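(* Let $2\le p<\infty$ and let $\Omega\subset\mathbb{R}^n$, $n\ge 2$, be a bounded domain. Let $\Omega_\infty=\Omega\times(0,\infty)$ and let $P_\infty=(\overline{\Omega}\times\{0\})\cup(\partial\Omega\times(0,\infty))$ be its parabolic boundary. Let $h\in C(P_\infty)$ be given by $h(x,0)=f(x)$ for $x\in\overline{\Omega}$ and $h(x,t)=g(x,t)$ for $(x,t)\in\partial\Omega\times[0,\infty)$, with $h\ge 0$ and $\sup_{P_\infty}h<\infty$. Let $u:\Omega_\infty\cup P_\infty\to[0,\infty)$ be upper semi-continuous and satisfy, in the viscosity sense, $$\Gamma_p u\ge 0\ \text{ in } \Omega_\infty,\qquad u\le h\ \text{ on } P_\infty .$$ (i) If $\lim_{t\to\infty}\big(\sup_{x\in\partial\Omega}g(x,t)\big)=0$, then $\lim_{t\to\infty}\big(\sup_{\Omega\times[t,\infty)}u\big)=0$. (ii) Moreover, if there is $T_0\ge 0$ such that $g(x,t)=0$ for all $(x,t)\in\partial\Omega\times[T_0,\infty)$, then $$\limsup_{t\to\infty}\frac{\log\big(\sup_{x\in\Omega}u(x,t)\big)}{t}\le-\frac{\lambda_\Omega}{p-1},$$ where $\lambda_\Omega$ is the first eigenvalue of $\Delta_p$ on $\Omega$ and $\log 0=-\infty$.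
   Context: For $2\le p<\infty$, $\Delta_p w=\mathrm{div}(|Dw|^{p-2}Dw)$ (derivatives in $x$ only) and $\Gamma_p u=\Delta_p u-(p-1)u^{p-2}u_t$. For a $C^2$ function $\psi$ of $x$, $\Delta_p\psi=|D\psi|^{p-2}\Delta\psi+(p-2)|D\psi|^{p-4}\sum_{i,j}D_i\psi D_j\psi D_{ij}\psi$ where $D\psi\ne0$; for $p>2$ it is $0$ where $D\psi=0$; for $p=2$ it is $\Delta\psi$. Viscosity sub-solution: an upper semi-continuous $u\ge 0$ satisfies $\Gamma_p u\ge 0$ in $\Omega_\infty$ if for every function $\psi(x,t)$, $C^2$ in $x$ and $C^1$ in $t$, such that $u-\psi$ has a local maximum at a point $(y,s)\in\Omega_\infty$, one has $\Delta_p\psi(y,s)-(p-1)u(y,s)^{p-2}\psi_t(y,s)\ge 0$ (with $u^{p-2}=1$ when $p=2$). That $h\in C(P_\infty)$ means $f\in C(\overline{\Omega})$, $g\in C(\partial\Omega\times[0,\infty))$ and $\lim_{y\to x}f(y)=g(x,0)$ for each $x\in\partial\Omega$. First eigenvalue: fix $\delta>0$ and let $E_\Omega$ be the set of $\lambda\ge 0$ for which there is a positive $v\in C(\overline{\Omega})$ with $\Delta_p v+\lambda v^{p-1}=0$ in $\Omega$ (in the viscosity sense) and $v=\delta$ on $\partial\Omega$. Then $\lambda_\Omega=\sup E_\Omega$ (independent of $\delta$ by homogeneity). Here $v$ is a viscosity solution if for every $C^2$ function $\psi$: at any local maximum $y\in\Omega$ of $v-\psi$, $\Delta_p\psi(y)+\lambda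 v(y)^{p-1}\ge0$, and at any local minimum $y\in\Omega$ of $v-\psi$, $\Delta_p\psi(y)+\lambda v(y)^{p-1}\le0$. *)

theory Defs
  imports "HOL-Analysis.Analysis"
begin

definition upper_semicontinuous_on :: "'a::topological_space set \<Rightarrow> ('a \<Rightarrow> real) \<Rightarrow> bool" where
  "upper_semicontinuous_on S u \<longleftrightarrow>
     (\<forall>x\<in>S. \<forall>c. u x < c \<longrightarrow> (\<forall>\<^sub>F z in at x within S. u z < c))"

definition local_max_at :: "('a::topological_space \<Rightarrow> real) \<Rightarrow> 'a \<Rightarrow> bool" where
  "local_max_at w y \<longleftrightarrow> (\<forall>\<^sub>F z in nhds y. w z \<le> w y)"

definition local_min_at :: "('a::topological_space \<Rightarrow> real) \<Rightarrow> 'a \<Rightarrow> bool" where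
  "local_min_at w y \<longleftrightarrow> (\<forall>\<^sub>F z in nhds y. w y \<le> w z)"

text \<open>Partial derivatives are meaningful only where the function is differentiable; the
  predicates \<open>C2_on\<close> and \<open>C21_on\<close> below guarantee this on open sets.\<close>

definition partial :: "'a::euclidean_space \<Rightarrow> ('a \<Rightarrow> real) \<Rightarrow> 'a \<Rightarrow> real" where
  "partial i \<psi> x = frechet_derivative \<psi> (at x) i"

definition gradient :: "('a::euclidean_space \<Rightarrow> real) \<Rightarrow> 'a \<Rightarrow> 'a" where
  "gradient \<psi> x = (\<Sum>i\<in>Basis. partial i \<psi> x *\<^sub>R i)"

definition laplacian :: "('a::euclidean_space \<Rightarrow> real) \<Rightarrow> 'a \<Rightarrow> real" where
  "laplacian \<psi> x = (\<Sum>i\<in>Basis. partial i (partial i \<psi>) x)"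

definition p_laplacian :: "real \<Rightarrow> ('a::euclidean_space \<Rightarrow> real) \<Rightarrow> 'a \<Rightarrow> real" where
  "p_laplacian p \<psi> x =
     (if p = 2 then laplacian \<psi> x
      else if gradient \<psi> x = 0 then 0
      else norm (gradient \<psi> x) powr (p - 2) * laplacian \<psi> x
         + (p - 2) * norm (gradient \<psi> x) powr (p - 4)
           * (\<Sum>i\<in>Basis. \<Sum>j\<in>Basis.
                partial i \<psi> x * partial j \<psi> x * partial i (partial j \<psi>) x))"

definition C2_on :: "'a::euclidean_space set \<Rightarrow> ('a \<Rightarrow> real) \<Rightarrow> bool" where
  "C2_on S \<psi> \<longleftrightarrow>
     (\<forall>x\<in>S. \<psi> differentiable (at x)) \<and>
     (\<forall>i\<in>Basis. \<forall>x\<in>S. partial i \<psi> differentiable (at x)) \<and>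
     (\<forall>i\<in>Basis. \<forall>j\<in>Basis. continuous_on S (partial i (partial j \<psi>)))"

text \<open>Functions of \<open>(x, t)\<close> that are \<open>C\<^sup>2\<close> in \<open>x\<close> and \<open>C\<^sup>1\<close> in \<open>t\<close>: the function and its
  derivatives \<open>D\<^sub>i\<psi>\<close>, \<open>D\<^sub>i\<^sub>j\<psi>\<close>, \<open>\<psi>\<^sub>t\<close> exist and are continuous jointly in \<open>(x, t)\<close>.\<close>

definition C21_on :: "('a::euclidean_space \<times> real) set \<Rightarrow> ('a \<times> real \<Rightarrow> real) \<Rightarrow> bool" where
  "C21_on S \<psi> \<longleftrightarrow>
     (\<forall>(x, t)\<in>S.
        (\<lambda>z. \<psi> (z, t)) differentiable (at x) \<and>
        (\<forall>i\<in>Basis. partial i (\<lambda>z. \<psi> (z, t)) differentiable (at x)) \<and>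
        (\<lambda>\<tau>. \<psi> (x, \<tau>)) field_differentiable (at t)) \<and>
     continuous_on S \<psi> \<and>
     (\<forall>i\<in>Basis. continuous_on S (\<lambda>(x, t). partial i (\<lambda>z. \<psi> (z, t)) x)) \<and>
     (\<forall>i\<in>Basis. \<forall>j\<in>Basis.
        continuous_on S (\<lambda>(x, t). partial i (partial j (\<lambda>z. \<psi> (z, t))) x)) \<and>
     continuous_on S (\<lambda>(x, t). deriv (\<lambda>\<tau>. \<psi> (x, \<tau>)) t)"

definition space_time :: "'a set \<Rightarrow> ('a \<times> real) set" where
  "space_time \<Omega> = \<Omega> \<times> {0<..}"

definition parabolic_boundary :: "'a::topological_space set \<Rightarrow> ('a \<times> real) set" where
  "parabolic_boundary \<Omega> = closure \<Omega> \<times> {0} \<union> frontier \<Omega> \<times> {0<..}"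

text \<open>The case distinction is needed because \<open>0 powr 0 = 0\<close>, whereas \<open>u\<^sup>p\<^sup>-\<^sup>2 = 1\<close> is
  meant for \<open>p = 2\<close>, also where \<open>u = 0\<close>.\<close>

definition viscosity_subsolution ::
    "real \<Rightarrow> 'a::euclidean_space set \<Rightarrow> ('a \<times> real \<Rightarrow> real) \<Rightarrow> bool" where
  "viscosity_subsolution p \<Omega> u \<longleftrightarrow>
     (\<forall>\<psi> y s. C21_on (space_time \<Omega>) \<psi> \<and> (y, s) \<in> space_time \<Omega> \<and>
        local_max_at (\<lambda>z. u z - \<psi> z) (y, s) \<longrightarrow>
        p_laplacian p (\<lambda>x. \<psi> (x, s)) y
          - (p - 1) * (if p = 2 then 1 else u (y, s) powr (p - 2))
              * deriv (\<lambda>\<tau>. \<psi> (y, \<tau>)) s \<ge> 0)"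

text \<open>The condition \<open>h \<in> C(P\<^sub>\<infinity>)\<close>, where \<open>h\<close> is composed of the initial values \<open>f\<close> and the
  lateral values \<open>g\<close>.\<close>

definition continuous_boundary_data ::
    "'a::euclidean_space set \<Rightarrow> ('a \<Rightarrow> real) \<Rightarrow> ('a \<times> real \<Rightarrow> real) \<Rightarrow> ('a \<times> real \<Rightarrow> real) \<Rightarrow> bool" where
  "continuous_boundary_data \<Omega> f g h \<longleftrightarrow>
     (\<forall>x\<in>closure \<Omega>. h (x, 0) = f x) \<and>
     (\<forall>x\<in>frontier \<Omega>. \<forall>t\<ge>0. h (x, t) = g (x, t)) \<and>
     continuous_on (closure \<Omega>) f \<and>
     continuous_on (frontier \<Omega> \<times> {0..}) g \<and>
     (\<forall>x\<in>frontier \<Omega>. (f \<longlongrightarrow> g (x, 0)) (at x within closure \<Omega>))"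

definition eigen_viscosity_solution ::
    "real \<Rightarrow> real \<Rightarrow> 'a::euclidean_space set \<Rightarrow> ('a \<Rightarrow> real) \<Rightarrow> bool" where
  "eigen_viscosity_solution p \<mu> \<Omega> v \<longleftrightarrow>
     (\<forall>\<psi> y. C2_on \<Omega> \<psi> \<and> y \<in> \<Omega> \<longrightarrow>
        (local_max_at (\<lambda>x. v x - \<psi> x) y \<longrightarrow>
           p_laplacian p \<psi> y + \<mu> * v y powr (p - 1) \<ge> 0) \<and>
        (local_min_at (\<lambda>x. v x - \<psi> x) y \<longrightarrow>
           p_laplacian p \<psi> y + \<mu> * v y powr (p - 1) \<le> 0))"

definition eigen_set :: "real \<Rightarrow> real \<Rightarrow> 'a::euclidean_space set \<Rightarrow> real set" where
  "eigen_set p \<delta> \<Omega> =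
     {\<mu>. \<mu> \<ge> 0 \<and>
        (\<exists>v. continuous_on (closure \<Omega>) v \<and> (\<forall>x\<in>closure \<Omega>. v x > 0) \<and>
             eigen_viscosity_solution p \<mu> \<Omega> v \<and> (\<forall>x\<in>frontier \<Omega>. v x = \<delta>))}"

text \<open>The supremum is taken in the extended reals, so that no boundedness of the set has to be
  presupposed.\<close>

definition first_eigenvalue :: "real \<Rightarrow> real \<Rightarrow> 'a::euclidean_space set \<Rightarrow> ereal" where
  "first_eigenvalue p \<delta> \<Omega> = (SUP \<mu>\<in>eigen_set p \<delta> \<Omega>. ereal \<mu>)"

definition elog :: "ereal \<Rightarrow> ereal" where
  "elog x = (if x \<le> 0 then - \<infinity> else if x = \<infinity> then \<infinity> else ereal (ln (real_of_ereal x)))"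

end

theory Submission
  imports Defs "HOL-Library.Function_Algebras"
begin

text \<open>Comparison of \<open>u\<close> with \<open>C v exp (- m t)\<close>, where \<open>v\<close> is a positive supersolution of
  \<open>\<Delta>\<^sub>p v + \<Lambda> v\<^sup>p\<^sup>-\<^sup>1 = 0\<close> and \<open>(p - 1) m < \<Lambda>\<close>, gives both parts: for (i), \<open>v\<close> is the
  exponential of an explicit quadratic polynomial; for (ii), \<open>v\<close> is a competitor in the definition
  of \<open>\<lambda>\<^sub>\<Omega>\<close> and \<open>m\<close> is arbitrarily close to \<open>\<Lambda> / (p - 1)\<close>.

  Maximising \<open>u exp (m t)\<close> over \<open>t\<close> reduces this to an elliptic comparison. In terms of
  logarithms the equation has no zero-order term, so sup- and inf-convolution preserve sub- and
  supersolutions. Where the two convolutions touch they are differentiable with a common gradient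
  \<open>q\<^sub>0\<close>, and the Hessians of test functions are bounded on one side. Hence, near that point, both
  inequalities persist for the linear operator whose coefficients are frozen at \<open>q\<^sub>0\<close> and made
  uniformly elliptic. For this operator the Dirichlet problem on a ball with polynomial data has a
  polynomial solution, which separates the two convolutions; this replaces the theorem on sums.\<close>

section \<open>Polynomials of bounded degree\<close>

text \<open>The function u is merely upper semicontinuous and the operator degenerates where the
  gradient vanishes, so neither a pointwise Hessian nor uniform ellipticity is at hand. Freezing the
  coefficients succeeds for two reasons. The coefficient matrix is continuous in the gradient, also
  at 0; and if X + \<beta> I is nonnegative, its symmetrised entries are controlled by its trace, so
  that a multiple \<omega> of the Laplacian, as small as desired, absorbs the oscillation of the
  coefficients at a cost proportional to \<omega>\<beta>. This cost and all other errors are paid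
  from the strict gap between (p - 1) m and \<Lambda>, which is why the critical rate is reached
  only as a limit. Constant coefficients and polynomial data on a ball keep the separating functions
  polynomial; accordingly every test function is built from the exponential of a polynomial, for
  which the p-Laplacian is computed exactly. The coefficients are even in the gradient, so 1 / v can
  be treated by the same lemma as w.\<close>

lemma (in vector_space) linear_inj_on_finite_dim_surj:
  assumes W: "subspace W" "W \<subseteq> span F" "finite F"
    and TW: "\<And>x. x \<in> W \<Longrightarrow> T x \<in> W"
    and add: "\<And>x y. x \<in> W \<Longrightarrow> y \<in> W \<Longrightarrow> T (x + y) = T x + T y"
    and scl: "\<And>c x. x \<in> W \<Longrightarrow> T (scale c x) = scale c (T x)"
    and inj: "\<And>x. x \<in> W \<Longrightarrow> T x = 0 \<Longrightarrow> x = 0"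
    and y: "y \<in> W"
  shows "\<exists>x\<in>W. T x = y"
proof -
  \<comment> \<open>T maps a basis B of W to an independent family of the same size; a vector of W
    outside the span of that family would give more independent vectors in \<open>span B\<close>
    than B has. Linearity of T is asked on W only, which fits \<open>lin_op\<close>: its additivity
    is shown for polynomials, where all derivatives exist.\<close>
  obtain B where B: "B \<subseteq> W" "independent B" "W \<subseteq> span B"
    using maximal_independent_subset by blast
  have finB: "finite B" "card B \<le> card F"
    using independent_span_bound[OF W(3) B(2)] B(1) W(2) by auto
  have spanB: "span B = W"
    using B W(1) span_minimal by blast
  have T0: "T 0 = 0"
    using scl[of 0 0] subspace_0[OF W(1)] by simp
  have sumW: "(\<Sum>b\<in>S. scale (c b) b) \<in> W" if "S \<subseteq> B" for S c
    using that B(1) W(1) by (meson subspace_scale subspace_sum subsetD)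
  have Tsum: "T (\<Sum>b\<in>S. scale (c b) b) = (\<Sum>b\<in>S. scale (c b) (T b))" if "S \<subseteq> B" for S c
  proof -
    have "finite S" using that finB finite_subset by blast
    then show ?thesis using that
    proof (induction S)
      case empty
      then show ?case by (simp add: T0)
    next
      case (insert b S)
      have "scale (c b) b \<in> W" "b \<in> W"
        using insert.prems B(1) W(1) subspace_scale by auto
      with insert sumW[of S c] show ?case
        by (simp add: add scl)
    qed
  qed
  have injT: "inj_on T B"
  proof (rule inj_onI)
    fix a b assume ab: "a \<in> B" "b \<in> B" "T a = T b"
    have aW: "a \<in> W" "b \<in> W" using ab B by auto
    have "T (a + scale (-1) b) = T a + scale (-1) (T b)"
      using add[of a "scale (-1) b"] scl[of b "-1"] aW subspace_scale[OF W(1), of b "-1"] by simp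
    then have "T (a - b) = 0" using ab by simp
    then show "a = b" using inj[of "a - b"] aW subspace_diff[OF W(1)] by auto
  qed
  have indT: "independent (T ` B)"
  proof
    assume "dependent (T ` B)"
    then obtain u where u: "\<exists>v\<in>T ` B. u v \<noteq> 0" "(\<Sum>v\<in>T ` B. scale (u v) v) = 0"
      unfolding dependent_finite[OF finite_imageI[OF finB(1), of T]] by blast
    have "T (\<Sum>b\<in>B. scale (u (T b)) b) = 0"
      using u(2) Tsum[of B "\<lambda>b. u (T b)"] by (simp add: sum.reindex[OF injT])
    then have "(\<Sum>b\<in>B. scale (u (T b)) b) = 0"
      using inj[OF sumW[of B "\<lambda>b. u (T b)"]] by simp
    then have "\<forall>b\<in>B. u (T b) = 0"
      using B(2)[unfolded dependent_finite[OF finB(1)], unfolded not_ex, rule_format, of "\<lambda>b. u (T b)"]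
      by blast
    with u(1) show False by auto
  qed
  have "y \<in> span (T ` B)"
  proof (rule ccontr)
    assume ny: "y \<notin> span (T ` B)"
    then have "independent (insert y (T ` B))"
      using indT independent_insertI by blast
    moreover have "insert y (T ` B) \<subseteq> span B"
      using spanB y TW B(1) by auto
    ultimately have "card (insert y (T ` B)) \<le> card B"
      using independent_span_bound finB(1) by blast
    moreover have "y \<notin> T ` B" using ny span_base by blast
    ultimately show False
      using finB(1) injT by (simp add: card_image)
  qed
  moreover have "span (T ` B) \<subseteq> T ` W"
  proof (rule span_minimal)
    show "T ` B \<subseteq> T ` W" using B by auto
    show "subspace (T ` W)"
      unfolding subspace_def
    proof safe
      show "0 \<in> T ` W" using T0 subspace_0[OF W(1)] by (metis imageI)
    next
      fix a b assume "a \<in> W" "b \<in> W"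
      then show "T a + T b \<in> T ` W" using add[of a b] subspace_add[OF W(1), of a b] by (metis imageI)
    next
      fix c a assume "a \<in> W"
      then show "scale c (T a) \<in> T ` W" using scl[of a c] subspace_scale[OF W(1), of a c] by (metis imageI)
    qed
  qed
  ultimately show ?thesis by auto
qed

section \<open>Calculus of partial derivatives\<close>

lemma has_derivative_partial:
  assumes "(f has_derivative f') (at x)"
  shows "partial i f x = f' i"
  using assms frechet_derivative_at unfolding partial_def by metis

lemma partial_add:
  assumes "f differentiable at x" "g differentiable at x"
  shows "partial i (\<lambda>x. f x + g x) x = partial i f x + partial i g x"
  using has_derivative_partial[OF has_derivative_add[OF assms[unfolded frechet_derivative_works]]]
  by (simp add: partial_def)

lemma partial_diff:
  assumes "f differentiable at x" "g differentiable at x"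
  shows "partial i (\<lambda>x. f x - g x) x = partial i f x - partial i g x"
  using has_derivative_partial[OF has_derivative_diff[OF assms[unfolded frechet_derivative_works]]]
  by (simp add: partial_def)

lemma partial_minus:
  assumes "f differentiable at x"
  shows "partial i (\<lambda>x. - f x) x = - partial i f x"
  using has_derivative_partial[OF has_derivative_minus[OF assms[unfolded frechet_derivative_works]]]
  by (simp add: partial_def)

lemma partial_mult:
  assumes "f differentiable at x" "g differentiable at x"
  shows "partial i (\<lambda>x. f x * g x) x = f x * partial i g x + partial i f x * g x"
proof -
  have "((\<lambda>x. f x * g x) has_derivative
      (\<lambda>h. f x * frechet_derivative g (at x) h + frechet_derivative f (at x) h * g x)) (at x)"
    using assms by (intro has_derivative_mult) (auto simp: frechet_derivative_works)
  then show ?thesis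
    using has_derivative_partial unfolding partial_def by metis
qed

lemma partial_const [simp]: "partial i (\<lambda>x. c) = (\<lambda>x. 0)"
  by (auto simp: partial_def)

lemma partial_inner:
  "partial i (\<lambda>x. x \<bullet> b) = (\<lambda>x. i \<bullet> b)"
proof
  fix x
  have "((\<lambda>x. x \<bullet> b) has_derivative (\<lambda>x. x \<bullet> b)) (at x)"
    by (auto intro!: derivative_eq_intros)
  then show "partial i (\<lambda>x. x \<bullet> b) x = i \<bullet> b"
    using has_derivative_partial by blast
qed

lemma partial_exp:
  assumes "f differentiable at x"
  shows "partial i (\<lambda>x. exp (f x)) x = partial i f x * exp (f x)"
proof -
  have "(f has_derivative frechet_derivative f (at x)) (at x)"
    using assms frechet_derivative_works by blast
  from has_derivative_exp[OF this] show ?thesis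
    using has_derivative_partial[of "\<lambda>x. exp (f x)"] unfolding partial_def by fastforce
qed

lemma partial_translate:
  assumes "f differentiable at (x + a)"
  shows "partial i (\<lambda>x. f (x + a)) x = partial i f (x + a)"
proof -
  have "(f has_derivative frechet_derivative f (at (x + a))) (at (x + a))"
    using assms frechet_derivative_works by blast
  moreover have "((\<lambda>x. x + a) has_derivative (\<lambda>h. h)) (at x)"
    by (auto intro!: derivative_eq_intros)
  ultimately have "((\<lambda>x. f (x + a)) has_derivative frechet_derivative f (at (x + a))) (at x)"
    using has_derivative_compose by fastforce
  then show ?thesis
    using has_derivative_partial unfolding partial_def by metis
qed

lemma frechet_derivative_eq_sum_partial:
  fixes f :: "'a::euclidean_space \<Rightarrow> real"
  assumes "f differentiable at x"
  shows "frechet_derivative f (at x) h = (\<Sum>i\<in>Basis. (h \<bullet> i) * partial i f x)"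
proof -
  interpret bounded_linear "frechet_derivative f (at x)"
    using assms frechet_derivative_works has_derivative_bounded_linear by blast
  have "frechet_derivative f (at x) h = frechet_derivative f (at x) (\<Sum>i\<in>Basis. (h \<bullet> i) *\<^sub>R i)"
    by (simp add: euclidean_representation)
  then show ?thesis by (simp add: sum scaleR partial_def)
qed

lemma gradient_inner: "i \<in> Basis \<Longrightarrow> gradient f x \<bullet> i = partial i f x"
  unfolding gradient_def by simp

text \<open>Polynomials with a bound on the total degree. The bound is carried along because the
  Dirichlet problem is solved inside the polynomials of one fixed degree bound, a finite-dimensional
  space in which injectivity gives surjectivity.\<close>

inductive poly_le :: "nat \<Rightarrow> ('a::euclidean_space \<Rightarrow> real) \<Rightarrow> bool" where
  const: "poly_le k (\<lambda>x. c)"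
| coord: "b \<in> Basis \<Longrightarrow> poly_le k f \<Longrightarrow> poly_le (Suc k) (\<lambda>x. (x \<bullet> b) * f x)"
| add: "poly_le k f \<Longrightarrow> poly_le k g \<Longrightarrow> poly_le k (\<lambda>x. f x + g x)"
| weaken: "poly_le k f \<Longrightarrow> poly_le (Suc k) f"

lemma poly_le_mono: "poly_le k f \<Longrightarrow> k \<le> l \<Longrightarrow> poly_le l f"
  by (induction l rule: nat_induct) (auto simp: le_Suc_eq intro: poly_le.weaken)

lemma poly_le_cmult: "poly_le k f \<Longrightarrow> poly_le k (\<lambda>x. c * f x)"
proof (induction rule: poly_le.induct)
  case (coord b k f)
  from poly_le.coord[OF coord(1) coord(3)] show ?case by (simp add: mult.left_commute)
next
  case (add k f g)
  from poly_le.add[OF add(3,4)] show ?case by (simp add: distrib_left)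
qed (auto intro: poly_le.intros)

lemma poly_le_mult: "poly_le k f \<Longrightarrow> poly_le l g \<Longrightarrow> poly_le (k + l) (\<lambda>x. f x * g x)"
proof (induction rule: poly_le.induct)
  case (const k c)
  then show ?case by (auto intro: poly_le_cmult poly_le_mono)
next
  case (coord b k f)
  from poly_le.coord[OF coord(1) coord(3)[OF coord(4)]] show ?case by (simp add: mult.assoc)
next
  case (add k f g)
  from poly_le.add[OF add(3,4)[OF add(5)]] show ?case by (simp add: distrib_right)
qed (auto intro: poly_le.intros)

lemma poly_le_sum:
  "finite I \<Longrightarrow> (\<And>i. i \<in> I \<Longrightarrow> poly_le k (f i)) \<Longrightarrow> poly_le k (\<lambda>x. \<Sum>i\<in>I. f i x)"
  by (induction I rule: finite_induct) (auto intro: poly_le.intros)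

lemma poly_le_real_polynomial_function: "poly_le k f \<Longrightarrow> real_polynomial_function f"
proof (induction rule: poly_le.induct)
  case (coord b k f)
  then show ?case
    using real_polynomial_function.intros(4)[OF real_polynomial_function.intros(1)[OF bounded_linear_inner_left]]
    by blast
qed (simp_all add: real_polynomial_function.intros(2,3))

lemma real_polynomial_function_imp_poly_le:
  assumes "real_polynomial_function f"
  shows "\<exists>k. poly_le k f"
  using assms
proof induction
  case (linear f)
  have "poly_le 1 (\<lambda>x. \<Sum>b\<in>Basis. f b * (x \<bullet> b))"
  proof (intro poly_le_sum)
    fix b :: 'a assume "b \<in> Basis"
    then have "poly_le (Suc 0) (\<lambda>x. (x \<bullet> b) * f b)"
      by (intro poly_le.intros)
    then show "poly_le 1 (\<lambda>x. f b * (x \<bullet> b))" by (simp add: mult.commute)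
  qed simp
  moreover have "f = (\<lambda>x. \<Sum>b\<in>Basis. f b * (x \<bullet> b))"
  proof
    fix x
    interpret bounded_linear f by fact
    have "f x = f (\<Sum>b\<in>Basis. (x \<bullet> b) *\<^sub>R b)"
      by (simp add: euclidean_representation)
    then show "f x = (\<Sum>b\<in>Basis. f b * (x \<bullet> b))" by (simp add: sum scaleR mult.commute)
  qed
  ultimately show ?case by metis
next
  case (const c)
  then show ?case using poly_le.const by blast
next
  case (add f g)
  then obtain k l where "poly_le k f" "poly_le l g" by blast
  then have "poly_le (max k l) f" "poly_le (max k l) g"
    by (auto intro: poly_le_mono)
  then show ?case using poly_le.add by blast
next
  case (mult f g)
  then show ?case using poly_le_mult by blast
qed

lemma real_polynomial_differentiable:
  "real_polynomial_function f \<Longrightarrow> f differentiable (at x)"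
  for f :: "'a::euclidean_space \<Rightarrow> real"
  by (simp add: differentiable_at_real_polynomial_function)

lemma poly_le_differentiable: "poly_le k f \<Longrightarrow> f differentiable (at x)"
  using poly_le_real_polynomial_function real_polynomial_differentiable by blast

text \<open>Truncated subtraction alone would lose the fact that degree 0 has derivative 0. The
  second conjunct keeps it for the case of a coordinate times a constant: there the product rule
  leaves the coordinate times that derivative, which must again have degree 0.\<close>

lemma poly_le_partial:
  "poly_le k f \<Longrightarrow> poly_le (k - 1) (partial i f) \<and> (k = 0 \<longrightarrow> partial i f = (\<lambda>x. 0))"
proof (induction rule: poly_le.induct)
  case (const k c)
  then show ?case by (auto intro: poly_le.const)
next
  case (coord b k f)
  have *: "partial i (\<lambda>x. (x \<bullet> b) * f x) = (\<lambda>x. (x \<bullet> b) * partial i f x + (i \<bullet> b) * f x)"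
    using partial_inner[of i b] poly_le_differentiable[OF coord(2)]
    by (auto simp: partial_mult fun_eq_iff)
  have "poly_le k (\<lambda>x. (x \<bullet> b) * partial i f x)"
  proof (cases k)
    case 0
    then show ?thesis using coord by (auto intro: poly_le.const)
  next
    case (Suc m)
    then show ?thesis using coord by (auto intro: poly_le.coord)
  qed
  then show ?case
    using poly_le.add[OF _ poly_le_cmult[OF coord(2)], of "\<lambda>x. (x \<bullet> b) * partial i f x"] by (simp add: *)
next
  case (add k f g)
  have "partial i (\<lambda>x. f x + g x) = (\<lambda>x. partial i f x + partial i g x)"
    by (simp add: fun_eq_iff partial_add poly_le_differentiable[OF add(1)] poly_le_differentiable[OF add(2)])
  with add show ?case by (auto intro: poly_le.add)
next
  case (weaken k f)
  then show ?case by (auto intro: poly_le_mono)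
qed

lemma real_polynomial_partial:
  fixes f :: "'a::euclidean_space \<Rightarrow> real"
  shows "real_polynomial_function f \<Longrightarrow> real_polynomial_function (partial i f)"
  using real_polynomial_function_imp_poly_le poly_le_partial poly_le_real_polynomial_function
  by blast

lemma poly_le_finite_span:
  fixes k :: nat
  defines "S \<equiv> (\<lambda>(c::real) (f::'a::euclidean_space \<Rightarrow> real) x. c * f x)"
  shows "\<exists>F. finite F \<and> {f. poly_le k f} \<subseteq> module.span S F"
proof -
  interpret vector_space S
    by unfold_locales (auto simp: S_def fun_eq_iff algebra_simps)
  have "\<exists>F. finite F \<and> (\<forall>f. poly_le k f \<longrightarrow> f \<in> span F)"
  proof -
    \<comment> \<open>\<open>F k\<close> consists of the products of at most k coordinate functions,
      generated from the constant 1.\<close>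
    define F where "F \<equiv> rec_nat {\<lambda>x. 1} (\<lambda>_ F. F \<union> (\<lambda>(b, f) x. (x \<bullet> b) * f x) ` ((Basis::'a set) \<times> F))"
    have F0: "F 0 = {\<lambda>x. 1}" and FS: "\<And>k. F (Suc k) = F k \<union> (\<lambda>(b, f) x. (x \<bullet> b) * f x) ` (Basis \<times> F k)"
      by (auto simp: F_def)
    have finF: "finite (F k)" for k
      by (induction k) (auto simp: F0 FS)
    have one: "(\<lambda>x. 1) \<in> F k" for k
      by (induction k) (auto simp: F0 FS)
    have "f \<in> span (F k)" if "poly_le k f" for f k
      using that
    proof (induction)
      case (const k c)
      have "(\<lambda>x. c) = S c (\<lambda>x. 1)" by (simp add: S_def)
      then show ?case using one span_base span_scale by metis
    next
      case (coord b k f)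
      have "S a = (\<lambda>f x. a * f x)" for a by (simp add: S_def)
      show ?case
        using coord(3)
      proof (induction f rule: span_induct_alt)
        case base
        have "(\<lambda>x. (x \<bullet> b) * (0::'a \<Rightarrow> real) x) = 0" by (auto simp: fun_eq_iff)
        then show ?case using span_zero by metis
      next
        case (step c f g)
        have "(\<lambda>x. (x \<bullet> b) * f x) \<in> F (Suc k)"
          using step coord(1) by (auto simp: FS image_iff intro: bexI[of _ "(b, f)"])
        then have "S c (\<lambda>x. (x \<bullet> b) * f x) + (\<lambda>x. (x \<bullet> b) * g x) \<in> span (F (Suc k))"
          using step by (auto intro: span_add span_scale span_base)
        moreover have "S c (\<lambda>x. (x \<bullet> b) * f x) + (\<lambda>x. (x \<bullet> b) * g x)
            = (\<lambda>x. (x \<bullet> b) * (S c f + g) x)"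
          by (auto simp: S_def fun_eq_iff algebra_simps)
        ultimately show ?case by simp
      qed
    next
      case (add k f g)
      then have "f + g \<in> span (F k)" by (simp add: span_add)
      then show ?case by (simp add: plus_fun_def)
    next
      case (weaken k f)
      then show ?case using span_mono[of "F k" "F (Suc k)"] FS by auto
    qed
    then show ?thesis using finF by blast
  qed
  then show ?thesis by auto
qed

section \<open>The Dirichlet problem for constant coefficients\<close>

lemma real_polynomial_has_derivative_line:
  fixes f :: "'a::euclidean_space \<Rightarrow> real"
  assumes "real_polynomial_function f"
  shows "((\<lambda>s. f (x + s *\<^sub>R h)) has_real_derivative
    (\<Sum>j\<in>Basis. (h \<bullet> j) * partial j f (x + s *\<^sub>R h))) (at s)"
proof -
  have d: "f differentiable (at (x + s *\<^sub>R h))"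
    using assms real_polynomial_differentiable by blast
  then have "(f has_derivative frechet_derivative f (at (x + s *\<^sub>R h))) (at (x + s *\<^sub>R h))"
    using frechet_derivative_works by blast
  moreover have "((\<lambda>s. x + s *\<^sub>R h) has_derivative (\<lambda>t. t *\<^sub>R h)) (at s)"
    by (auto intro!: derivative_eq_intros)
  ultimately have "((\<lambda>s. f (x + s *\<^sub>R h)) has_derivative
      (\<lambda>t. frechet_derivative f (at (x + s *\<^sub>R h)) (t *\<^sub>R h))) (at s)"
    using has_derivative_compose by fastforce
  moreover have "(\<lambda>t. frechet_derivative f (at (x + s *\<^sub>R h)) (t *\<^sub>R h))
      = (\<lambda>t. (\<Sum>j\<in>Basis. (h \<bullet> j) * partial j f (x + s *\<^sub>R h)) * t)"
    by (simp add: frechet_derivative_eq_sum_partial[OF d] sum_distrib_left mult_ac)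
  ultimately show ?thesis
    by (simp add: has_field_derivative_def)
qed

text \<open>On the line through x in direction h, a negative second derivative at 0 would make the
  first derivative, which vanishes at 0, negative just after 0; the mean value theorem would then
  produce a smaller value of f.\<close>

lemma real_polynomial_local_min:
  fixes f :: "'a::euclidean_space \<Rightarrow> real"
  assumes f: "real_polynomial_function f" and min: "local_min_at f x"
  shows "i \<in> Basis \<Longrightarrow> partial i f x = 0"
    and "0 \<le> (\<Sum>i\<in>Basis. \<Sum>j\<in>Basis. (h \<bullet> i) * (h \<bullet> j) * partial i (partial j f) x)"
proof -
  have near: "\<exists>d>0. \<forall>s. \<bar>s\<bar> < d \<longrightarrow> f x \<le> f (x + s *\<^sub>R h)" for h
  proof -
    obtain e where e: "e > 0" "\<And>z. dist z x < e \<Longrightarrow> f x \<le> f z"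
      using min unfolding local_min_at_def eventually_nhds_metric by blast
    have "norm (s *\<^sub>R h) < e" if "\<bar>s\<bar> < e / (norm h + 1)" for s
    proof -
      have "\<bar>s\<bar> * norm h \<le> \<bar>s\<bar> * (norm h + 1)" by (simp add: mult_left_mono)
      also have "\<dots> < e" using that by (simp add: pos_less_divide_eq add_nonneg_pos)
      finally show ?thesis by simp
    qed
    then have "\<forall>s. \<bar>s\<bar> < e / (norm h + 1) \<longrightarrow> f x \<le> f (x + s *\<^sub>R h)"
      using e by (simp add: dist_norm)
    moreover have "e / (norm h + 1) > 0" using e by (simp add: add_nonneg_pos)
    ultimately show ?thesis by blast
  qed
  define g1 where "g1 h s = (\<Sum>j\<in>Basis. (h \<bullet> j) * partial j f (x + s *\<^sub>R h))" for h s
  have D1: "((\<lambda>s. f (x + s *\<^sub>R h)) has_real_derivative g1 h s) (at s)" for h s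
    unfolding g1_def by (rule real_polynomial_has_derivative_line[OF f])
  have g10: "g1 h 0 = 0" for h
  proof -
    obtain d where d: "d > 0" "\<And>s. \<bar>s\<bar> < d \<Longrightarrow> f x \<le> f (x + s *\<^sub>R h)"
      using near[of h] by auto
    show ?thesis
      by (rule DERIV_local_min[OF D1 d(1)]) (use d(2) in auto)
  qed
  {
    assume i: "i \<in> Basis"
    have "g1 i 0 = partial i f x"
      using i by (simp add: g1_def inner_Basis if_distrib[of "\<lambda>c. c * _"] cong: if_cong)
    then show "partial i f x = 0" using g10 by simp
  }
  let ?g2 = "\<Sum>i\<in>Basis. \<Sum>j\<in>Basis. (h \<bullet> i) * (h \<bullet> j) * partial i (partial j f) x"
  have "(g1 h has_real_derivative (\<Sum>j\<in>Basis. (h \<bullet> j) * (\<Sum>i\<in>Basis. (h \<bullet> i) * partial i (partial j f) (x + 0 *\<^sub>R h)))) (at 0)"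
    unfolding g1_def
    by (intro DERIV_sum DERIV_cmult real_polynomial_has_derivative_line real_polynomial_partial f)
  moreover have "(\<Sum>j\<in>Basis. (h \<bullet> j) * (\<Sum>i\<in>Basis. (h \<bullet> i) * partial i (partial j f) (x + 0 *\<^sub>R h))) = ?g2"
    by (subst sum.swap) (simp add: sum_distrib_left mult_ac)
  ultimately have D2: "(g1 h has_real_derivative ?g2) (at 0)" by simp
  show "0 \<le> ?g2"
  proof (rule ccontr)
    assume "\<not> 0 \<le> ?g2"
    then obtain d where d: "d > 0" "\<And>s. 0 < s \<Longrightarrow> s < d \<Longrightarrow> g1 h s < 0"
      using DERIV_neg_dec_right[OF D2] g10 by auto
    obtain d' where d': "d' > 0" "\<And>s. \<bar>s\<bar> < d' \<Longrightarrow> f x \<le> f (x + s *\<^sub>R h)"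
      using near[of h] by auto
    define s where "s = min d d' / 2"
    have s: "0 < s" "s < d" "s < d'" using d(1) d'(1) by (auto simp: s_def)
    obtain z where z: "0 < z" "z < s" "f (x + s *\<^sub>R h) - f (x + 0 *\<^sub>R h) = (s - 0) * g1 h z"
      using MVT2[OF s(1) D1[of h]] by blast
    have "g1 h z < 0" using d(2) z s by auto
    then have "(s - 0) * g1 h z < 0" using s by (simp add: mult_pos_neg)
    then show False using z d'(2)[of s] s by auto
  qed
qed

section \<open>Operators with constant coefficients and their maximum principle\<close>

definition lin_op :: "('a::euclidean_space \<Rightarrow> 'a \<Rightarrow> real) \<Rightarrow> ('a \<Rightarrow> real) \<Rightarrow> 'a \<Rightarrow> real" where
  "lin_op c f x = (\<Sum>i\<in>Basis. \<Sum>j\<in>Basis. c i j * partial i (partial j f) x)"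

text \<open>Degenerate ellipticity by duality: c pairs nonnegatively with every X whose quadratic
  form is nonnegative, which is precisely the second-order information at a minimum. Antisymmetric X
  are included, so the condition also makes c symmetric on the basis.\<close>

definition elliptic :: "('a::euclidean_space \<Rightarrow> 'a \<Rightarrow> real) \<Rightarrow> bool" where
  "elliptic c \<longleftrightarrow> (\<forall>X. (\<forall>h. 0 \<le> (\<Sum>i\<in>Basis. \<Sum>j\<in>Basis. (h \<bullet> i) * (h \<bullet> j) * X i j)) \<longrightarrow>
     0 \<le> (\<Sum>i\<in>Basis. \<Sum>j\<in>Basis. c i j * X i j))"

lemma lin_op_local_min:
  assumes "elliptic c" "real_polynomial_function f" "local_min_at f x"
  shows "0 \<le> lin_op c f x"
proof -
  have "\<forall>h. 0 \<le> (\<Sum>i\<in>Basis. \<Sum>j\<in>Basis. (h \<bullet> i) * (h \<bullet> j) * partial i (partial j f) x)"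
    using real_polynomial_local_min(2)[OF assms(2,3)] by blast
  then show ?thesis unfolding lin_op_def
    by (rule assms(1)[unfolded elliptic_def, THEN spec, THEN mp])
qed

lemma partial_partial_add:
  fixes f g :: "'a::euclidean_space \<Rightarrow> real"
  assumes "real_polynomial_function f" "real_polynomial_function g"
  shows "partial i (partial j (\<lambda>x. f x + g x)) x = partial i (partial j f) x + partial i (partial j g) x"
proof -
  have "partial j (\<lambda>x. f x + g x) = (\<lambda>x. partial j f x + partial j g x)"
    using assms by (simp add: fun_eq_iff partial_add real_polynomial_differentiable)
  then show ?thesis
    using assms by (simp add: partial_add real_polynomial_differentiable real_polynomial_partial)
qed

lemma partial_cmult:
  assumes "f differentiable at x"
  shows "partial i (\<lambda>x. c * f x) x = c * partial i f x"
  using partial_mult[OF differentiable_const assms, of i c] by simp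

lemma partial_partial_cmult:
  fixes f :: "'a::euclidean_space \<Rightarrow> real"
  assumes "real_polynomial_function f"
  shows "partial i (partial j (\<lambda>x. c * f x)) x = c * partial i (partial j f) x"
proof -
  have "partial j (\<lambda>x. c * f x) = (\<lambda>x. c * partial j f x)"
    using assms by (simp add: fun_eq_iff partial_cmult real_polynomial_differentiable)
  then show ?thesis
    using assms by (simp add: partial_cmult real_polynomial_differentiable real_polynomial_partial)
qed

lemma lin_op_add:
  assumes "real_polynomial_function f" "real_polynomial_function g"
  shows "lin_op c (\<lambda>x. f x + g x) x = lin_op c f x + lin_op c g x"
  by (simp add: lin_op_def partial_partial_add[OF assms] distrib_left sum.distrib)

lemma lin_op_cmult:
  assumes "real_polynomial_function f"
  shows "lin_op c (\<lambda>x. a * f x) x = a * lin_op c f x"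
  by (simp add: lin_op_def partial_partial_cmult[OF assms] sum_distrib_left mult_ac)

lemma lin_op_const [simp]: "lin_op c (\<lambda>x. a) x = 0"
  by (simp add: lin_op_def)

lemma lin_op_minus:
  assumes "real_polynomial_function f"
  shows "lin_op c (\<lambda>x. - f x) x = - lin_op c f x"
  using lin_op_cmult[OF assms, of c "-1" x] by simp

lemma lin_op_diff:
  assumes "real_polynomial_function f" "real_polynomial_function g"
  shows "lin_op c (\<lambda>x. f x - g x) x = lin_op c f x - lin_op c g x"
  using lin_op_add[OF assms(1) real_polynomial_function_minus[OF assms(2)], of c x] assms
  by (simp add: lin_op_minus)

lemma partial_norm_sq: "partial i (\<lambda>x. (norm (x - a))\<^sup>2) = (\<lambda>x. 2 * ((x - a) \<bullet> i))"
proof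
  fix x
  have "((\<lambda>x. (x - a) \<bullet> (x - a)) has_derivative (\<lambda>h. (x - a) \<bullet> h + h \<bullet> (x - a))) (at x)"
    by (auto intro!: derivative_eq_intros)
  then have "partial i (\<lambda>x. (x - a) \<bullet> (x - a)) x = 2 * ((x - a) \<bullet> i)"
    using has_derivative_partial by (fastforce simp: inner_commute)
  then show "partial i (\<lambda>x. (norm (x - a))\<^sup>2) x = 2 * ((x - a) \<bullet> i)"
    by (simp add: power2_norm_eq_inner)
qed

lemma partial_partial_norm_sq:
  "partial i (partial j (\<lambda>x. (norm (x - a))\<^sup>2)) x = 2 * (i \<bullet> j)"
proof -
  have "((\<lambda>x. 2 * ((x - a) \<bullet> j)) has_derivative (\<lambda>h. 2 * (h \<bullet> j))) (at x)"
    by (auto intro!: derivative_eq_intros)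
  then show ?thesis
    using has_derivative_partial by (fastforce simp: partial_norm_sq)
qed

lemma poly_le_norm_sq: "poly_le 2 (\<lambda>x::'a::euclidean_space. (norm (x - a))\<^sup>2)"
proof -
  have "(\<lambda>x::'a. (norm (x - a))\<^sup>2) = (\<lambda>x. \<Sum>b\<in>Basis. (x \<bullet> b * 1 + (- (a \<bullet> b))) * (x \<bullet> b * 1 + (- (a \<bullet> b))))"
    by (rule ext, unfold power2_norm_eq_inner, subst euclidean_inner) (simp add: inner_diff_left)
  moreover have "poly_le (1 + 1) (\<lambda>x::'a. \<Sum>b\<in>Basis. (x \<bullet> b * 1 + (- (a \<bullet> b))) * (x \<bullet> b * 1 + (- (a \<bullet> b))))"
    by (intro poly_le_sum poly_le_mult poly_le.add)
       (auto intro: poly_le.coord[OF _ poly_le.const[of 0 1], simplified] poly_le.const)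
  ultimately show ?thesis by (simp add: numeral_2_eq_2)
qed

lemma real_polynomial_norm_sq: "real_polynomial_function (\<lambda>x::'a::euclidean_space. (norm (x - a))\<^sup>2)"
  using poly_le_norm_sq poly_le_real_polynomial_function by blast

lemma lin_op_norm_sq: "lin_op c (\<lambda>x. (norm (x - a))\<^sup>2) x = 2 * (\<Sum>i\<in>Basis. c i i)"
proof -
  have "(\<Sum>j\<in>Basis. c i j * (2 * (i \<bullet> j))) = 2 * c i i" if "i \<in> Basis" for i
    using that by (simp add: inner_Basis if_distrib[of "\<lambda>t. _ * t"] cong: if_cong)
  then show ?thesis
    by (simp add: lin_op_def partial_partial_norm_sq sum_distrib_left)
qed

lemma real_polynomial_continuous_on: "real_polynomial_function f \<Longrightarrow> continuous_on S f"
  for f :: "'a::euclidean_space \<Rightarrow> real"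
  by (simp add: continuous_on_polymonial_function real_polynomial_function_eq)

text \<open>As c may be degenerate, an interior maximum of F contradicts nothing by itself. Adding
  \<delta> |x - a|^2 raises the operator by 2 \<delta> tr c > 0 and forces the maximum onto the
  sphere, where the added term is \<delta> r^2; then \<delta> tends to 0.\<close>

lemma lin_op_max_principle:
  fixes a :: "'a::euclidean_space"
  assumes c: "elliptic c" "0 < (\<Sum>i\<in>Basis. c i i)"
    and F: "real_polynomial_function F"
    and sub: "\<And>x. x \<in> ball a r \<Longrightarrow> 0 \<le> lin_op c F x"
    and bd: "\<And>x. x \<in> sphere a r \<Longrightarrow> F x \<le> 0"
    and x: "x \<in> cball a r"
  shows "F x \<le> 0"
proof -
  have "F x \<le> \<delta> * r\<^sup>2" if \<delta>: "\<delta> > 0" for \<delta>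
  proof -
    define G where "G = (\<lambda>x. F x + \<delta> * (norm (x - a))\<^sup>2)"
    have polyG: "real_polynomial_function G"
      unfolding G_def
      by (intro real_polynomial_function.intros(2,3,4) F real_polynomial_norm_sq)
    have opG: "lin_op c G y = lin_op c F y + 2 * \<delta> * (\<Sum>i\<in>Basis. c i i)" for y
      unfolding G_def
      by (subst lin_op_add)
         (simp_all add: F lin_op_cmult lin_op_norm_sq real_polynomial_norm_sq real_polynomial_function.intros(2,4))
    obtain y where y: "y \<in> cball a r" "\<And>z. z \<in> cball a r \<Longrightarrow> G z \<le> G y"
      using continuous_attains_sup[OF compact_cball[of a r] _ real_polynomial_continuous_on[OF polyG]] x
      by blast
    have "y \<notin> ball a r"
    proof
      assume yb: "y \<in> ball a r"
      have "local_min_at (\<lambda>z. - G z) y"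
        unfolding local_min_at_def
        using eventually_nhds_in_open[OF open_ball yb]
        by (rule eventually_mono) (use y(2) in auto)
      then have "0 \<le> lin_op c (\<lambda>z. - G z) y"
        by (intro lin_op_local_min c real_polynomial_function_minus polyG)
      then have "lin_op c G y \<le> 0"
        by (simp add: lin_op_minus[OF polyG])
      moreover have "2 * \<delta> * (\<Sum>i\<in>Basis. c i i) > 0" using \<delta> c(2) by simp
      ultimately show False using sub[OF yb] opG[of y] by linarith
    qed
    then have ys: "y \<in> sphere a r" using y(1) by auto
    then have "G y \<le> \<delta> * r\<^sup>2"
      using bd[OF ys] by (simp add: G_def dist_norm norm_minus_commute)
    moreover have "F x \<le> G x" using \<delta> by (simp add: G_def)
    ultimately show ?thesis using y(2)[OF x] by simp
  qed
  then have ev: "\<forall>\<^sub>F \<delta> in at_right 0. F x \<le> \<delta> * r\<^sup>2"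
    by (simp add: eventually_at_right_less eventually_at_filter)
  have "((\<lambda>\<delta>. \<delta> * r\<^sup>2) \<longlongrightarrow> 0 * r\<^sup>2) (at_right 0)"
    by (intro tendsto_intros)
  then show ?thesis
    using tendsto_lowerbound[OF _ ev] by simp
qed

text \<open>Along the line from a through x the polynomial has infinitely many zeros, at small
  parameters, so it also vanishes at parameter 1, which is x.\<close>

lemma real_polynomial_eq_0_on_ball:
  fixes Q :: "'a::euclidean_space \<Rightarrow> real"
  assumes Q: "real_polynomial_function Q" and r: "r > 0"
    and zero: "\<And>x. x \<in> ball a r \<Longrightarrow> Q x = 0"
  shows "Q x = 0"
proof -
  have "polynomial_function (\<lambda>s::real. a + s *\<^sub>R (x - a))"
    by (intro polynomial_function_add polynomial_function_const polynomial_function_bounded_linear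
        bounded_linear_scaleR_left)
  then have "real_polynomial_function (\<lambda>s. Q (a + s *\<^sub>R (x - a)))"
    using real_polynomial_function_compose[OF _ Q] by (fastforce simp: o_def)
  then obtain b n where b: "(\<lambda>s. Q (a + s *\<^sub>R (x - a))) = (\<lambda>s. \<Sum>i\<le>n. b i * s ^ i)"
    using real_polynomial_function_imp_sum by blast
  define e where "e = r / (norm (x - a) + 1)"
  have e: "e > 0" using r by (simp add: e_def add_nonneg_pos)
  have "Q (a + s *\<^sub>R (x - a)) = 0" if "s \<in> {0<..<e}" for s
  proof -
    have "s * norm (x - a) \<le> s * (norm (x - a) + 1)" using that by (simp add: mult_left_mono)
    also have "\<dots> < r" using that by (simp add: e_def pos_less_divide_eq add_nonneg_pos)
    finally show ?thesis using that by (intro zero) (simp add: dist_norm)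
  qed
  then have "{0<..<e} \<subseteq> {s. (\<Sum>i\<le>n. b i * s ^ i) = 0}"
    using fun_cong[OF b] by auto
  then have "infinite {s. (\<Sum>i\<le>n. b i * s ^ i) = 0}"
    using infinite_Ioo[OF e] finite_subset by blast
  then have "\<forall>i\<le>n. b i = 0"
    using polyfun_finite_roots[of b n] by auto
  then have "Q (a + 1 *\<^sub>R (x - a)) = 0"
    using fun_cong[OF b, of 1] by simp
  then show ?thesis by simp
qed

text \<open>The polynomials \<open>(r\<^sup>2 - |x - a|\<^sup>2) Q\<close> vanish on the sphere, and \<open>L\<close> applied to them is an
  endomorphism of the polynomials \<open>Q\<close> of bounded degree; it is injective by the maximum
  principle, hence surjective.\<close>

lemma polynomial_dirichlet_problem:
  fixes a :: "'a::euclidean_space"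
  assumes c: "elliptic c" "0 < (\<Sum>i\<in>Basis. c i i)"
    and P: "real_polynomial_function P" and r: "r > 0"
  obtains H where "real_polynomial_function H"
    "\<And>x. x \<in> sphere a r \<Longrightarrow> H x = P x" "\<And>x. lin_op c H x = e"
proof -
  obtain m where "poly_le m P" using real_polynomial_function_imp_poly_le P by blast
  \<comment> \<open>With m + 2 as degree bound for P, the second-order operator sends both P and q
    Q, where Q has degree at most m, into degree at most m.\<close>
  then have Pm: "poly_le (m + 2) P" using poly_le_mono by fastforce
  define W where "W = {f::'a \<Rightarrow> real. poly_le m f}"
  define q where "q = (\<lambda>x. r\<^sup>2 - (norm (x - a))\<^sup>2)"
  define T where "T = (\<lambda>Q. lin_op c (\<lambda>x. q x * Q x))"
  have q2: "poly_le 2 q"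
    using poly_le.add[OF poly_le.const[of 2 "r\<^sup>2"] poly_le_cmult[OF poly_le_norm_sq[of a], of "-1"]]
    by (simp add: q_def)
  have polyq: "real_polynomial_function q"
    using q2 poly_le_real_polynomial_function by blast
  have opdeg: "poly_le m (lin_op c f)" if "poly_le (m + 2) f" for f
  proof -
    have "poly_le m (partial i (partial j f))" for i j
      using poly_le_partial[of _ "partial j f" i] poly_le_partial[OF that, of j] by fastforce
    then have "poly_le m (\<lambda>x. \<Sum>i\<in>Basis. \<Sum>j\<in>Basis. c i j * partial i (partial j f) x)"
      by (intro poly_le_sum poly_le_cmult) auto
    then show ?thesis by (simp add: lin_op_def[abs_def])
  qed
  have polyW: "real_polynomial_function Q" if "Q \<in> W" for Q
    using that by (auto simp: W_def poly_le_real_polynomial_function)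
  have polyqW: "real_polynomial_function (\<lambda>x. q x * Q x)" if "Q \<in> W" for Q
    using polyW[OF that] polyq real_polynomial_function.intros(4) by blast
  define S where "S = (\<lambda>(c::real) (f::'a \<Rightarrow> real) x. c * f x)"
  interpret vector_space S
    by unfold_locales (auto simp: S_def fun_eq_iff algebra_simps)
  obtain B where B: "finite B" "W \<subseteq> span B"
    using poly_le_finite_span[of m] unfolding S_def W_def by blast
  \<comment> \<open>The right-hand side is chosen so that the operator takes the value e on P + q Q,
    which agrees with P on the sphere because q vanishes there.\<close>
  have "\<exists>Q\<in>W. T Q = (\<lambda>x. e - lin_op c P x)"
  proof (rule linear_inj_on_finite_dim_surj[OF _ B(2,1)])
    show "subspace W"
      unfolding subspace_def W_def zero_fun_def plus_fun_def
      by (auto simp: S_def intro: poly_le.intros poly_le_cmult)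
    show "T Q \<in> W" if "Q \<in> W" for Q
    proof -
      have "poly_le (2 + m) (\<lambda>x. q x * Q x)"
        using that poly_le_mult[OF q2] by (auto simp: W_def)
      then show ?thesis using opdeg unfolding W_def T_def by (simp add: add.commute)
    qed
    show "T (Q + R) = T Q + T R" if "Q \<in> W" "R \<in> W" for Q R
      using lin_op_add[OF polyqW polyqW, OF that] by (auto simp: T_def fun_eq_iff distrib_left)
    show "T (S s Q) = S s (T Q)" if "Q \<in> W" for s Q
      using lin_op_cmult[OF polyqW, OF that] by (auto simp: T_def S_def fun_eq_iff mult.left_commute)
    show "Q = 0" if Q: "Q \<in> W" and T0: "T Q = 0" for Q
    proof -
      have L0: "lin_op c (\<lambda>x. q x * Q x) x = 0" for x
        using T0 by (auto simp: T_def fun_eq_iff)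
      have sph: "q x = 0" if "x \<in> sphere a r" for x
        using that by (simp add: q_def dist_norm norm_minus_commute)
      have "q x * Q x = 0" if x: "x \<in> cball a r" for x
      proof (rule antisym)
        show "q x * Q x \<le> 0"
          by (rule lin_op_max_principle[OF c polyqW[OF Q] _ _ x]) (simp_all add: L0 sph)
        have "- (q x * Q x) \<le> 0"
          by (rule lin_op_max_principle[OF c real_polynomial_function_minus[OF polyqW[OF Q]] _ _ x])
             (simp_all add: L0 sph lin_op_minus[OF polyqW[OF Q]])
        then show "0 \<le> q x * Q x" by simp
      qed
      moreover have "q x \<noteq> 0" if "x \<in> ball a r" for x
      proof -
        have "(norm (x - a))\<^sup>2 < r\<^sup>2"
          using that by (intro power_strict_mono) (auto simp: dist_norm norm_minus_commute)
        then show ?thesis by (simp add: q_def)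
      qed
      ultimately have "Q x = 0" if "x \<in> ball a r" for x
        using that by (metis ball_subset_cball mult_eq_0_iff subsetD)
      then show "Q = 0"
        using real_polynomial_eq_0_on_ball[OF polyW[OF Q] r] by (auto simp: fun_eq_iff)
    qed
    have "poly_le m (\<lambda>x. e + (-1) * lin_op c P x)"
      by (intro poly_le.add poly_le.const poly_le_cmult opdeg Pm)
    then show "(\<lambda>x. e - lin_op c P x) \<in> W" by (simp add: W_def)
  qed
  then obtain Q where Q: "Q \<in> W" "T Q = (\<lambda>x. e - lin_op c P x)" by blast
  show ?thesis
  proof
    show "real_polynomial_function (\<lambda>x. P x + q x * Q x)"
      using P polyqW[OF Q(1)] real_polynomial_function.intros(3) by blast
    show "P x + q x * Q x = P x" if "x \<in> sphere a r" for x
      using that by (simp add: q_def dist_norm norm_minus_commute)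
    show "lin_op c (\<lambda>x. P x + q x * Q x) x = e" for x
      using fun_cong[OF Q(2), of x] by (simp add: lin_op_add[OF P polyqW[OF Q(1)]] T_def)
  qed
qed

section \<open>The coefficients of the p-Laplacian\<close>

text \<open>The matrix |q|^(p-2) (I + (p-2) q q^T / |q|^2) of the operator in nondivergence form.
  The case p = 2 is split off because \<open>0 powr 0 = 0\<close> would destroy the identity matrix
  at q = 0.\<close>

definition plap_coeff :: "real \<Rightarrow> 'a::euclidean_space \<Rightarrow> 'a \<Rightarrow> 'a \<Rightarrow> real" where
  "plap_coeff p q i j =
     (if p = 2 then of_bool (i = j)
      else norm q powr (p - 2) * of_bool (i = j) + (p - 2) * norm q powr (p - 4) * ((q \<bullet> i) * (q \<bullet> j)))"

text \<open>The operator for the unknown H = ln v: the p-Laplacian of exp H is exp ((p-1) H) times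
  this expression, so that the eigenvalue equation with \<Lambda> reads
  \<open>log_plap p H x = - \<Lambda>\<close>.\<close>

definition log_plap :: "real \<Rightarrow> ('a::euclidean_space \<Rightarrow> real) \<Rightarrow> 'a \<Rightarrow> real" where
  "log_plap p H x = lin_op (plap_coeff p (gradient H x)) H x + (p - 1) * norm (gradient H x) powr p"

lemma sum_of_bool_Basis:
  "i \<in> Basis \<Longrightarrow> (\<Sum>j\<in>Basis. of_bool (i = j) * (X j :: real)) = X i"
  by (simp add: of_bool_def if_distrib[of "\<lambda>c. c * _"] cong: if_cong)

lemma plap_coeff_sum:
  "(\<Sum>i\<in>Basis. \<Sum>j\<in>Basis. plap_coeff p q i j * X i j) =
     (if p = 2 then (\<Sum>i\<in>Basis. X i i)
      else norm q powr (p - 2) * (\<Sum>i\<in>Basis. X i i)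
        + (p - 2) * norm q powr (p - 4) * (\<Sum>i\<in>Basis. \<Sum>j\<in>Basis. (q \<bullet> i) * (q \<bullet> j) * X i j))"
proof -
  have d: "(\<Sum>j\<in>Basis. c * of_bool (i = j) * X i j) = c * X i i" if "i \<in> Basis" for i c
    using sum_of_bool_Basis[OF that, of "X i"] by (simp add: sum_distrib_left[symmetric] mult.assoc)
  show ?thesis
  proof (cases "p = 2")
    case True
    then show ?thesis using d[of _ 1] by (simp add: plap_coeff_def)
  next
    case False
    have "(\<Sum>j\<in>Basis. plap_coeff p q i j * X i j) = norm q powr (p - 2) * X i i
        + (p - 2) * norm q powr (p - 4) * (\<Sum>j\<in>Basis. (q \<bullet> i) * (q \<bullet> j) * X i j)"
      if "i \<in> Basis" for i
    proof -
      have "(\<Sum>j\<in>Basis. plap_coeff p q i j * X i j) = (\<Sum>j\<in>Basis. norm q powr (p - 2) * of_bool (i = j) * X i j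
        + (p - 2) * norm q powr (p - 4) * ((q \<bullet> i) * (q \<bullet> j) * X i j))"
        using False by (intro sum.cong) (auto simp: plap_coeff_def algebra_simps)
      then show ?thesis
        by (simp only: sum.distrib d[OF that] sum_distrib_left)
    qed
    then show ?thesis
      using False by (simp add: sum.distrib sum_distrib_left)
  qed
qed

lemma quadratic_form_Basis:
  fixes X :: "'a::euclidean_space \<Rightarrow> 'a \<Rightarrow> real"
  assumes "i \<in> Basis" "j \<in> Basis"
  shows "(\<Sum>a\<in>Basis. \<Sum>b\<in>Basis. (i \<bullet> a) * (j \<bullet> b) * X a b) = X i j"
proof -
  have "(\<Sum>b\<in>Basis. (i \<bullet> a) * (j \<bullet> b) * X a b) = (i \<bullet> a) * X a j" if "a \<in> Basis" for a
  proof -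
    have "(\<Sum>b\<in>Basis. (i \<bullet> a) * (j \<bullet> b) * X a b) = (\<Sum>b\<in>Basis. of_bool (j = b) * ((i \<bullet> a) * X a b))"
      using assms(2) by (intro sum.cong) (auto simp: inner_Basis)
    then show ?thesis by (simp add: sum_of_bool_Basis[OF assms(2)])
  qed
  then have "(\<Sum>a\<in>Basis. \<Sum>b\<in>Basis. (i \<bullet> a) * (j \<bullet> b) * X a b) = (\<Sum>a\<in>Basis. (i \<bullet> a) * X a j)"
    by simp
  also have "\<dots> = (\<Sum>a\<in>Basis. of_bool (i = a) * X a j)"
    using assms(1) by (intro sum.cong) (auto simp: inner_Basis)
  also have "\<dots> = X i j"
    by (rule sum_of_bool_Basis[OF assms(1)])
  finally show ?thesis .
qed

lemma elliptic_plap_coeff: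
  assumes "p \<ge> 2"
  shows "elliptic (plap_coeff p q)"
  unfolding elliptic_def
proof (intro allI impI)
  fix X :: "'a \<Rightarrow> 'a \<Rightarrow> real"
  assume X: "\<forall>h. 0 \<le> (\<Sum>i\<in>Basis. \<Sum>j\<in>Basis. (h \<bullet> i) * (h \<bullet> j) * X i j)"
  have "0 \<le> X i i" if "i \<in> Basis" for i
    using X[rule_format, of i] quadratic_form_Basis[OF that that, of X] by simp
  then have "0 \<le> (\<Sum>i\<in>Basis. X i i)" by (simp add: sum_nonneg)
  then show "0 \<le> (\<Sum>i\<in>Basis. \<Sum>j\<in>Basis. plap_coeff p q i j * X i j)"
    unfolding plap_coeff_sum using assms X[rule_format, of q] by simp
qed

definition shift_coeff :: "real \<Rightarrow> ('a \<Rightarrow> 'a \<Rightarrow> real) \<Rightarrow> 'a \<Rightarrow> 'a \<Rightarrow> real" where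
  "shift_coeff \<omega> c i j = c i j + \<omega> * of_bool (i = j)"

lemma shift_coeff_sum:
  "(\<Sum>i\<in>Basis. \<Sum>j\<in>Basis. shift_coeff \<omega> c i j * X i j) =
     (\<Sum>i\<in>Basis. \<Sum>j\<in>Basis. c i j * X i j) + \<omega> * (\<Sum>i\<in>Basis. X i i)"
proof -
  have "(\<Sum>j\<in>Basis. shift_coeff \<omega> c i j * X i j) = (\<Sum>j\<in>Basis. c i j * X i j) + \<omega> * X i i"
    if "i \<in> Basis" for i
  proof -
    have "(\<Sum>j\<in>Basis. shift_coeff \<omega> c i j * X i j)
        = (\<Sum>j\<in>Basis. c i j * X i j) + (\<Sum>j\<in>Basis. of_bool (i = j) * (\<omega> * X i j))"
      unfolding sum.distrib[symmetric] by (intro sum.cong) (auto simp: shift_coeff_def algebra_simps)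
    then show ?thesis using sum_of_bool_Basis[OF that] by simp
  qed
  then show ?thesis by (simp add: sum.distrib sum_distrib_left)
qed

lemma elliptic_shift_coeff:
  assumes "elliptic c" "\<omega> \<ge> 0"
  shows "elliptic (shift_coeff \<omega> c)"
  unfolding elliptic_def
proof (intro allI impI)
  fix X :: "'a \<Rightarrow> 'a \<Rightarrow> real"
  assume X: "\<forall>h. 0 \<le> (\<Sum>i\<in>Basis. \<Sum>j\<in>Basis. (h \<bullet> i) * (h \<bullet> j) * X i j)"
  have "0 \<le> X i i" if "i \<in> Basis" for i
    using X[rule_format, of i] quadratic_form_Basis[OF that that, of X] by simp
  then have "0 \<le> (\<Sum>i\<in>Basis. X i i)" by (simp add: sum_nonneg)
  moreover have "0 \<le> (\<Sum>i\<in>Basis. \<Sum>j\<in>Basis. c i j * X i j)"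
    using assms(1)[unfolded elliptic_def, THEN spec, THEN mp, OF X] .
  ultimately show "0 \<le> (\<Sum>i\<in>Basis. \<Sum>j\<in>Basis. shift_coeff \<omega> c i j * X i j)"
    unfolding shift_coeff_sum using assms(2) by simp
qed

lemma trace_shift_plap_coeff_pos:
  assumes "p \<ge> 2" "\<omega> > 0"
  shows "0 < (\<Sum>i\<in>Basis. shift_coeff \<omega> (plap_coeff p (q::'a::euclidean_space)) i i)"
proof (rule sum_pos)
  fix i :: 'a
  have "0 \<le> plap_coeff p q i i" using assms by (simp add: plap_coeff_def)
  then show "0 < shift_coeff \<omega> (plap_coeff p q) i i" using assms by (simp add: shift_coeff_def)
qed auto

lemma plap_coeff_uminus [simp]: "plap_coeff p (- q) = plap_coeff p q"
  by (simp add: plap_coeff_def fun_eq_iff)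

text \<open>The delicate case is q0 = 0 with p > 2, where |q|^(p-4) may blow up. The product of the
  two components of q is at most |q|^2 |i| |j|, so the entry is O(|q|^(p-2)) and tends to its value
  0.\<close>

lemma isCont_plap_coeff:
  assumes p: "p \<ge> 2"
  shows "isCont (\<lambda>q. plap_coeff p q i j) q0"
proof (cases "p = 2 \<or> q0 \<noteq> 0")
  case True
  then show ?thesis
    by (cases "p = 2") (auto simp: plap_coeff_def intro!: continuous_intros)
next
  case False
  then have p2: "p > 2" and q0: "q0 = 0" using p by auto
  have b: "norm (plap_coeff p q i j) \<le> norm q powr (p - 2) * (1 + (p - 2) * norm i * norm j)" for q
  proof -
    have "\<bar>(q \<bullet> i) * (q \<bullet> j)\<bar> \<le> (norm q * norm i) * (norm q * norm j)"
      unfolding abs_mult by (intro mult_mono Cauchy_Schwarz_ineq2) auto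
    then have "norm q powr (p - 4) * \<bar>(q \<bullet> i) * (q \<bullet> j)\<bar>
        \<le> norm q powr (p - 4) * ((norm q * norm i) * (norm q * norm j))"
      by (intro mult_left_mono) auto
    also have "\<dots> = norm q powr (p - 2) * (norm i * norm j)"
    proof (cases "q = 0")
      case False
      have "norm q powr (p - 2) = norm q powr (p - 4) * norm q powr 2"
        unfolding powr_add[symmetric] by simp
      then show ?thesis using False by (simp add: powr_numeral power2_eq_square)
    qed simp
    finally have "(p - 2) * (norm q powr (p - 4) * \<bar>(q \<bullet> i) * (q \<bullet> j)\<bar>)
        \<le> (p - 2) * (norm q powr (p - 2) * (norm i * norm j))"
      using p by (intro mult_left_mono) auto
    moreover have "norm (plap_coeff p q i j) \<le> norm q powr (p - 2) + (p - 2) * (norm q powr (p - 4) * \<bar>(q \<bullet> i) * (q \<bullet> j)\<bar>)"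
    proof -
      have "norm (plap_coeff p q i j) \<le> \<bar>norm q powr (p - 2) * of_bool (i = j)\<bar>
          + \<bar>(p - 2) * norm q powr (p - 4) * ((q \<bullet> i) * (q \<bullet> j))\<bar>"
        using p2 abs_triangle_ineq by (simp add: plap_coeff_def)
      also have "\<dots> \<le> norm q powr (p - 2) + (p - 2) * (norm q powr (p - 4) * \<bar>(q \<bullet> i) * (q \<bullet> j)\<bar>)"
        using p2 by (simp add: abs_mult)
      finally show ?thesis .
    qed
    ultimately show ?thesis by (simp add: algebra_simps)
  qed
  have "((\<lambda>q::'a. norm q powr (p - 2)) \<longlongrightarrow> norm (0::'a) powr (p - 2)) (at 0)"
    using p2 by (intro tendsto_powr2 tendsto_norm tendsto_ident_at tendsto_const) auto
  then have "((\<lambda>q::'a. norm q powr (p - 2) * (1 + (p - 2) * norm i * norm j)) \<longlongrightarrow>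
      norm (0::'a) powr (p - 2) * (1 + (p - 2) * norm i * norm j)) (at 0)"
    by (rule tendsto_mult[OF _ tendsto_const])
  then have "((\<lambda>q. norm q powr (p - 2) * (1 + (p - 2) * norm i * norm j)) \<longlongrightarrow> 0) (at (0::'a))"
    by simp
  then have "((\<lambda>q. plap_coeff p q i j) \<longlongrightarrow> 0) (at 0)"
    by (rule Lim_null_comparison[rotated]) (use b in auto)
  then show ?thesis
    using p2 by (simp add: isCont_def q0) (simp add: plap_coeff_def)
qed

text \<open>N = X + \<beta> I has a nonnegative quadratic form, hence |N i j + N j i| is at most N i
  i + N j j. If each coefficient changes by at most \<omega> / n, the pairing with N changes by at
  most \<omega> tr N = \<omega> tr X + \<omega> \<beta> n. The term \<omega> tr X is the added
  Laplacian; what remains is bounded by \<kappa>.\<close>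

lemma frozen_coefficients:
  fixes q0 :: "'a::euclidean_space"
  assumes p: "p \<ge> 2" and \<beta>: "\<beta> \<ge> 0" and \<kappa>: "\<kappa> > 0"
  shows "\<exists>\<omega>>0. \<exists>\<eta>>0. \<forall>q X. dist q q0 < \<eta> \<longrightarrow>
      (\<forall>h. 0 \<le> (\<Sum>i\<in>Basis. \<Sum>j\<in>Basis. (h \<bullet> i) * (h \<bullet> j) * X i j) + \<beta> * (norm h)\<^sup>2) \<longrightarrow>
      (\<Sum>i\<in>Basis. \<Sum>j\<in>Basis. plap_coeff p q i j * X i j)
        \<le> (\<Sum>i\<in>Basis. \<Sum>j\<in>Basis. shift_coeff \<omega> (plap_coeff p q0) i j * X i j) + \<kappa>"
proof -
  define n where "n = real DIM('a)"
  have n: "n \<ge> 1" by (simp add: n_def DIM_positive Suc_leI)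
  \<comment> \<open>The errors \<omega> \<beta> n and \<omega> \<beta> are together at most 2 n
    \<beta> \<omega>, as n is at least 1; the summand 1 keeps the denominator positive when \<beta>
    = 0.\<close>
  define \<omega> where "\<omega> = \<kappa> / (2 * n * \<beta> + 1)"
  have den: "2 * n * \<beta> + 1 > 0" using n \<beta> by (simp add: add_nonneg_pos)
  have \<omega>: "\<omega> > 0" using \<kappa> den by (simp add: \<omega>_def)
  have \<omega>\<kappa>: "\<omega> * (2 * n * \<beta>) \<le> \<kappa>"
  proof -
    have "\<omega> * (2 * n * \<beta>) \<le> \<omega> * (2 * n * \<beta> + 1)" using \<omega> by simp
    also have "\<dots> = \<kappa>" using den by (simp add: \<omega>_def)
    finally show ?thesis .
  qed
  have "\<forall>\<^sub>F q in nhds q0. \<forall>i\<in>Basis. \<forall>j\<in>Basis. \<bar>plap_coeff p q i j - plap_coeff p q0 i j\<bar> < \<omega> / n"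
  proof (intro eventually_ball_finite ballI)
    fix i j :: 'a
    have "((\<lambda>q. plap_coeff p q i j) \<longlongrightarrow> plap_coeff p q0 i j) (nhds q0)"
      using isCont_plap_coeff[OF p] by (simp add: tendsto_nhds_iff isCont_def)
    moreover have "\<omega> / n > 0" using \<omega> n by simp
    ultimately show "\<forall>\<^sub>F q in nhds q0. \<bar>plap_coeff p q i j - plap_coeff p q0 i j\<bar> < \<omega> / n"
      by (auto dest: tendstoD simp: dist_real_def)
  qed auto
  then obtain \<eta> where \<eta>: "\<eta> > 0"
    "\<And>q i j. dist q q0 < \<eta> \<Longrightarrow> i \<in> Basis \<Longrightarrow> j \<in> Basis \<Longrightarrow> \<bar>plap_coeff p q i j - plap_coeff p q0 i j\<bar> < \<omega> / n"
    unfolding eventually_nhds_metric by blast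
  have main: "(\<Sum>i\<in>Basis. \<Sum>j\<in>Basis. plap_coeff p q i j * X i j)
        \<le> (\<Sum>i\<in>Basis. \<Sum>j\<in>Basis. shift_coeff \<omega> (plap_coeff p q0) i j * X i j) + \<kappa>"
    if q: "dist q q0 < \<eta>"
      and X: "\<And>h. 0 \<le> (\<Sum>i\<in>Basis. \<Sum>j\<in>Basis. (h \<bullet> i) * (h \<bullet> j) * X i j) + \<beta> * (norm h)\<^sup>2"
    for q and X :: "'a \<Rightarrow> 'a \<Rightarrow> real"
  proof -
    define N where "N i j = X i j + \<beta> * of_bool (i = j)" for i j
    define S where "S i j = plap_coeff p q0 i j - plap_coeff p q i j" for i j
    have Sb: "\<bar>S i j\<bar> \<le> \<omega> / n" if "i \<in> Basis" "j \<in> Basis" for i j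
      using \<eta>(2)[OF q that] by (simp add: S_def abs_minus_commute)
    have Ssym: "S i j = S j i" for i j
      by (simp add: S_def plap_coeff_def mult.commute eq_commute)
    have Xd: "- \<beta> \<le> X i i" if "i \<in> Basis" for i
      using X[of i] quadratic_form_Basis[OF that that, of X] that by simp
    \<comment> \<open>For distinct i and j this is the hypothesis on X tested with i + j and i -
      j.\<close>
    have Npos: "\<bar>N i j + N j i\<bar> \<le> N i i + N j j" if ij: "i \<in> Basis" "j \<in> Basis" for i j
    proof (cases "i = j")
      case True
      then show ?thesis using Xd[OF ij(1)] by (simp add: N_def)
    next
      case False
      have expand: "(\<Sum>a\<in>Basis. \<Sum>b\<in>Basis. ((i + s *\<^sub>R j) \<bullet> a) * ((i + s *\<^sub>R j) \<bullet> b) * X a b)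
          = X i i + s * (X i j + X j i) + s\<^sup>2 * X j j" for s
      proof -
        have "(\<Sum>a\<in>Basis. \<Sum>b\<in>Basis. ((i + s *\<^sub>R j) \<bullet> a) * ((i + s *\<^sub>R j) \<bullet> b) * X a b)
          = (\<Sum>a\<in>Basis. \<Sum>b\<in>Basis. (i \<bullet> a) * (i \<bullet> b) * X a b)
            + s * (\<Sum>a\<in>Basis. \<Sum>b\<in>Basis. (i \<bullet> a) * (j \<bullet> b) * X a b)
            + s * (\<Sum>a\<in>Basis. \<Sum>b\<in>Basis. (j \<bullet> a) * (i \<bullet> b) * X a b)
            + s\<^sup>2 * (\<Sum>a\<in>Basis. \<Sum>b\<in>Basis. (j \<bullet> a) * (j \<bullet> b) * X a b)"
          unfolding sum_distrib_left sum.distrib[symmetric]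
          by (intro sum.cong refl) (simp add: inner_add_left power2_eq_square algebra_simps)
        then show ?thesis by (simp only: quadratic_form_Basis ij) (simp add: algebra_simps)
      qed
      have nrm: "(norm (i + s *\<^sub>R j))\<^sup>2 = 1 + s\<^sup>2" for s
        unfolding power2_norm_eq_inner using ij False
        by (simp add: inner_add_left inner_add_right inner_Basis) (simp add: power2_eq_square)
      have "0 \<le> X i i + (X i j + X j i) + X j j + \<beta> * 2"
        using X[of "i + 1 *\<^sub>R j"] unfolding expand nrm by simp
      moreover have "0 \<le> X i i - (X i j + X j i) + X j j + \<beta> * 2"
        using X[of "i + (-1) *\<^sub>R j"] unfolding expand nrm by simp
      ultimately show ?thesis using False by (auto simp: N_def)
    qed
    define tr where "tr = (\<Sum>i\<in>Basis. N i i)"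
    have "- (\<omega> * tr) \<le> (\<Sum>i\<in>Basis. \<Sum>j\<in>Basis. S i j * N i j)"
    proof -
      \<comment> \<open>X may be nonsymmetric, so only N i j + N j i is under control; the symmetry
        of S allows the sum to be symmetrised.\<close>
      have swap: "(\<Sum>i\<in>Basis. \<Sum>j\<in>Basis. S i j * N i j) = (\<Sum>i\<in>Basis. \<Sum>j\<in>Basis. S i j * N j i)"
        by (subst sum.swap) (simp add: Ssym[of _ _])
      have "2 * (\<Sum>i\<in>Basis. \<Sum>j\<in>Basis. S i j * N i j) = (\<Sum>i\<in>Basis. \<Sum>j\<in>Basis. S i j * (N i j + N j i))"
        by (simp add: distrib_left sum.distrib swap[symmetric])
      also have "\<dots> \<ge> (\<Sum>i\<in>Basis. \<Sum>j\<in>Basis. - (\<omega> / n * (N i i + N j j)))"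
      proof (intro sum_mono)
        fix i j :: 'a assume ij: "i \<in> Basis" "j \<in> Basis"
        have "\<bar>S i j * (N i j + N j i)\<bar> \<le> \<omega> / n * (N i i + N j j)"
          unfolding abs_mult using Sb[OF ij] Npos[OF ij] \<omega> n by (intro mult_mono) auto
        then show "- (\<omega> / n * (N i i + N j j)) \<le> S i j * (N i j + N j i)" by linarith
      qed
      also have "(\<Sum>i\<in>Basis. \<Sum>j\<in>Basis. - (\<omega> / n * (N i i + N j j))) = - (2 * (\<omega> * tr))"
      proof -
        have "(\<Sum>i\<in>(Basis::'a set). \<Sum>j\<in>(Basis::'a set). (N i i + N j j)) = 2 * (n * tr)"
          by (simp add: sum.distrib tr_def n_def sum_distrib_left)
        moreover have "(\<Sum>i\<in>(Basis::'a set). \<Sum>j\<in>(Basis::'a set). - (\<omega> / n * (N i i + N j j)))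
            = - (\<omega> / n * (\<Sum>i\<in>(Basis::'a set). \<Sum>j\<in>(Basis::'a set). (N i i + N j j)))"
          by (simp only: sum_negf sum_distrib_left)
        ultimately show ?thesis using n by simp
      qed
      finally show ?thesis by simp
    qed
    moreover have "(\<Sum>i\<in>Basis. \<Sum>j\<in>Basis. S i j * N i j)
        = (\<Sum>i\<in>Basis. \<Sum>j\<in>Basis. S i j * X i j) + \<beta> * (\<Sum>i\<in>Basis. S i i)"
    proof -
      have "(\<Sum>j\<in>Basis. S i j * N i j) = (\<Sum>j\<in>Basis. S i j * X i j) + (\<Sum>j\<in>Basis. of_bool (i = j) * (\<beta> * S i j))" for i
        unfolding sum.distrib[symmetric] by (intro sum.cong) (auto simp: N_def algebra_simps)
      then show ?thesis
        by (simp add: sum_of_bool_Basis sum.distrib sum_distrib_left)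
    qed
    moreover have "tr = (\<Sum>i\<in>Basis. X i i) + \<beta> * n"
      by (simp add: tr_def N_def sum.distrib n_def)
    moreover have "\<beta> * (\<Sum>i\<in>Basis. S i i) \<le> \<beta> * \<omega>"
    proof -
      have "(\<Sum>i\<in>Basis. S i i) \<le> (\<Sum>i\<in>(Basis::'a set). \<omega> / n)"
        using Sb by (intro sum_mono) (meson abs_le_D1)
      also have "\<dots> = \<omega>" using n by (simp add: n_def)
      finally show ?thesis using \<beta> by (intro mult_left_mono)
    qed
    moreover have "\<omega> * (\<beta> * n) + \<beta> * \<omega> \<le> \<omega> * (2 * n * \<beta>)"
    proof -
      have "\<beta> * \<omega> \<le> \<beta> * \<omega> * n" using mult_left_mono[OF n, of "\<beta> * \<omega>"] \<beta> \<omega> by simp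
      then show ?thesis by (simp add: algebra_simps)
    qed
    moreover have "(\<Sum>i\<in>Basis. \<Sum>j\<in>Basis. S i j * X i j)
        = (\<Sum>i\<in>Basis. \<Sum>j\<in>Basis. plap_coeff p q0 i j * X i j) - (\<Sum>i\<in>Basis. \<Sum>j\<in>Basis. plap_coeff p q i j * X i j)"
      by (simp add: S_def left_diff_distrib sum_subtractf)
    ultimately show ?thesis
      using \<omega>\<kappa> unfolding shift_coeff_sum by (simp add: algebra_simps)
  qed
  show ?thesis
    using \<omega> \<eta>(1) by (intro exI[of _ \<omega>] exI[of _ \<eta>] conjI allI impI main) auto
qed

lemma real_polynomial_exp_differentiable:
  fixes H :: "'a::euclidean_space \<Rightarrow> real"
  assumes "real_polynomial_function H"
  shows "(\<lambda>x. exp (H x)) differentiable (at x)"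
  using has_derivative_exp real_polynomial_differentiable[OF assms]
  unfolding differentiable_def by blast

lemma partial_exp_polynomial:
  fixes H :: "'a::euclidean_space \<Rightarrow> real"
  assumes "real_polynomial_function H"
  shows "partial i (\<lambda>x. exp (H x)) = (\<lambda>x. partial i H x * exp (H x))"
  using partial_exp[OF real_polynomial_differentiable[OF assms]] by (simp add: fun_eq_iff)

lemma partial_partial_exp_polynomial:
  fixes H :: "'a::euclidean_space \<Rightarrow> real"
  assumes "real_polynomial_function H"
  shows "partial i (partial j (\<lambda>x. exp (H x)))
    = (\<lambda>x. (partial i (partial j H) x + partial i H x * partial j H x) * exp (H x))"
proof
  fix x
  show "partial i (partial j (\<lambda>x. exp (H x))) x
      = (partial i (partial j H) x + partial i H x * partial j H x) * exp (H x)"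
    unfolding partial_exp_polynomial[OF assms]
    by (subst partial_mult)
       (simp_all add: partial_exp_polynomial[OF assms] algebra_simps real_polynomial_differentiable
         real_polynomial_exp_differentiable real_polynomial_partial assms)
qed

text \<open>The Hessian of exp H is exp H times D^2 H + DH DH^T. The rank-one part contributes
  |DH|^p through the Laplacian and (p-2) |DH|^p through the quadratic term, together the first-order
  part of \<open>log_plap\<close>.\<close>

lemma p_laplacian_exp:
  fixes H :: "'a::euclidean_space \<Rightarrow> real"
  assumes H: "real_polynomial_function H" and p: "p \<ge> 2"
  shows "p_laplacian p (\<lambda>x. exp (H x)) x = exp ((p - 1) * H x) * log_plap p H x"
proof -
  define g where "g = gradient H x"
  define L where "L = (\<Sum>i\<in>Basis. partial i (partial i H) x)"
  define E where "E = exp (H x)"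
  define S where "S = (\<Sum>i\<in>Basis. \<Sum>j\<in>Basis. (g \<bullet> i) * (g \<bullet> j) * partial i (partial j H) x)"
  have gi: "partial i H x = g \<bullet> i" if "i \<in> Basis" for i
    using gradient_inner[OF that] by (simp add: g_def)
  have sq: "(\<Sum>i\<in>Basis. (g \<bullet> i) * (g \<bullet> i)) = (norm g)\<^sup>2"
    by (simp add: power2_norm_eq_inner euclidean_inner[of g g])
  have grad: "gradient (\<lambda>x. exp (H x)) x = E *\<^sub>R g"
    by (simp add: gradient_def g_def partial_exp_polynomial[OF H] E_def scaleR_sum_right mult.commute)
  have lap: "laplacian (\<lambda>x. exp (H x)) x = E * (L + (norm g)\<^sup>2)"
  proof -
    have "laplacian (\<lambda>x. exp (H x)) x = (\<Sum>i\<in>Basis. E * partial i (partial i H) x + E * ((g \<bullet> i) * (g \<bullet> i)))"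
      unfolding laplacian_def partial_partial_exp_polynomial[OF H]
      by (intro sum.cong refl) (simp add: gi E_def algebra_simps)
    then show ?thesis
      by (simp add: sum.distrib sum_distrib_left[symmetric] sq L_def distrib_left)
  qed
  have op: "lin_op (plap_coeff p g) H x
      = (if p = 2 then L else norm g powr (p - 2) * L + (p - 2) * norm g powr (p - 4) * S)"
    by (simp add: lin_op_def plap_coeff_sum L_def S_def)
  show ?thesis
  proof (cases "p = 2")
    case True
    then show ?thesis
      using op by (simp add: p_laplacian_def lap log_plap_def flip: g_def) (simp add: E_def powr_numeral)
  next
    case False
    then have p2: "p > 2" using p by simp
    show ?thesis
    proof (cases "g = 0")
      case True
      then show ?thesis
        using op False p2 by (simp add: p_laplacian_def grad log_plap_def flip: g_def)
    next
      case g0: False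
      define n where "n = norm g"
      have n: "n > 0" using g0 by (simp add: n_def)
      \<comment> \<open>Every real power that occurs is a product of \<open>a\<close>,
        \<open>e\<close> and natural powers of n and E, which turns the claim into a polynomial
        identity.\<close>
      define a where "a = n powr (p - 4)"
      define e where "e = E powr (p - 4)"
      have E: "E > 0" by (simp add: E_def)
      have shift: "y powr (p - 2) = y powr (p - 4) * y^2" "y powr p = y powr (p - 4) * y^4" if "y > 0" for y :: real
      proof -
        have "y powr (p - 4) * y powr 2 = y powr (p - 2)" "y powr (p - 4) * y powr 4 = y powr p"
          unfolding powr_add[symmetric] by simp_all
        then show "y powr (p - 2) = y powr (p - 4) * y^2" "y powr p = y powr (p - 4) * y^4"
          using that by (simp_all add: powr_numeral)
      qed
      have nE: "norm (E *\<^sub>R g) = E * n" using E by (simp add: n_def)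
      have pw: "(E * n) powr (p - 2) = e * E^2 * (a * n^2)" "(E * n) powr (p - 4) = e * a"
        using E n by (simp_all add: powr_mult shift a_def e_def)
      have ex: "exp ((p - 1) * H x) = e * E ^ 3"
      proof -
        have "e * E powr 3 = exp ((p - 1) * H x)"
          unfolding e_def powr_add[symmetric] by (simp add: E_def powr_def)
        then show ?thesis using E by (simp add: powr_numeral)
      qed
      have quad: "(\<Sum>i\<in>Basis. \<Sum>j\<in>Basis. partial i (\<lambda>x. exp (H x)) x * partial j (\<lambda>x. exp (H x)) x
          * partial i (partial j (\<lambda>x. exp (H x))) x) = E^3 * (S + n^4)"
      proof -
        have "(\<Sum>i\<in>Basis. \<Sum>j\<in>Basis. partial i (\<lambda>x. exp (H x)) x * partial j (\<lambda>x. exp (H x)) x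
            * partial i (partial j (\<lambda>x. exp (H x))) x)
          = (\<Sum>i\<in>Basis. \<Sum>j\<in>Basis. E^3 * ((g \<bullet> i) * (g \<bullet> j) * partial i (partial j H) x)
              + E^3 * (((g \<bullet> i) * (g \<bullet> i)) * ((g \<bullet> j) * (g \<bullet> j))))"
          unfolding partial_partial_exp_polynomial[OF H] unfolding partial_exp_polynomial[OF H]
          by (intro sum.cong refl) (simp add: gi E_def[symmetric] algebra_simps power3_eq_cube)
        also have "\<dots> = E^3 * S + E^3 * ((\<Sum>i\<in>Basis. (g \<bullet> i) * (g \<bullet> i)) * (\<Sum>j\<in>Basis. (g \<bullet> j) * (g \<bullet> j)))"
          by (simp only: sum.distrib sum_distrib_left[symmetric] sum_product S_def)
        finally show ?thesis
          unfolding sq by (simp add: n_def distrib_left flip: power_add)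
      qed
      show ?thesis
        using False g0 E
        by (simp add: p_laplacian_def log_plap_def grad op lap quad nE pw ex shift n flip: g_def n_def a_def)
           (simp add: algebra_simps power2_eq_square power3_eq_cube power4_eq_xxxx)
    qed
  qed
qed

section \<open>Sup-convolution\<close>

lemma upper_semicontinuous_on_iff:
  "upper_semicontinuous_on S u \<longleftrightarrow>
     (\<forall>x\<in>S. \<forall>c. u x < c \<longrightarrow> (\<exists>T. open T \<and> x \<in> T \<and> (\<forall>z\<in>T \<inter> S. u z < c)))"
  unfolding upper_semicontinuous_on_def eventually_at_topological by (metis IntE IntI)

lemma upper_semicontinuous_on_compose:
  assumes u: "upper_semicontinuous_on S u" and f: "continuous_on T f" "f ` T \<subseteq> S"
  shows "upper_semicontinuous_on T (\<lambda>x. u (f x))"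
  unfolding upper_semicontinuous_on_iff
proof (intro ballI allI impI)
  fix x c assume x: "x \<in> T" and c: "u (f x) < c"
  then obtain B where B: "open B" "f x \<in> B" "\<forall>z\<in>B \<inter> S. u z < c"
    using u f(2) unfolding upper_semicontinuous_on_iff by blast
  then obtain A where "open A" "x \<in> A" "\<forall>y\<in>T. y \<in> A \<longrightarrow> f y \<in> B"
    using f(1) x unfolding continuous_on_topological by blast
  with B(3) f(2) show "\<exists>A. open A \<and> x \<in> A \<and> (\<forall>z\<in>A \<inter> T. u (f z) < c)"
    by (intro exI[of _ A]) blast
qed

lemma upper_semicontinuous_on_subset:
  "upper_semicontinuous_on S u \<Longrightarrow> T \<subseteq> S \<Longrightarrow> upper_semicontinuous_on T u"
  using upper_semicontinuous_on_compose[of S u T "\<lambda>x. x"] by auto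

lemma continuous_on_imp_upper_semicontinuous_on:
  fixes u :: "'a::topological_space \<Rightarrow> real"
  assumes "continuous_on S u"
  shows "upper_semicontinuous_on S u"
  using assms unfolding upper_semicontinuous_on_def continuous_on_def
  by (auto dest: order_tendstoD(2))

lemma upper_semicontinuous_on_mult:
  assumes u: "upper_semicontinuous_on S u" and u0: "\<And>x. x \<in> S \<Longrightarrow> 0 \<le> u x"
    and k: "continuous_on S k" "\<And>x. x \<in> S \<Longrightarrow> 0 < k x"
  shows "upper_semicontinuous_on S (\<lambda>x. u x * k x)"
  unfolding upper_semicontinuous_on_def
proof (intro ballI allI impI)
  fix x c assume x: "x \<in> S" and c: "u x * k x < c"
  then have "u x < c / k x" using k(2)[OF x] by (simp add: pos_less_divide_eq)
  then obtain d where d: "u x < d" "d < c / k x" using dense by blast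
  have "d > 0" using u0[OF x] d(1) by simp
  have "\<forall>\<^sub>F z in at x within S. u z < d"
    using u x d(1) unfolding upper_semicontinuous_on_def by blast
  moreover have "\<forall>\<^sub>F z in at x within S. d * k z < c"
  proof (rule order_tendstoD(2))
    show "((\<lambda>z. d * k z) \<longlongrightarrow> d * k x) (at x within S)"
      using k(1) x by (intro tendsto_intros) (auto simp: continuous_on_def)
    show "d * k x < c" using d(2) k(2)[OF x] by (simp add: pos_less_divide_eq)
  qed
  moreover have "\<forall>\<^sub>F z in at x within S. z \<in> S"
    by (simp add: eventually_at_filter)
  ultimately show "\<forall>\<^sub>F z in at x within S. u z * k z < c"
  proof eventually_elim
    case (elim z)
    have "u z * k z \<le> d * k z" using elim k(2) by (intro mult_right_mono) (auto intro: less_imp_le)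
    then show ?case using elim by simp
  qed
qed

text \<open>Without a maximum, every x has a neighbourhood on which u stays below a value u (y x)
  taken in S. Finitely many of these cover S, and the largest of the corresponding values would have
  to be smaller than one of them.\<close>

lemma upper_semicontinuous_on_attains_sup:
  assumes S: "compact S" "S \<noteq> {}" and u: "upper_semicontinuous_on S u"
  shows "\<exists>x\<in>S. \<forall>y\<in>S. u y \<le> u x"
proof (rule ccontr)
  assume "\<not> ?thesis"
  then obtain y where y: "\<And>x. x \<in> S \<Longrightarrow> y x \<in> S \<and> u x < u (y x)"
    by (metis not_le)
  then have "\<forall>x\<in>S. \<exists>T. open T \<and> x \<in> T \<and> (\<forall>z\<in>T \<inter> S. u z < u (y x))"
    using u unfolding upper_semicontinuous_on_iff by blast
  then obtain T where T: "\<And>x. x \<in> S \<Longrightarrow> open (T x) \<and> x \<in> T x \<and> (\<forall>z\<in>T x \<inter> S. u z < u (y x))"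
    by metis
  obtain F where F: "F \<subseteq> S" "finite F" "S \<subseteq> (\<Union>x\<in>F. T x)"
    using compactE_image[OF S(1), of S T] T by (metis UN_I subsetI)
  have "F \<noteq> {}" using F(3) S(2) by auto
  then have "Max ((\<lambda>z. u (y z)) ` F) \<in> (\<lambda>z. u (y z)) ` F"
    using F(2) by (intro Max_in) auto
  then obtain x where xF: "x \<in> F" and xM: "Max ((\<lambda>z. u (y z)) ` F) = u (y x)" by blast
  have x: "u (y z) \<le> u (y x)" if "z \<in> F" for z
    using Max_ge[of "(\<lambda>z. u (y z)) ` F" "u (y z)"] F(2) that by (simp add: xM)
  have "y x \<in> S" using y xF F by auto
  then obtain z where z: "z \<in> F" "y x \<in> T z" using F(3) by auto
  then have "u (y x) < u (y z)" using T[of z] F(1) \<open>y x \<in> S\<close> by auto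
  then show False using x[OF z(1)] by simp
qed

text \<open>The values u (X n) may fail to converge; convergent minorants d n are what a maximality
  inequality supplies.\<close>

lemma upper_semicontinuous_on_seq_bound:
  assumes u: "upper_semicontinuous_on S u" and X: "\<And>n. X n \<in> S" "X \<longlonglongrightarrow> x" "x \<in> S"
    and d: "\<And>n. d n \<le> u (X n)" "d \<longlonglongrightarrow> l"
  shows "l \<le> u x"
proof (rule ccontr)
  assume "\<not> l \<le> u x"
  then obtain c where c: "u x < c" "c < l" using dense by (meson not_le)
  obtain T where T: "open T" "x \<in> T" "\<And>z. z \<in> T \<Longrightarrow> z \<in> S \<Longrightarrow> u z < c"
    using u X(3) c(1) unfolding upper_semicontinuous_on_iff by (metis IntI)
  have "\<forall>\<^sub>F n in sequentially. X n \<in> T"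
    using X(2) T(1,2) by (rule topological_tendstoD)
  moreover have "\<forall>\<^sub>F n in sequentially. c < d n"
    using d(2) c(2) by (rule order_tendstoD)
  ultimately have "\<forall>\<^sub>F n in sequentially. False"
  proof eventually_elim
    case (elim n)
    then show ?case using T(3)[OF _ X(1), of n] d(1)[of n] by simp
  qed
  then show False by simp
qed

section \<open>Gaussian kernels and their maximisers\<close>

definition gauss :: "real \<Rightarrow> 'a::metric_space \<Rightarrow> 'a \<Rightarrow> real" where
  "gauss \<alpha> x \<xi> = exp (- \<alpha> * (dist x \<xi>)\<^sup>2)"

lemma gauss_pos [simp]: "0 < gauss \<alpha> x \<xi>"
  by (simp add: gauss_def)

lemma gauss_neq_0 [simp]: "gauss \<alpha> x \<xi> \<noteq> 0"
  by (simp add: gauss_def)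

lemma tendsto_gauss [tendsto_intros]:
  "(f \<longlongrightarrow> a) F \<Longrightarrow> (g \<longlongrightarrow> b) F \<Longrightarrow> ((\<lambda>x. gauss \<alpha> (f x) (g x)) \<longlongrightarrow> gauss \<alpha> a b) F"
  unfolding gauss_def by (intro tendsto_intros)

lemma continuous_on_gauss [continuous_intros]:
  "continuous_on S f \<Longrightarrow> continuous_on S g \<Longrightarrow> continuous_on S (\<lambda>x. gauss \<alpha> (f x) (g x))"
  unfolding gauss_def by (intro continuous_intros)

text \<open>The maximum of \<open>w y * gauss \<alpha> y \<xi>\<close> over \<open>y\<close> is the exponential of the sup-convolution
  of \<open>ln w\<close> at \<open>\<xi>\<close>; this form needs no convention for \<open>w y = 0\<close>.\<close>

definition gauss_argmax :: "real \<Rightarrow> 'a::metric_space set \<Rightarrow> ('a \<Rightarrow> real) \<Rightarrow> 'a \<Rightarrow> 'a \<Rightarrow> bool" where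
  "gauss_argmax \<alpha> K w \<xi> x \<longleftrightarrow> x \<in> K \<and> (\<forall>y\<in>K. w y * gauss \<alpha> y \<xi> \<le> w x * gauss \<alpha> x \<xi>)"

text \<open>Maximisers for \<xi> near \<xi>0 accumulate only at maximisers for \<xi>0, hence at x0.
  Semicontinuity gives no lower bound on w near x0; the bound c < w x comes from maximality tested
  with x0, divided by a Gaussian factor.\<close>

lemma gauss_argmax_stable:
  assumes K: "compact K" and w: "upper_semicontinuous_on K w" and x0: "x0 \<in> K"
    and uniq: "\<And>x. gauss_argmax \<alpha> K w \<xi>0 x \<Longrightarrow> x = x0"
    and \<eta>: "\<eta> > 0" and c: "c < w x0"
  shows "\<exists>r>0. \<forall>\<xi> x. dist \<xi> \<xi>0 \<le> r \<longrightarrow> gauss_argmax \<alpha> K w \<xi> x \<longrightarrow> dist x x0 < \<eta> \<and> c < w x"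
proof (rule ccontr)
  assume "\<not> ?thesis"
  then have "\<forall>n::nat. \<exists>\<xi> x. dist \<xi> \<xi>0 \<le> inverse (real (Suc n)) \<and> gauss_argmax \<alpha> K w \<xi> x
      \<and> \<not> (dist x x0 < \<eta> \<and> c < w x)"
    by (metis inverse_positive_iff_positive of_nat_0_less_iff zero_less_Suc)
  then obtain Z X where ZX: "\<And>n::nat. dist (Z n) \<xi>0 \<le> inverse (real (Suc n))"
    "\<And>n. gauss_argmax \<alpha> K w (Z n) (X n)" "\<And>n. \<not> (dist (X n) x0 < \<eta> \<and> c < w (X n))"
    by metis
  have XK: "X n \<in> K" for n using ZX(2) by (simp add: gauss_argmax_def)
  then obtain x' s where s: "x' \<in> K" "strict_mono s" "(X \<circ> s) \<longlonglongrightarrow> x'"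
    using K unfolding compact_def by metis
  have "Z \<longlonglongrightarrow> \<xi>0"
    unfolding tendsto_dist_iff[of Z]
    by (rule Lim_null_comparison[OF _ LIMSEQ_inverse_real_of_nat]) (use ZX(1) in auto)
  then have Zs: "(\<lambda>n. Z (s n)) \<longlonglongrightarrow> \<xi>0"
    using LIMSEQ_subseq_LIMSEQ[OF _ s(2)] by (force simp: o_def)
  have Xs: "(\<lambda>n. X (s n)) \<longlonglongrightarrow> x'" using s(3) by (simp add: o_def)
  \<comment> \<open>By maximality \<open>d y n\<close> bounds w from below at the maximiser, and it
    converges because only Gaussian factors depend on n.\<close>
  define d where "d y n = w y * gauss \<alpha> y (Z (s n)) / gauss \<alpha> (X (s n)) (Z (s n))" for y n
  have dle: "d y n \<le> w (X (s n))" if "y \<in> K" for y n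
    using ZX(2)[of "s n"] that unfolding d_def gauss_argmax_def by (simp add: pos_divide_le_eq)
  have dlim: "d y \<longlonglongrightarrow> w y * gauss \<alpha> y \<xi>0 / gauss \<alpha> x' \<xi>0" for y
    unfolding d_def by (intro tendsto_intros Zs Xs) simp
  have "w y * gauss \<alpha> y \<xi>0 \<le> w x' * gauss \<alpha> x' \<xi>0" if "y \<in> K" for y
  proof -
    have "w y * gauss \<alpha> y \<xi>0 / gauss \<alpha> x' \<xi>0 \<le> w x'"
      by (rule upper_semicontinuous_on_seq_bound[OF w _ Xs s(1) dle[OF that] dlim]) (rule XK)
    then show ?thesis by (simp add: pos_divide_le_eq)
  qed
  then have "x' = x0" using uniq s(1) by (simp add: gauss_argmax_def)
  have "d x0 \<longlonglongrightarrow> w x0" using dlim[of x0] by (simp add: \<open>x' = x0\<close>)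
  then have "\<forall>\<^sub>F n in sequentially. c < d x0 n" using c by (rule order_tendstoD)
  moreover have "\<forall>\<^sub>F n in sequentially. dist (X (s n)) x0 < \<eta>"
    using tendstoD[OF Xs \<eta>] by (simp add: \<open>x' = x0\<close>)
  ultimately have "\<forall>\<^sub>F n in sequentially. False"
  proof eventually_elim
    case (elim n)
    then show ?case using dle[OF x0, of n] ZX(3)[of "s n"] by simp
  qed
  then show False by simp
qed

lemma real_polynomial_translate:
  fixes f :: "'a::euclidean_space \<Rightarrow> real"
  assumes "real_polynomial_function f"
  shows "real_polynomial_function (\<lambda>x. f (x + a))"
proof -
  have "polynomial_function (\<lambda>x::'a. x + a)"
    by (intro polynomial_function_add polynomial_function_const polynomial_function_id)
  then show ?thesis
    using real_polynomial_function_compose[OF _ assms] by (fastforce simp: o_def)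
qed

lemma real_polynomial_add_const:
  "real_polynomial_function f \<Longrightarrow> real_polynomial_function (\<lambda>x. f x + c)"
  by (intro real_polynomial_function.intros(2,3))

lemma partial_add_const:
  fixes f :: "'a::euclidean_space \<Rightarrow> real"
  assumes "real_polynomial_function f"
  shows "partial i (\<lambda>x. f x + c) = partial i f"
  using partial_add[OF real_polynomial_differentiable[OF assms] differentiable_const]
  by (simp add: fun_eq_iff)

lemma partial_translate_polynomial:
  fixes f :: "'a::euclidean_space \<Rightarrow> real"
  assumes "real_polynomial_function f"
  shows "partial i (\<lambda>x. f (x + a)) = (\<lambda>x. partial i f (x + a))"
  using partial_translate[OF real_polynomial_differentiable[OF assms]] by (simp add: fun_eq_iff)

text \<open>One maximum is read in two ways. With x = x1 fixed and \<xi> varying, \<phi> + \<alpha>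
  |\<xi> - x1|^2 has a local minimum at \<xi>1, which gives the gradient and the lower bound on the
  Hessian. With x and \<xi> shifted by the same vector the Gaussian is unchanged, so the translate H
  of \<phi> is a test function for ln w at x1 with the same derivatives.\<close>

lemma sup_convolution_touching:
  fixes \<xi>1 x1 :: "'a::euclidean_space"
  assumes \<phi>: "real_polynomial_function \<phi>" and x1: "x1 \<in> K" "0 < w x1"
    and touch: "\<forall>\<^sub>F \<xi> in nhds \<xi>1. \<forall>x\<in>K.
      w x * gauss \<alpha> x \<xi> * exp (- \<phi> \<xi>) \<le> w x1 * gauss \<alpha> x1 \<xi>1 * exp (- \<phi> \<xi>1)"
  defines "H \<equiv> \<lambda>x. \<phi> (x + (\<xi>1 - x1)) + (ln (w x1) - \<phi> \<xi>1)"
  shows "gauss_argmax \<alpha> K w \<xi>1 x1"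
    and "gradient \<phi> \<xi>1 = (2 * \<alpha>) *\<^sub>R (x1 - \<xi>1)"
    and "0 \<le> (\<Sum>i\<in>Basis. \<Sum>j\<in>Basis. (h \<bullet> i) * (h \<bullet> j) * partial i (partial j \<phi>) \<xi>1) + 2 * \<alpha> * (norm h)\<^sup>2"
    and "real_polynomial_function H" "exp (H x1) = w x1"
    and "\<forall>\<^sub>F x in nhds x1. x \<in> K \<longrightarrow> w x \<le> exp (H x)"
    and "gradient H x1 = gradient \<phi> \<xi>1" "lin_op c H x1 = lin_op c \<phi> \<xi>1"
proof -
  show "gauss_argmax \<alpha> K w \<xi>1 x1"
    using eventually_nhds_x_imp_x[OF touch] x1 by (simp add: gauss_argmax_def)
  define G where "G = (\<lambda>\<xi>. \<phi> \<xi> + \<alpha> * (norm (\<xi> - x1))\<^sup>2)"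
  have polyq: "real_polynomial_function (\<lambda>\<xi>. \<alpha> * (norm (\<xi> - x1))\<^sup>2)"
    by (intro real_polynomial_function.intros(2,4) real_polynomial_norm_sq)
  have polyG: "real_polynomial_function G"
    unfolding G_def by (intro real_polynomial_function.intros(3) \<phi> polyq)
  have "local_min_at G \<xi>1"
    unfolding local_min_at_def using touch
  proof eventually_elim
    case (elim \<xi>)
    have "gauss \<alpha> x1 \<zeta> * exp (- \<phi> \<zeta>) = exp (- G \<zeta>)" for \<zeta>
      by (simp add: gauss_def G_def dist_norm norm_minus_commute exp_diff exp_minus field_simps)
    then have "w x1 * exp (- G \<xi>) \<le> w x1 * exp (- G \<xi>1)"
      using elim[rule_format, OF x1(1)] by (simp add: mult.assoc)
    then show ?case using x1(2) by simp
  qed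
  note min = real_polynomial_local_min[OF polyG this]
  have pq: "partial i (\<lambda>\<xi>. \<alpha> * (norm (\<xi> - x1))\<^sup>2) = (\<lambda>\<xi>. \<alpha> * (2 * ((\<xi> - x1) \<bullet> i)))" for i
    using real_polynomial_differentiable[OF real_polynomial_norm_sq[of x1]]
    by (simp add: fun_eq_iff partial_cmult partial_norm_sq)
  have pG: "partial i G \<xi> = partial i \<phi> \<xi> + \<alpha> * (2 * ((\<xi> - x1) \<bullet> i))" for i \<xi>
    unfolding G_def
    by (simp add: partial_add[OF real_polynomial_differentiable[OF \<phi>] real_polynomial_differentiable[OF polyq]] pq)
  show "gradient \<phi> \<xi>1 = (2 * \<alpha>) *\<^sub>R (x1 - \<xi>1)"
  proof (rule euclidean_eqI)
    fix i :: 'a assume i: "i \<in> Basis"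
    have "partial i \<phi> \<xi>1 + \<alpha> * (2 * ((\<xi>1 - x1) \<bullet> i)) = 0"
      using min(1)[OF i] pG by simp
    then show "gradient \<phi> \<xi>1 \<bullet> i = (2 * \<alpha>) *\<^sub>R (x1 - \<xi>1) \<bullet> i"
      by (simp add: gradient_inner[OF i] inner_diff_left algebra_simps)
  qed
  have ppG: "partial i (partial j G) \<xi>1 = partial i (partial j \<phi>) \<xi>1 + 2 * \<alpha> * (i \<bullet> j)" for i j
    unfolding G_def partial_partial_add[OF \<phi> polyq]
      partial_partial_cmult[OF real_polynomial_norm_sq] partial_partial_norm_sq by simp
  show "0 \<le> (\<Sum>i\<in>Basis. \<Sum>j\<in>Basis. (h \<bullet> i) * (h \<bullet> j) * partial i (partial j \<phi>) \<xi>1) + 2 * \<alpha> * (norm h)\<^sup>2"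
  proof -
    have "(\<Sum>i\<in>Basis. \<Sum>j\<in>Basis. (h \<bullet> i) * (h \<bullet> j) * partial i (partial j G) \<xi>1)
      = (\<Sum>i\<in>Basis. \<Sum>j\<in>Basis. (h \<bullet> i) * (h \<bullet> j) * partial i (partial j \<phi>) \<xi>1)
        + (\<Sum>i\<in>Basis. \<Sum>j\<in>Basis. of_bool (i = j) * (2 * \<alpha> * ((h \<bullet> i) * (h \<bullet> j))))"
      unfolding sum.distrib[symmetric] ppG
      by (intro sum.cong refl) (auto simp: inner_Basis algebra_simps)
    also have "(\<Sum>i\<in>Basis. \<Sum>j\<in>Basis. of_bool (i = j) * (2 * \<alpha> * ((h \<bullet> i) * (h \<bullet> j)))) = 2 * \<alpha> * (norm h)\<^sup>2"
      by (simp add: sum_of_bool_Basis power2_norm_eq_inner euclidean_inner[of h h] sum_distrib_left)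
    finally show ?thesis using min(2)[of h] by simp
  qed
  have tr: "real_polynomial_function (\<lambda>x. \<phi> (x + (\<xi>1 - x1)))"
    by (rule real_polynomial_translate[OF \<phi>])
  show "real_polynomial_function H"
    unfolding H_def by (rule real_polynomial_add_const[OF tr])
  show "exp (H x1) = w x1" using x1 by (simp add: H_def)
  have pH: "partial i H = (\<lambda>x. partial i \<phi> (x + (\<xi>1 - x1)))" for i
    unfolding H_def partial_add_const[OF tr] partial_translate_polynomial[OF \<phi>] ..
  then show "gradient H x1 = gradient \<phi> \<xi>1" by (simp add: gradient_def)
  show "lin_op c H x1 = lin_op c \<phi> \<xi>1"
    by (simp add: lin_op_def pH partial_translate_polynomial real_polynomial_partial \<phi>)
  have "((\<lambda>x. x + (\<xi>1 - x1)) \<longlongrightarrow> x1 + (\<xi>1 - x1)) (nhds x1)"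
    by (intro tendsto_intros filterlim_ident)
  then have "filterlim (\<lambda>x. x + (\<xi>1 - x1)) (nhds \<xi>1) (nhds x1)" by simp
  from eventually_compose_filterlim[OF touch this]
  show "\<forall>\<^sub>F x in nhds x1. x \<in> K \<longrightarrow> w x \<le> exp (H x)"
  proof eventually_elim
    case (elim x)
    show ?case
    proof
      assume x: "x \<in> K"
      have "dist x (x + (\<xi>1 - x1)) = dist x1 \<xi>1"
        by (simp add: dist_norm norm_minus_commute)
      then have "w x * gauss \<alpha> x1 \<xi>1 * exp (- \<phi> (x + (\<xi>1 - x1))) \<le> w x1 * gauss \<alpha> x1 \<xi>1 * exp (- \<phi> \<xi>1)"
        using elim[rule_format, OF x] by (simp add: gauss_def)
      then have "gauss \<alpha> x1 \<xi>1 * (w x * exp (- \<phi> (x + (\<xi>1 - x1)))) \<le> gauss \<alpha> x1 \<xi>1 * (w x1 * exp (- \<phi> \<xi>1))"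
        by (simp add: mult_ac)
      then have "w x * exp (- \<phi> (x + (\<xi>1 - x1))) \<le> w x1 * exp (- \<phi> \<xi>1)" by simp
      then have "w x * exp (- \<phi> (x + (\<xi>1 - x1))) * exp (\<phi> (x + (\<xi>1 - x1))) 
          \<le> w x1 * exp (- \<phi> \<xi>1) * exp (\<phi> (x + (\<xi>1 - x1)))"
        by (rule mult_right_mono) simp
      moreover have "w x1 * exp (- \<phi> \<xi>1) * exp (\<phi> (x + (\<xi>1 - x1))) = exp (H x)"
        using x1(2) by (simp add: H_def exp_add exp_diff exp_minus field_simps)
      moreover have "w x * exp (- \<phi> (x + (\<xi>1 - x1))) * exp (\<phi> (x + (\<xi>1 - x1))) = w x"
        by (simp add: mult.assoc flip: exp_add)
      ultimately show "w x \<le> exp (H x)" by simp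
    qed
  qed
qed

text \<open>Near the touching point the gradients of the test polynomials are close to \<open>q0\<close> and their
  Hessians are bounded below, so the coefficients can be frozen: the sup-convolution is a
  subsolution of a linear equation with constant coefficients.\<close>

lemma sup_convolution_le_polynomial:
  fixes \<xi>0 x0 :: "'a::euclidean_space"
  assumes K: "compact K" and w: "upper_semicontinuous_on K w" and w0: "\<And>x. x \<in> K \<Longrightarrow> 0 \<le> w x"
    and \<Omega>: "open \<Omega>" "\<Omega> \<subseteq> K" "x0 \<in> \<Omega>" and \<alpha>: "\<alpha> > 0"
    and uniq: "\<And>x. gauss_argmax \<alpha> K w \<xi>0 x \<Longrightarrow> x = x0"
    and q0: "q0 = (2 * \<alpha>) *\<^sub>R (x0 - \<xi>0)" and B: "isCont B q0" and \<kappa>: "\<kappa> > 0" and \<eta>: "\<eta> > 0"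
    and sub: "\<forall>\<^sub>F x1 in nhds x0. c < w x1 \<longrightarrow> (\<forall>H. real_polynomial_function H \<longrightarrow> exp (H x1) = w x1 \<longrightarrow>
        (\<forall>\<^sub>F x in nhds x1. w x \<le> exp (H x)) \<longrightarrow>
        B (gradient H x1) \<le> lin_op (plap_coeff p (gradient H x1)) H x1)"
    and c: "c < w x0"
    and frozen: "\<And>q X. dist q q0 < \<eta> \<Longrightarrow>
      (\<And>h. 0 \<le> (\<Sum>i\<in>Basis. \<Sum>j\<in>Basis. (h \<bullet> i) * (h \<bullet> j) * X i j) + 2 * \<alpha> * (norm h)\<^sup>2) \<Longrightarrow>
      (\<Sum>i\<in>Basis. \<Sum>j\<in>Basis. plap_coeff p q i j * X i j)
        \<le> (\<Sum>i\<in>Basis. \<Sum>j\<in>Basis. A i j * X i j) + \<kappa>"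
  shows "\<exists>r0>0. \<forall>r H. 0 < r \<longrightarrow> r \<le> r0 \<longrightarrow> real_polynomial_function H \<longrightarrow>
      (\<forall>\<xi>\<in>ball \<xi>0 r. lin_op A H \<xi> \<le> B q0 - 2 * \<kappa>) \<longrightarrow>
      (\<forall>\<xi>\<in>sphere \<xi>0 r. \<forall>x\<in>K. w x * gauss \<alpha> x \<xi> \<le> exp (H \<xi>)) \<longrightarrow>
      (\<forall>x\<in>K. w x * gauss \<alpha> x \<xi>0 \<le> exp (H \<xi>0))"
proof -
  have "\<forall>\<^sub>F q in nhds q0. B q0 - \<kappa> < B q"
    using B \<kappa> by (intro order_tendstoD(1)[where y = "B q0"]) (auto simp: isCont_def tendsto_nhds_iff)
  then obtain \<eta>1 where \<eta>1: "\<eta>1 > 0" "\<And>q. dist q q0 < \<eta>1 \<Longrightarrow> B q0 - \<kappa> < B q"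
    unfolding eventually_nhds_metric by blast
  have "\<forall>\<^sub>F x in nhds x0. x \<in> \<Omega>" using \<Omega> by (intro eventually_nhds_in_open)
  define good where "good x1 \<longleftrightarrow> (c < w x1 \<longrightarrow> (\<forall>H. real_polynomial_function H \<longrightarrow> exp (H x1) = w x1 \<longrightarrow>
        (\<forall>\<^sub>F x in nhds x1. w x \<le> exp (H x)) \<longrightarrow>
        B (gradient H x1) \<le> lin_op (plap_coeff p (gradient H x1)) H x1))" for x1
  from sub \<open>\<forall>\<^sub>F x in nhds x0. x \<in> \<Omega>\<close> have "\<forall>\<^sub>F x1 in nhds x0. good x1 \<and> x1 \<in> \<Omega>"
    unfolding good_def by (rule eventually_conj)
  then obtain \<eta>2 where \<eta>2: "\<eta>2 > 0" and good: "\<And>x1. dist x1 x0 < \<eta>2 \<Longrightarrow> good x1"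
      and in\<Omega>: "\<And>x1. dist x1 x0 < \<eta>2 \<Longrightarrow> x1 \<in> \<Omega>"
    unfolding eventually_nhds_metric by blast
  \<comment> \<open>Gradients at contact are 2 \<alpha> (x1 - \<xi>1). Displacements below \<eta>3
    of x1 from x0 and of \<xi>1 from \<xi>0 therefore keep them within 4 \<alpha> \<eta>3 = min
    \<eta> \<eta>1 of \<open>q0\<close>.\<close>
  define \<eta>3 where "\<eta>3 = min \<eta> \<eta>1 / (4 * \<alpha>)"
  have \<eta>3: "\<eta>3 > 0" using \<eta> \<eta>1(1) \<alpha> by (simp add: \<eta>3_def)
  have "x0 \<in> K" "min \<eta>2 \<eta>3 > 0" using \<Omega> \<eta>2 \<eta>3 by auto
  from gauss_argmax_stable[OF K w this(1) uniq this(2) c]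
  obtain r1 where r1: "r1 > 0" "\<And>\<xi> x. dist \<xi> \<xi>0 \<le> r1 \<Longrightarrow> gauss_argmax \<alpha> K w \<xi> x \<Longrightarrow>
      dist x x0 < min \<eta>2 \<eta>3 \<and> c < w x"
    by blast
  show ?thesis
  proof (intro exI[of _ "min r1 \<eta>3"] conjI allI impI ballI)
    show "0 < min r1 \<eta>3" using r1(1) \<eta>3 by simp
    fix r H x
    assume r: "0 < r" "r \<le> min r1 \<eta>3" and H: "real_polynomial_function H"
      and LH: "\<forall>\<xi>\<in>ball \<xi>0 r. lin_op A H \<xi> \<le> B q0 - 2 * \<kappa>"
      and sph: "\<forall>\<xi>\<in>sphere \<xi>0 r. \<forall>x\<in>K. w x * gauss \<alpha> x \<xi> \<le> exp (H \<xi>)" and x: "x \<in> K"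
    \<comment> \<open>A value of G above 1 at \<xi>0 forces its maximum away from the sphere, where
      G is at most 1; the maximum is then an interior contact to which the touching lemma
      applies.\<close>
    define G where "G = (\<lambda>z. w (fst z) * (gauss \<alpha> (fst z) (snd z) * exp (- H (snd z))))"
    have contH: "continuous_on S (\<lambda>z. H (snd z))" for S :: "('a \<times> 'a) set"
      by (rule continuous_on_compose2[OF real_polynomial_continuous_on[OF H, of UNIV]])
         (auto intro: continuous_intros)
    have uscG: "upper_semicontinuous_on (K \<times> cball \<xi>0 r) G"
      unfolding G_def
    proof (rule upper_semicontinuous_on_mult)
      show "upper_semicontinuous_on (K \<times> cball \<xi>0 r) (\<lambda>z. w (fst z))"
        by (rule upper_semicontinuous_on_compose[OF w]) (auto intro: continuous_intros)
      show "continuous_on (K \<times> cball \<xi>0 r) (\<lambda>z. gauss \<alpha> (fst z) (snd z) * exp (- H (snd z)))"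
        by (intro continuous_intros contH)
    qed (auto simp: w0)
    have "compact (K \<times> cball \<xi>0 r)" "K \<times> cball \<xi>0 r \<noteq> {}"
      using K x r(1) by (auto intro: compact_Times)
    from upper_semicontinuous_on_attains_sup[OF this uscG]
    obtain z where z: "z \<in> K \<times> cball \<xi>0 r" "\<And>y. y \<in> K \<times> cball \<xi>0 r \<Longrightarrow> G y \<le> G z"
      by blast
    obtain x1 \<xi>1 where z_eq: "z = (x1, \<xi>1)" by fastforce
    have x1: "x1 \<in> K" and \<xi>1: "\<xi>1 \<in> cball \<xi>0 r" using z(1) z_eq by auto
    show "w x * gauss \<alpha> x \<xi>0 \<le> exp (H \<xi>0)"
    proof (rule ccontr)
      assume "\<not> ?thesis"
      then have "1 < G (x, \<xi>0)"
        by (simp add: G_def exp_minus field_simps)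
      also have "G (x, \<xi>0) \<le> G z" using x r(1) by (intro z(2)) auto
      finally have G1: "1 < w x1 * gauss \<alpha> x1 \<xi>1 * exp (- H \<xi>1)" by (simp add: G_def z_eq mult.assoc)
      have "\<xi>1 \<notin> sphere \<xi>0 r"
      proof
        assume "\<xi>1 \<in> sphere \<xi>0 r"
        then have "w x1 * gauss \<alpha> x1 \<xi>1 * exp (- H \<xi>1) \<le> exp (H \<xi>1) * exp (- H \<xi>1)"
          using sph x1 by (intro mult_right_mono) auto
        with G1 show False by (simp flip: exp_add)
      qed
      then have \<xi>1b: "\<xi>1 \<in> ball \<xi>0 r" using \<xi>1 by auto
      have wx1: "0 < w x1"
        using G1 w0[OF x1] by (cases "w x1 = 0") auto
      have touch: "\<forall>\<^sub>F \<xi> in nhds \<xi>1. \<forall>x\<in>K.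
          w x * gauss \<alpha> x \<xi> * exp (- H \<xi>) \<le> w x1 * gauss \<alpha> x1 \<xi>1 * exp (- H \<xi>1)"
        using eventually_nhds_in_open[OF open_ball \<xi>1b]
      proof eventually_elim
        case (elim \<xi>)
        then show ?case using z(2)[of "(_, \<xi>)"] by (auto simp: G_def z_eq mult.assoc)
      qed
      note T = sup_convolution_touching[OF H x1 wx1 touch]
      have near: "dist x1 x0 < \<eta>2" "dist x1 x0 < \<eta>3" "c < w x1"
        using r1(2)[OF _ T(1)] \<xi>1 r(2) by (auto simp: dist_commute)
      define q where "q = gradient H \<xi>1"
      have q: "q = (2 * \<alpha>) *\<^sub>R (x1 - \<xi>1)" unfolding q_def by (rule T(2))
      have "dist q q0 < min \<eta> \<eta>1"
      proof -
        have "dist q q0 = (2 * \<alpha>) * norm ((x1 - x0) - (\<xi>1 - \<xi>0))"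
          using \<alpha> by (simp add: q q0 dist_norm algebra_simps flip: scaleR_right_diff_distrib)
        also have "\<dots> \<le> (2 * \<alpha>) * (dist x1 x0 + dist \<xi>1 \<xi>0)"
          using \<alpha> norm_triangle_ineq4[of "x1 - x0" "\<xi>1 - \<xi>0"] by (simp add: dist_norm)
        also have "\<dots> < (2 * \<alpha>) * (\<eta>3 + \<eta>3)"
          using \<alpha> near(2) \<xi>1b r(2) by (intro mult_strict_left_mono add_strict_mono) (auto simp: dist_commute)
        also have "\<dots> = min \<eta> \<eta>1" using \<alpha> by (simp add: \<eta>3_def)
        finally show ?thesis .
      qed
      then have dq: "dist q q0 < \<eta>" "B q0 - \<kappa> < B q" using \<eta>1(2) by auto
      define F where "F = (\<lambda>x. H (x + (\<xi>1 - x1)) + (ln (w x1) - H \<xi>1))"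
      have "\<forall>\<^sub>F x in nhds x1. x \<in> K"
        using eventually_nhds_in_open[OF \<Omega>(1) in\<Omega>[OF near(1)]]
        by (rule eventually_mono) (use \<Omega>(2) in auto)
      with T(6) have "\<forall>\<^sub>F x in nhds x1. w x \<le> exp (F x)"
        unfolding F_def by eventually_elim blast
      then have "B (gradient F x1) \<le> lin_op (plap_coeff p (gradient F x1)) F x1"
        using T(4,5) near(3) good[OF near(1)] unfolding good_def F_def by simp
      \<comment> \<open>The margin 2 \<kappa> is spent here: one \<kappa> on freezing the
        coefficients, the other on passing from B q to B q0.\<close>
      then have "B q \<le> lin_op (plap_coeff p q) H \<xi>1"
        using T(7,8) unfolding F_def[symmetric] q_def by metis
      also have "\<dots> \<le> lin_op A H \<xi>1 + \<kappa>"
        unfolding lin_op_def by (rule frozen[OF dq(1) T(3)])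
      also have "\<dots> \<le> B q0 - \<kappa>" using LH \<xi>1b by fastforce
      finally show False using dq(2) by simp
    qed
  qed
qed

section \<open>Elliptic comparison\<close>

text \<open>The exponent |\<xi> - x|^2 + |\<xi> - y|^2 has its only critical point at the midpoint.
  Either of x and y thus determines the other, which yields the uniqueness of maximisers.\<close>

lemma gauss_midpoint:
  fixes \<xi>0 x y :: "'a::euclidean_space"
  assumes \<alpha>: "\<alpha> > 0" and \<Omega>: "open \<Omega>" "\<xi>0 \<in> \<Omega>"
    and max: "\<And>\<xi>. \<xi> \<in> \<Omega> \<Longrightarrow> gauss \<alpha> x \<xi> * gauss \<alpha> y \<xi> \<le> gauss \<alpha> x \<xi>0 * gauss \<alpha> y \<xi>0"
  shows "x + y = 2 *\<^sub>R \<xi>0"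
proof -
  define G where "G = (\<lambda>\<xi>. (norm (\<xi> - x))\<^sup>2 + (norm (\<xi> - y))\<^sup>2)"
  have eq: "gauss \<alpha> x \<xi> * gauss \<alpha> y \<xi> = exp (- (\<alpha> * G \<xi>))" for \<xi>
    unfolding gauss_def G_def exp_add[symmetric] by (simp add: dist_norm norm_minus_commute algebra_simps)
  have "local_min_at G \<xi>0"
    unfolding local_min_at_def using eventually_nhds_in_open[OF \<Omega>]
  proof eventually_elim
    case (elim \<xi>)
    then show ?case using max[of \<xi>] \<alpha> unfolding eq by simp
  qed
  moreover have "real_polynomial_function G"
    unfolding G_def by (intro real_polynomial_function.intros(3) real_polynomial_norm_sq)
  ultimately have "partial i G \<xi>0 = 0" if "i \<in> Basis" for i
    using real_polynomial_local_min(1) that by blast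
  moreover have "partial i G \<xi>0 = 2 * ((\<xi>0 - x) \<bullet> i) + 2 * ((\<xi>0 - y) \<bullet> i)" for i
    unfolding G_def
    by (simp add: partial_add real_polynomial_differentiable real_polynomial_norm_sq partial_norm_sq)
  ultimately have *: "2 * ((\<xi>0 - x) \<bullet> i) + 2 * ((\<xi>0 - y) \<bullet> i) = 0" if "i \<in> Basis" for i
    using that by metis
  show ?thesis
  proof (rule euclidean_eqI)
    fix i :: 'a assume "i \<in> Basis"
    from *[OF this] show "(x + y) \<bullet> i = (2 *\<^sub>R \<xi>0) \<bullet> i"
      by (simp add: inner_diff_left inner_add_left)
  qed
qed

text \<open>Uniform continuity carries over to the maximum. It makes the convolution of 1 / v
  continuous on a sphere, so that polynomials can approximate its logarithm.\<close>

lemma compact_sup_continuous: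
  fixes f :: "'a::metric_space \<times> 'b::metric_space \<Rightarrow> real"
  assumes K: "compact K" "K \<noteq> {}" and T: "compact T" and f: "continuous_on (K \<times> T) f"
  obtains S where "continuous_on T S" "\<And>\<xi>. \<xi> \<in> T \<Longrightarrow> \<exists>y\<in>K. S \<xi> = f (y, \<xi>)"
    "\<And>\<xi> y. \<xi> \<in> T \<Longrightarrow> y \<in> K \<Longrightarrow> f (y, \<xi>) \<le> S \<xi>"
proof -
  have "\<exists>y\<in>K. \<forall>y'\<in>K. f (y', \<xi>) \<le> f (y, \<xi>)" if "\<xi> \<in> T" for \<xi>
    using that by (intro continuous_attains_sup K continuous_on_compose2[OF f]) (auto intro: continuous_intros)
  then obtain Y where Y: "\<And>\<xi>. \<xi> \<in> T \<Longrightarrow> Y \<xi> \<in> K" "\<And>\<xi> y. \<xi> \<in> T \<Longrightarrow> y \<in> K \<Longrightarrow> f (y, \<xi>) \<le> f (Y \<xi>, \<xi>)"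
    by metis
  have "continuous_on T (\<lambda>\<xi>. f (Y \<xi>, \<xi>))"
    unfolding continuous_on_iff
  proof (intro ballI allI impI)
    fix \<xi> e :: _ assume \<xi>: "\<xi> \<in> T" and e: "(0::real) < e"
    have "uniformly_continuous_on (K \<times> T) f"
      using f K T by (intro compact_uniformly_continuous compact_Times)
    then obtain d where d: "d > 0" "\<And>z z'. z \<in> K \<times> T \<Longrightarrow> z' \<in> K \<times> T \<Longrightarrow> dist z' z < d \<Longrightarrow> dist (f z') (f z) < e"
      using e unfolding uniformly_continuous_on_def by metis
    have le: "f (Y \<zeta>, \<zeta>) - f (Y \<zeta>', \<zeta>') < e" if "\<zeta> \<in> T" "\<zeta>' \<in> T" "dist \<zeta>' \<zeta> < d" for \<zeta> \<zeta>'
    proof -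
      have "dist (f (Y \<zeta>, \<zeta>')) (f (Y \<zeta>, \<zeta>)) < e"
        using that Y(1) by (intro d(2)) (auto simp: dist_Pair_Pair)
      moreover have "f (Y \<zeta>, \<zeta>') \<le> f (Y \<zeta>', \<zeta>')" using that Y by auto
      ultimately show ?thesis by (simp add: dist_real_def)
    qed
    show "\<exists>d>0. \<forall>\<zeta>\<in>T. dist \<zeta> \<xi> < d \<longrightarrow> dist (f (Y \<zeta>, \<zeta>)) (f (Y \<xi>, \<xi>)) < e"
    proof (intro exI[of _ d] conjI ballI impI)
      fix \<zeta> assume "\<zeta> \<in> T" "dist \<zeta> \<xi> < d"
      with \<xi> show "dist (f (Y \<zeta>, \<zeta>)) (f (Y \<xi>, \<xi>)) < e"
        using le[of \<zeta> \<xi>] le[of \<xi> \<zeta>] by (simp add: dist_real_def dist_commute abs_less_iff)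
    qed (fact d(1))
  qed
  then show ?thesis
    using that[of "\<lambda>\<xi>. f (Y \<xi>, \<xi>)"] Y by blast
qed

text \<open>At x = \<xi> = y = xs the product is \<theta> > 1 for every \<alpha>, so the Gaussian
  factors at the maximum cannot be small: |x - \<xi>|^2 + |y - \<xi>|^2 is O(1 / \<alpha>) and the
  three points merge as \<alpha> grows. At their limit w is at least \<theta> v > v, which places it
  in \<Omega>; one large \<alpha> then suffices.\<close>

lemma doubling_maximum:
  fixes w v :: "'a::euclidean_space \<Rightarrow> real"
  assumes K: "compact K" and \<Omega>: "open \<Omega>" and w: "upper_semicontinuous_on K w"
    and w0: "\<And>x. x \<in> K \<Longrightarrow> 0 \<le> w x"
    and v: "continuous_on K v" "\<And>x. x \<in> K \<Longrightarrow> 0 < v x"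
    and bd: "\<And>x. x \<in> K - \<Omega> \<Longrightarrow> w x \<le> v x"
    and xs: "xs \<in> K" "v xs < w xs"
  obtains \<alpha> x0 \<xi>0 y0 where "\<alpha> > 0" "x0 \<in> K \<inter> \<Omega>" "\<xi>0 \<in> K \<inter> \<Omega>" "y0 \<in> K \<inter> \<Omega>" "v x0 < w x0"
    "\<And>x \<xi> y. x \<in> K \<Longrightarrow> \<xi> \<in> K \<Longrightarrow> y \<in> K \<Longrightarrow>
      w x * gauss \<alpha> x \<xi> * (inverse (v y) * gauss \<alpha> y \<xi>)
        \<le> w x0 * gauss \<alpha> x0 \<xi>0 * (inverse (v y0) * gauss \<alpha> y0 \<xi>0)"
proof -
  define \<theta> where "\<theta> = w xs * inverse (v xs)"
  have \<theta>: "\<theta> > 1" using xs v(2)[OF xs(1)] by (simp add: \<theta>_def field_simps)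
  define a where "a n = real (Suc n)" for n
  have "\<exists>z\<in>K \<times> K \<times> K. \<forall>y\<in>K \<times> K \<times> K.
      w (fst y) * (gauss (a n) (fst y) (fst (snd y)) * (inverse (v (snd (snd y))) * gauss (a n) (snd (snd y)) (fst (snd y))))
      \<le> w (fst z) * (gauss (a n) (fst z) (fst (snd z)) * (inverse (v (snd (snd z))) * gauss (a n) (snd (snd z)) (fst (snd z))))" for n
  proof (rule upper_semicontinuous_on_attains_sup)
    show "upper_semicontinuous_on (K \<times> K \<times> K) (\<lambda>y. w (fst y) * (gauss (a n) (fst y) (fst (snd y))
        * (inverse (v (snd (snd y))) * gauss (a n) (snd (snd y)) (fst (snd y)))))"
    proof (rule upper_semicontinuous_on_mult)
      show "upper_semicontinuous_on (K \<times> K \<times> K) (\<lambda>y. w (fst y))"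
        by (rule upper_semicontinuous_on_compose[OF w]) (auto intro: continuous_intros)
      have "continuous_on (K \<times> K \<times> K) (\<lambda>y. v (snd (snd y)))"
        by (rule continuous_on_compose2[OF v(1) continuous_on_snd[OF continuous_on_snd[OF continuous_on_id]]]) auto
      then show "continuous_on (K \<times> K \<times> K) (\<lambda>y. gauss (a n) (fst y) (fst (snd y))
        * (inverse (v (snd (snd y))) * gauss (a n) (snd (snd y)) (fst (snd y))))"
        using v(2) by (intro continuous_intros) (auto simp: less_imp_neq[symmetric])
    qed (use w0 v(2) in auto)
  qed (use K xs(1) in \<open>auto intro: compact_Times\<close>)
  then obtain q where q: "\<And>n. q n \<in> K \<times> K \<times> K" "\<And>n y. y \<in> K \<times> K \<times> K \<Longrightarrow>
      w (fst y) * (gauss (a n) (fst y) (fst (snd y)) * (inverse (v (snd (snd y))) * gauss (a n) (snd (snd y)) (fst (snd y))))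
      \<le> w (fst (q n)) * (gauss (a n) (fst (q n)) (fst (snd (q n))) * (inverse (v (snd (snd (q n)))) * gauss (a n) (snd (snd (q n))) (fst (snd (q n)))))"
    by metis
  define X where "X n = fst (q n)" for n
  define Z where "Z n = fst (snd (q n))" for n
  define Y where "Y n = snd (snd (q n))" for n
  have inK: "X n \<in> K" "Z n \<in> K" "Y n \<in> K" for n
    using q(1)[of n] by (auto simp: X_def Y_def Z_def)
  have max: "w x * (gauss (a n) x \<xi> * (inverse (v y) * gauss (a n) y \<xi>))
      \<le> w (X n) * (gauss (a n) (X n) (Z n) * (inverse (v (Y n)) * gauss (a n) (Y n) (Z n)))"
    if "x \<in> K" "\<xi> \<in> K" "y \<in> K" for x \<xi> y n
    using q(2)[of "(x, \<xi>, y)" n] that by (simp add: X_def Y_def Z_def)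
  have \<theta>le: "\<theta> \<le> w (X n) * (gauss (a n) (X n) (Z n) * (inverse (v (Y n)) * gauss (a n) (Y n) (Z n)))" for n
    using max[OF xs(1) xs(1) xs(1), of n] by (simp add: \<theta>_def gauss_def)
  have Kne: "K \<noteq> {}" using xs(1) by blast
  obtain W where W: "\<And>x. x \<in> K \<Longrightarrow> w x \<le> W"
    using upper_semicontinuous_on_attains_sup[OF K Kne w] by auto
  obtain xm where xm: "xm \<in> K" "\<forall>x\<in>K. v xm \<le> v x"
    using continuous_attains_inf[OF K Kne v(1)] by auto
  define m where "m = v xm"
  have m: "m > 0" "\<And>x. x \<in> K \<Longrightarrow> m \<le> v x"
    using xm v(2) by (auto simp: m_def)
  have W0: "W > 0" using W[OF xs(1)] xs v(2)[OF xs(1)] by simp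
  have dists: "(dist (X n) (Z n))\<^sup>2 + (dist (Y n) (Z n))\<^sup>2 \<le> ln (W / m) * inverse (real (Suc n))" for n
  proof -
    define D where "D = (dist (X n) (Z n))\<^sup>2 + (dist (Y n) (Z n))\<^sup>2"
    have g: "gauss (a n) (X n) (Z n) * gauss (a n) (Y n) (Z n) = exp (- (a n * D))"
      unfolding gauss_def D_def exp_add[symmetric] by (simp add: algebra_simps)
    have "1 \<le> w (X n) * inverse (v (Y n)) * exp (- (a n * D))"
      unfolding g[symmetric] using \<theta>le[of n] \<theta> by (simp add: mult_ac)
    also have "\<dots> \<le> W * inverse m * exp (- (a n * D))"
      using W0 W w0 m v(2) inK by (intro mult_right_mono mult_mono le_imp_inverse_le) (auto intro: less_imp_le)
    finally have "exp (a n * D) \<le> W / m"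
      using W0 m(1) by (simp add: exp_minus field_simps)
    then have "a n * D \<le> ln (W / m)" using W0 m(1) by (simp add: ln_ge_iff)
    then show ?thesis unfolding D_def[symmetric] a_def by (simp add: field_simps del: of_nat_Suc)
  qed
  have small: "(\<lambda>n. ln (W / m) * inverse (real (Suc n))) \<longlonglongrightarrow> 0"
    using tendsto_mult_left[OF LIMSEQ_inverse_real_of_nat, of "ln (W / m)"] by simp
  obtain l s where s: "l \<in> K \<times> K \<times> K" "strict_mono s" "(q \<circ> s) \<longlonglongrightarrow> l"
    using compact_Times[OF K compact_Times[OF K K]] q(1) unfolding compact_def by metis
  define x' where "x' = fst l"
  have lims: "(\<lambda>n. X (s n)) \<longlonglongrightarrow> x'" "(\<lambda>n. Z (s n)) \<longlonglongrightarrow> fst (snd l)" "(\<lambda>n. Y (s n)) \<longlonglongrightarrow> snd (snd l)"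
    using s(3) unfolding X_def Y_def Z_def x'_def o_def by (auto intro: tendsto_intros)
  have "(\<lambda>n. (dist (X (s n)) (Z (s n)))\<^sup>2 + (dist (Y (s n)) (Z (s n)))\<^sup>2) \<longlonglongrightarrow>
      (dist x' (fst (snd l)))\<^sup>2 + (dist (snd (snd l)) (fst (snd l)))\<^sup>2"
    by (intro tendsto_intros lims)
  moreover have "(\<lambda>n. ln (W / m) * inverse (real (Suc (s n)))) \<longlonglongrightarrow> 0"
    using LIMSEQ_subseq_LIMSEQ[OF small s(2)] by (simp add: o_def)
  ultimately have "(dist x' (fst (snd l)))\<^sup>2 + (dist (snd (snd l)) (fst (snd l)))\<^sup>2 \<le> 0"
    by (rule LIMSEQ_le) (use dists in auto)
  then have eqs: "fst (snd l) = x'" "snd (snd l) = x'"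
    by (simp_all add: sum_power2_le_zero_iff)
  have x'K: "x' \<in> K" using s(1) by (auto simp: x'_def)
  have vlim: "(\<lambda>n. v (f n)) \<longlonglongrightarrow> v x'" if "f \<longlonglongrightarrow> x'" "\<And>n. f n \<in> K" for f :: "nat \<Rightarrow> 'a"
    using continuous_on_tendsto_compose[OF v(1) that(1) x'K] that(2) by simp
  \<comment> \<open>The comparison is between w at X and v at Y, two different points; the factor
    \<theta> > 1 leaves room to replace v at Y by v at X once the points are close.\<close>
  have \<theta>w: "\<theta> * v (Y n) \<le> w (X n)" for n
  proof -
    have g1: "gauss (a n) x y \<le> 1" for x y :: 'a
      by (simp add: gauss_def a_def mult_nonpos_nonneg)
    have "gauss (a n) (X n) (Z n) * gauss (a n) (Y n) (Z n) \<le> 1 * 1"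
      by (intro mult_mono g1) (auto simp: less_imp_le)
    then have "w (X n) * inverse (v (Y n)) * (gauss (a n) (X n) (Z n) * gauss (a n) (Y n) (Z n))
        \<le> w (X n) * inverse (v (Y n)) * 1"
      using w0 v(2) inK by (intro mult_left_mono) (auto simp: less_imp_le)
    then have "\<theta> \<le> w (X n) * inverse (v (Y n))"
      using \<theta>le[of n] by (simp add: mult_ac)
    then show ?thesis using v(2)[OF inK(3)[of n]] by (simp add: field_simps)
  qed
  have Ylim: "(\<lambda>n. Y (s n)) \<longlonglongrightarrow> x'" using lims(3) eqs by simp
  have "\<theta> * v x' \<le> w x'"
    by (rule upper_semicontinuous_on_seq_bound[OF w _ lims(1) x'K, of "\<lambda>n. \<theta> * v (Y (s n))"])
       (use inK \<theta>w in \<open>auto intro!: tendsto_intros vlim Ylim\<close>)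
  moreover have "v x' < \<theta> * v x'" using \<theta> v(2)[OF x'K] by simp
  ultimately have x'\<Omega>: "x' \<in> \<Omega>" using bd[of x'] x'K by force
  have "\<forall>\<^sub>F n in sequentially. X (s n) \<in> \<Omega>" "\<forall>\<^sub>F n in sequentially. Z (s n) \<in> \<Omega>"
      "\<forall>\<^sub>F n in sequentially. Y (s n) \<in> \<Omega>"
    using topological_tendstoD[OF lims(1) \<Omega> x'\<Omega>] topological_tendstoD[OF lims(2) \<Omega>]
      topological_tendstoD[OF Ylim \<Omega> x'\<Omega>] x'\<Omega> eqs by auto
  moreover have "\<forall>\<^sub>F n in sequentially. 0 < \<theta> * v (Y (s n)) - v (X (s n))"
  proof (rule order_tendstoD(1))
    show "(\<lambda>n. \<theta> * v (Y (s n)) - v (X (s n))) \<longlonglongrightarrow> \<theta> * v x' - v x'"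
      by (intro tendsto_intros vlim lims(1) Ylim inK)
    show "0 < \<theta> * v x' - v x'" using \<open>v x' < \<theta> * v x'\<close> by simp
  qed
  ultimately have "\<forall>\<^sub>F n in sequentially. X (s n) \<in> \<Omega> \<and> Z (s n) \<in> \<Omega> \<and> Y (s n) \<in> \<Omega> \<and> v (X (s n)) < w (X (s n))"
  proof eventually_elim
    case (elim n)
    then show ?case using \<theta>w[of "s n"] by auto
  qed
  then obtain n where n: "X (s n) \<in> \<Omega>" "Z (s n) \<in> \<Omega>" "Y (s n) \<in> \<Omega>" "v (X (s n)) < w (X (s n))"
    using eventually_happens trivial_limit_sequentially by blast
  show ?thesis
  proof (rule that[of "a (s n)" "X (s n)" "Z (s n)" "Y (s n)"])
    show "a (s n) > 0" by (simp add: a_def)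
  qed (use n inK max[where n="s n"] in \<open>auto simp: mult_ac\<close>)
qed

lemma gradient_minus:
  "f differentiable at x \<Longrightarrow> gradient (\<lambda>x. - f x) x = - gradient f x"
  by (simp add: gradient_def partial_minus sum_negf)

text \<open>The viscosity inequality divided by v^(p-1), with exponentials of polynomials touching v
  from below as the only tests. This is the common form of the two kinds of v: the explicit barrier
  and the competitors for the eigenvalue.\<close>

definition log_supersolution :: "real \<Rightarrow> real \<Rightarrow> 'a::euclidean_space set \<Rightarrow> ('a \<Rightarrow> real) \<Rightarrow> bool" where
  "log_supersolution p \<Lambda> \<Omega> v \<longleftrightarrow>
     (\<forall>y\<in>\<Omega>. \<forall>H. real_polynomial_function H \<longrightarrow> exp (H y) = v y \<longrightarrow>
        (\<forall>\<^sub>F x in nhds y. exp (H x) \<le> v x) \<longrightarrow> log_plap p H y \<le> - \<Lambda>)"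

lemma isCont_norm_powr:
  assumes "p > 0"
  shows "isCont (\<lambda>q::'a::real_normed_vector. norm q powr p) q0"
  unfolding isCont_def
  using assms by (intro tendsto_powr2 tendsto_norm tendsto_ident_at tendsto_const) auto

text \<open>Unless \<open>w \<le> v\<close>, the sup-convolution \<open>U\<close> of \<open>ln w\<close> and the inf-convolution \<open>V\<close> of
  \<open>ln v\<close> touch, up to a constant, at an interior point \<open>\<xi>0\<close>. By polynomial approximation and
  the solvability of the frozen Dirichlet problem, a polynomial fits between \<open>U\<close> and \<open>V\<close> on a
  small sphere about \<open>\<xi>0\<close>; as it is a strict supersolution for \<open>U\<close> and a strict subsolution
  for \<open>V\<close>, it separates them at \<open>\<xi>0\<close> as well.\<close>

lemma elliptic_comparison:
  fixes w v :: "'a::euclidean_space \<Rightarrow> real"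
  assumes \<Omega>: "open \<Omega>" "bounded \<Omega>" and p: "p \<ge> 2" and gap: "\<mu> < \<Lambda>"
    and w: "upper_semicontinuous_on (closure \<Omega>) w" "\<And>x. x \<in> closure \<Omega> \<Longrightarrow> 0 \<le> w x"
    and v: "continuous_on (closure \<Omega>) v" "\<And>x. x \<in> closure \<Omega> \<Longrightarrow> 0 < v x"
    and sub: "\<And>y H. y \<in> \<Omega> \<Longrightarrow> v y < w y \<Longrightarrow> real_polynomial_function H \<Longrightarrow> exp (H y) = w y \<Longrightarrow>
      \<forall>\<^sub>F x in nhds y. w x \<le> exp (H x) \<Longrightarrow> - \<mu> \<le> log_plap p H y"
    and super: "log_supersolution p \<Lambda> \<Omega> v"
    and bd: "\<And>x. x \<in> frontier \<Omega> \<Longrightarrow> w x \<le> v x"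
    and xs: "xs \<in> closure \<Omega>"
  shows "w xs \<le> v xs"
proof (rule ccontr)
  assume "\<not> w xs \<le> v xs"
  then have xs': "v xs < w xs" by simp
  define K where "K = closure \<Omega>"
  have K: "compact K" using \<Omega>(2) by (simp add: K_def compact_closure)
  have \<Omega>K: "\<Omega> \<subseteq> K" by (simp add: K_def closure_subset)
  have bd': "w x \<le> v x" if "x \<in> K - \<Omega>" for x
    using that bd \<Omega>(1) by (simp add: K_def frontier_def interior_open)
  from doubling_maximum[OF K \<Omega>(1) w[folded K_def] v[folded K_def] bd' xs[folded K_def] xs']
  obtain \<alpha> x0 \<xi>0 y0 where \<alpha>: "\<alpha> > 0" and in\<Omega>: "x0 \<in> K \<inter> \<Omega>" "\<xi>0 \<in> K \<inter> \<Omega>" "y0 \<in> K \<inter> \<Omega>"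
    and vw: "v x0 < w x0"
    and max: "\<And>x \<xi> y. x \<in> K \<Longrightarrow> \<xi> \<in> K \<Longrightarrow> y \<in> K \<Longrightarrow>
      w x * gauss \<alpha> x \<xi> * (inverse (v y) * gauss \<alpha> y \<xi>)
        \<le> w x0 * gauss \<alpha> x0 \<xi>0 * (inverse (v y0) * gauss \<alpha> y0 \<xi>0)"
    by metis
  define M where "M = w x0 * gauss \<alpha> x0 \<xi>0 * (inverse (v y0) * gauss \<alpha> y0 \<xi>0)"
  have v0: "0 < v x" if "x \<in> K" for x using v(2) that by (simp add: K_def)
  have wx0: "0 < w x0" using v0[of x0] in\<Omega> vw by simp
  have vy0: "0 < v y0" using v0 in\<Omega> by blast
  have M: "M > 0" using wx0 vy0 by (simp add: M_def)
  have mid: "x + y = 2 *\<^sub>R \<xi>0"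
    if x: "x \<in> K" and y: "y \<in> K" and eq: "w x * gauss \<alpha> x \<xi>0 * (inverse (v y) * gauss \<alpha> y \<xi>0) = M" for x y
  proof (rule gauss_midpoint[OF \<alpha> \<Omega>(1)])
    show "\<xi>0 \<in> \<Omega>" using in\<Omega> by blast
    fix \<xi> assume "\<xi> \<in> \<Omega>"
    then have "w x * gauss \<alpha> x \<xi> * (inverse (v y) * gauss \<alpha> y \<xi>)
        \<le> w x * gauss \<alpha> x \<xi>0 * (inverse (v y) * gauss \<alpha> y \<xi>0)"
      unfolding eq M_def using max x y \<Omega>K by blast
    then have "w x * inverse (v y) * (gauss \<alpha> x \<xi> * gauss \<alpha> y \<xi>)
        \<le> w x * inverse (v y) * (gauss \<alpha> x \<xi>0 * gauss \<alpha> y \<xi>0)"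
      by (simp add: mult_ac)
    moreover have "0 < w x * inverse (v y)"
    proof -
      have "0 \<le> w x" using w(2) x by (simp add: K_def)
      moreover have "w x \<noteq> 0" using eq M by auto
      ultimately show ?thesis using v0[OF y] by simp
    qed
    ultimately show "gauss \<alpha> x \<xi> * gauss \<alpha> y \<xi> \<le> gauss \<alpha> x \<xi>0 * gauss \<alpha> y \<xi>0"
      by (rule mult_left_le_imp_le)
  qed
  have mid0: "x0 + y0 = 2 *\<^sub>R \<xi>0" using in\<Omega> by (intro mid) (auto simp: M_def)
  \<comment> \<open>Exchanging x0 for another maximiser keeps the overall value M, so x and y0 again
    have midpoint \<xi>0. Uniqueness of both maximisers is the form in which differentiability at
    \<xi>0 is used.\<close>
  have uniqx: "x = x0" if "gauss_argmax \<alpha> K w \<xi>0 x" for x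
  proof -
    have x: "x \<in> K" and ge: "w x0 * gauss \<alpha> x0 \<xi>0 \<le> w x * gauss \<alpha> x \<xi>0"
      using that in\<Omega> by (auto simp: gauss_argmax_def)
    have "M \<le> w x * gauss \<alpha> x \<xi>0 * (inverse (v y0) * gauss \<alpha> y0 \<xi>0)"
      unfolding M_def using ge vy0 by (intro mult_right_mono) (auto intro: less_imp_le)
    moreover have "w x * gauss \<alpha> x \<xi>0 * (inverse (v y0) * gauss \<alpha> y0 \<xi>0) \<le> M"
      unfolding M_def using max x in\<Omega> by blast
    ultimately have "x + y0 = 2 *\<^sub>R \<xi>0" using x in\<Omega> by (intro mid) auto
    then show ?thesis using mid0 by (metis add_right_cancel)
  qed
  have uniqy: "y = y0" if "gauss_argmax \<alpha> K (\<lambda>x. inverse (v x)) \<xi>0 y" for y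
  proof -
    have y: "y \<in> K" and ge: "inverse (v y0) * gauss \<alpha> y0 \<xi>0 \<le> inverse (v y) * gauss \<alpha> y \<xi>0"
      using that in\<Omega> by (auto simp: gauss_argmax_def)
    have "M \<le> w x0 * gauss \<alpha> x0 \<xi>0 * (inverse (v y) * gauss \<alpha> y \<xi>0)"
      unfolding M_def using ge wx0 by (intro mult_left_mono) (auto intro: less_imp_le)
    moreover have "w x0 * gauss \<alpha> x0 \<xi>0 * (inverse (v y) * gauss \<alpha> y \<xi>0) \<le> M"
      unfolding M_def using max y in\<Omega> by blast
    ultimately have "x0 + y = 2 *\<^sub>R \<xi>0" using y in\<Omega> by (intro mid) auto
    then show ?thesis using mid0 by (metis add_left_cancel)
  qed
  define q0 where "q0 = (2 * \<alpha>) *\<^sub>R (x0 - \<xi>0)"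
  \<comment> \<open>\<open>q0\<close> belongs to the sup-convolution of ln w, - \<open>q0\<close> to
    that of - ln v; they are opposite by the midpoint relation.\<close>
  have q0y: "- q0 = (2 * \<alpha>) *\<^sub>R (y0 - \<xi>0)"
  proof -
    have "y0 - \<xi>0 = - (x0 - \<xi>0)" using mid0 by (simp add: algebra_simps scaleR_2)
    then show ?thesis unfolding q0_def by (simp only: scaleR_minus_right)
  qed
  define \<gamma> where "\<gamma> = \<Lambda> - \<mu>"
  \<comment> \<open>The polynomial \<open>H1\<close> will need 3 \<kappa> and \<open>H2\<close> will
    need 2 \<kappa>, each from half of the gap \<gamma>; a sixteenth leaves room.\<close>
  define \<kappa> where "\<kappa> = \<gamma> / 16"
  have \<gamma>: "\<gamma> > 0" "\<kappa> > 0" using gap by (simp_all add: \<gamma>_def \<kappa>_def)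
  have "2 * \<alpha> \<ge> 0" using \<alpha> by simp
  from frozen_coefficients[OF p this \<gamma>(2), of q0]
  obtain \<omega> \<eta> where \<omega>: "\<omega> > 0" and \<eta>: "\<eta> > 0" and froz: "\<forall>q X. dist q q0 < \<eta> \<longrightarrow>
      (\<forall>h. 0 \<le> (\<Sum>i\<in>Basis. \<Sum>j\<in>Basis. (h \<bullet> i) * (h \<bullet> j) * X i j) + 2 * \<alpha> * (norm h)\<^sup>2) \<longrightarrow>
      (\<Sum>i\<in>Basis. \<Sum>j\<in>Basis. plap_coeff p q i j * X i j)
        \<le> (\<Sum>i\<in>Basis. \<Sum>j\<in>Basis. shift_coeff \<omega> (plap_coeff p q0) i j * X i j) + \<kappa>"
    by (elim exE conjE)
  have frozen: "(\<Sum>i\<in>Basis. \<Sum>j\<in>Basis. plap_coeff p q i j * X i j)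
        \<le> (\<Sum>i\<in>Basis. \<Sum>j\<in>Basis. shift_coeff \<omega> (plap_coeff p q0) i j * X i j) + \<kappa>"
    if "dist q q0 < \<eta>"
      "\<And>h. 0 \<le> (\<Sum>i\<in>Basis. \<Sum>j\<in>Basis. (h \<bullet> i) * (h \<bullet> j) * X i j) + 2 * \<alpha> * (norm h)\<^sup>2" for q X
    by (rule froz[THEN spec, THEN spec, THEN mp, THEN mp]) (use that in simp_all)
  define A where "A = shift_coeff \<omega> (plap_coeff p q0)"
  define N where "N = (p - 1) * norm q0 powr p"
  have contN: "isCont (\<lambda>q::'a. (p - 1) * norm q powr p) q" for q
    using p by (intro continuous_intros isCont_norm_powr) auto
  \<comment> \<open>Near x0, w > c implies w > v, the region in which the subsolution inequality is
    given.\<close>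
  obtain c where c: "v x0 < c" "c < w x0" using vw dense by blast
  have contv: "isCont v x" if "x \<in> \<Omega>" for x
    using continuous_on_subset[OF v(1) closure_subset] that \<Omega>(1)
    by (simp add: continuous_on_eq_continuous_at)
  have near\<Omega>: "\<forall>\<^sub>F x in nhds y. x \<in> \<Omega>" if "y \<in> \<Omega>" for y
    using that \<Omega>(1) by (intro eventually_nhds_in_open)
  have x0y0: "x0 \<in> \<Omega>" "y0 \<in> \<Omega>" using in\<Omega> by auto
  have "\<forall>\<^sub>F x in nhds x0. v x < c"
    using contv[of x0] in\<Omega> c(1)
    by (intro order_tendstoD(2)[where y = "v x0"]) (auto simp: isCont_def tendsto_nhds_iff)
  then have subx: "\<forall>\<^sub>F x1 in nhds x0. c < w x1 \<longrightarrow> (\<forall>H. real_polynomial_function H \<longrightarrow> exp (H x1) = w x1 \<longrightarrow>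
        (\<forall>\<^sub>F x in nhds x1. w x \<le> exp (H x)) \<longrightarrow>
        - \<mu> - (p - 1) * norm (gradient H x1) powr p \<le> lin_op (plap_coeff p (gradient H x1)) H x1)"
    using near\<Omega>[OF x0y0(1)]
  proof eventually_elim
    case (elim x1)
    show ?case
    proof (intro impI allI)
      fix H assume "c < w x1" "real_polynomial_function H" "exp (H x1) = w x1"
        "\<forall>\<^sub>F x in nhds x1. w x \<le> exp (H x)"
      with elim sub[of x1 H] 
      show "- \<mu> - (p - 1) * norm (gradient H x1) powr p \<le> lin_op (plap_coeff p (gradient H x1)) H x1"
        by (simp add: log_plap_def)
    qed
  qed
  \<comment> \<open>The same lemma is applied to 1 / v with threshold 0: a polynomial H testing - ln
    v from above gives - H testing ln v from below, and changing the sign of the gradient leaves the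
    coefficients as they are.\<close>
  have suby: "\<forall>\<^sub>F x1 in nhds y0. 0 < inverse (v x1) \<longrightarrow> (\<forall>H. real_polynomial_function H \<longrightarrow> exp (H x1) = inverse (v x1) \<longrightarrow>
        (\<forall>\<^sub>F x in nhds x1. inverse (v x) \<le> exp (H x)) \<longrightarrow>
        \<Lambda> + (p - 1) * norm (gradient H x1) powr p \<le> lin_op (plap_coeff p (gradient H x1)) H x1)"
    using near\<Omega>[OF x0y0(2)]
  proof eventually_elim
    case (elim x1)
    show ?case
    proof (intro impI allI)
      fix H assume H: "real_polynomial_function H" "exp (H x1) = inverse (v x1)"
        "\<forall>\<^sub>F x in nhds x1. inverse (v x) \<le> exp (H x)"
      have "\<forall>\<^sub>F x in nhds x1. exp (- H x) \<le> v x"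
        using H(3) near\<Omega>[OF elim]
      proof eventually_elim
        case (elim x)
        then have "0 < v x" using v0 \<Omega>K by blast
        then show ?case using elim(1) by (simp add: exp_minus field_simps)
      qed
      then have "log_plap p (\<lambda>x. - H x) x1 \<le> - \<Lambda>"
        using super elim H real_polynomial_function_minus[OF H(1)]
        by (simp add: log_supersolution_def exp_minus)
      then show "\<Lambda> + (p - 1) * norm (gradient H x1) powr p \<le> lin_op (plap_coeff p (gradient H x1)) H x1"
        using H(1) by (simp add: log_plap_def gradient_minus real_polynomial_differentiable lin_op_minus)
    qed
  qed
  have contB: "isCont (\<lambda>q::'a. - \<mu> - (p - 1) * norm q powr p) q0"
      "isCont (\<lambda>q::'a. \<Lambda> + (p - 1) * norm q powr p) (- q0)"
    by (intro continuous_intros contN)+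
  from sup_convolution_le_polynomial[where B = "\<lambda>q. - \<mu> - (p - 1) * norm q powr p",
      OF K w[folded K_def] \<Omega>(1) \<Omega>K x0y0(1) \<alpha> uniqx q0_def contB(1) \<gamma>(2) \<eta> subx c(2) frozen[folded A_def]]
  obtain r1 where r1: "r1 > 0" "\<forall>r H. 0 < r \<longrightarrow> r \<le> r1 \<longrightarrow> real_polynomial_function H \<longrightarrow>
      (\<forall>\<xi>\<in>ball \<xi>0 r. lin_op A H \<xi> \<le> - \<mu> - N - 2 * \<kappa>) \<longrightarrow>
      (\<forall>\<xi>\<in>sphere \<xi>0 r. \<forall>x\<in>K. w x * gauss \<alpha> x \<xi> \<le> exp (H \<xi>)) \<longrightarrow>
      (\<forall>x\<in>K. w x * gauss \<alpha> x \<xi>0 \<le> exp (H \<xi>0))"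
    unfolding N_def by auto
  have Ule: "w x * gauss \<alpha> x \<xi>0 \<le> exp (H \<xi>0)"
    if "0 < r" "r \<le> r1" "real_polynomial_function H"
      "\<forall>\<xi>\<in>ball \<xi>0 r. lin_op A H \<xi> \<le> - \<mu> - N - 2 * \<kappa>"
      "\<forall>\<xi>\<in>sphere \<xi>0 r. \<forall>x\<in>K. w x * gauss \<alpha> x \<xi> \<le> exp (H \<xi>)" "x \<in> K" for r H x
    using r1(2) that by blast
  have contiv: "continuous_on K (\<lambda>x. inverse (v x))"
    using v[folded K_def] by (intro continuous_intros) (auto simp: less_imp_neq[symmetric])
  have frozen': "(\<Sum>i\<in>Basis. \<Sum>j\<in>Basis. plap_coeff p q i j * X i j)
        \<le> (\<Sum>i\<in>Basis. \<Sum>j\<in>Basis. A i j * X i j) + \<kappa>"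
    if "dist q (- q0) < \<eta>"
      "\<And>h. 0 \<le> (\<Sum>i\<in>Basis. \<Sum>j\<in>Basis. (h \<bullet> i) * (h \<bullet> j) * X i j) + 2 * \<alpha> * (norm h)\<^sup>2" for q X
  proof -
    have "dist (- q) q0 < \<eta>" using that(1) by (simp add: dist_norm norm_minus_commute add.commute)
    from frozen[OF this that(2)] show ?thesis by (simp add: A_def)
  qed
  have inv0: "0 \<le> inverse (v x)" if "x \<in> K" for x using v0[OF that] by simp
  have invy0: "0 < inverse (v y0)" using vy0 by simp
  from sup_convolution_le_polynomial[where B = "\<lambda>q. \<Lambda> + (p - 1) * norm q powr p",
      OF K continuous_on_imp_upper_semicontinuous_on[OF contiv] inv0 \<Omega>(1) \<Omega>K x0y0(2) \<alpha>
        uniqy q0y contB(2) \<gamma>(2) \<eta> suby invy0 frozen']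
  obtain r2 where r2: "r2 > 0" "\<forall>r H. 0 < r \<longrightarrow> r \<le> r2 \<longrightarrow> real_polynomial_function H \<longrightarrow>
      (\<forall>\<xi>\<in>ball \<xi>0 r. lin_op A H \<xi> \<le> \<Lambda> + N - 2 * \<kappa>) \<longrightarrow>
      (\<forall>\<xi>\<in>sphere \<xi>0 r. \<forall>x\<in>K. inverse (v x) * gauss \<alpha> x \<xi> \<le> exp (H \<xi>)) \<longrightarrow>
      (\<forall>x\<in>K. inverse (v x) * gauss \<alpha> x \<xi>0 \<le> exp (H \<xi>0))"
    unfolding N_def by auto
  have Vle: "inverse (v x) * gauss \<alpha> x \<xi>0 \<le> exp (H \<xi>0)"
    if "0 < r" "r \<le> r2" "real_polynomial_function H"
      "\<forall>\<xi>\<in>ball \<xi>0 r. lin_op A H \<xi> \<le> \<Lambda> + N - 2 * \<kappa>"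
      "\<forall>\<xi>\<in>sphere \<xi>0 r. \<forall>x\<in>K. inverse (v x) * gauss \<alpha> x \<xi> \<le> exp (H \<xi>)" "x \<in> K" for r H x
    using r2(2) that by blast
  obtain r3 where r3: "r3 > 0" "cball \<xi>0 r3 \<subseteq> \<Omega>"
    using \<Omega>(1) in\<Omega>(2) open_contains_cball by blast
  define r where "r = min r1 (min r2 r3)"
  have r: "r > 0" "r \<le> r1" "r \<le> r2" "sphere \<xi>0 r \<subseteq> K"
    using r1(1) r2(1) r3 \<Omega>K by (auto simp: r_def subset_iff)
  have trA: "0 < (\<Sum>i\<in>Basis. A i i)" unfolding A_def by (rule trace_shift_plap_coeff_pos[OF p \<omega>])
  have ellA: "elliptic A" unfolding A_def using \<omega> by (intro elliptic_shift_coeff elliptic_plap_coeff p) auto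
  have "continuous_on (K \<times> sphere \<xi>0 r) (\<lambda>z. inverse (v (fst z)) * gauss \<alpha> (fst z) (snd z))"
    by (intro continuous_intros continuous_on_compose2[OF contiv continuous_on_fst[OF continuous_on_id]]) auto
  from compact_sup_continuous[OF K _ compact_sphere this] in\<Omega>
  obtain S where S: "continuous_on (sphere \<xi>0 r) S"
    "\<And>\<xi>. \<xi> \<in> sphere \<xi>0 r \<Longrightarrow> \<exists>y\<in>K. S \<xi> = inverse (v y) * gauss \<alpha> y \<xi>"
    "\<And>\<xi> y. \<xi> \<in> sphere \<xi>0 r \<Longrightarrow> y \<in> K \<Longrightarrow> inverse (v y) * gauss \<alpha> y \<xi> \<le> S \<xi>"
    by (metis empty_iff fst_conv snd_conv IntD1)
  have Spos: "S \<xi> > 0" if "\<xi> \<in> sphere \<xi>0 r" for \<xi>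
    using S(2)[OF that] v0 by fastforce
  \<comment> \<open>The term b |\<xi> - \<xi>0|^2 contributes 2 b tr A = \<kappa> to the operator;
    made to vanish on the sphere, it lowers the value at the centre by b r^2.\<close>
  define b where "b = \<kappa> / (2 * (\<Sum>i\<in>Basis. A i i))"
  have b: "b > 0" using \<gamma>(2) trA by (simp add: b_def)
  \<comment> \<open>Both \<open>H1\<close> and \<open>H2\<close> are raised by \<epsilon> to
    dominate their data on the sphere; the total 2 \<epsilon> = b r^2 / 2 is less than the gain b
    r^2 at the centre.\<close>
  define \<epsilon> where "\<epsilon> = b * r\<^sup>2 / 4"
  have \<epsilon>: "\<epsilon> > 0" using b r(1) by (simp add: \<epsilon>_def)
  have "continuous_on (sphere \<xi>0 r) (\<lambda>\<xi>. ln (M / S \<xi>))"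
    using M by (intro continuous_intros S(1)) (auto dest!: Spos)
  from Stone_Weierstrass_real_polynomial_function[OF compact_sphere this \<epsilon>]
  obtain P where P: "real_polynomial_function P" "\<And>\<xi>. \<xi> \<in> sphere \<xi>0 r \<Longrightarrow> \<bar>ln (M / S \<xi>) - P \<xi>\<bar> < \<epsilon>"
    by metis
  \<comment> \<open>The midpoint between - \<Lambda> - N, which - H must exceed in the role of a
    strict subsolution for the lower function, and - \<mu> - N, below which a strict supersolution
    for the upper one lies.\<close>
  define e where "e = - N - (\<Lambda> + \<mu>) / 2"
  from polynomial_dirichlet_problem[OF ellA trA P(1) r(1)]
  obtain H where H: "real_polynomial_function H" "\<And>x. x \<in> sphere \<xi>0 r \<Longrightarrow> H x = P x" "\<And>x. lin_op A H x = e"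
    by metis
  define H1 where "H1 = (\<lambda>\<xi>. (H \<xi> + b * (norm (\<xi> - \<xi>0))\<^sup>2) + (\<epsilon> - b * r\<^sup>2))"
  define H2 where "H2 = (\<lambda>\<xi>. - H \<xi> + (\<epsilon> + ln M))"
  have polyb: "real_polynomial_function (\<lambda>\<xi>. b * (norm (\<xi> - \<xi>0))\<^sup>2)"
    by (intro real_polynomial_function.intros(2,4) real_polynomial_norm_sq)
  have poly1: "real_polynomial_function (\<lambda>\<xi>. H \<xi> + b * (norm (\<xi> - \<xi>0))\<^sup>2)"
    by (intro real_polynomial_function.intros(3) H polyb)
  have LH1: "lin_op A H1 \<xi> = e + \<kappa>" for \<xi>
    unfolding H1_def lin_op_add[OF poly1 real_polynomial_function.intros(2)]
      lin_op_add[OF H(1) polyb] lin_op_cmult[OF real_polynomial_norm_sq] lin_op_norm_sq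
    using trA by (simp add: H(3) b_def)
  have LH2: "lin_op A H2 \<xi> = - e" for \<xi>
    unfolding H2_def lin_op_add[OF real_polynomial_function_minus[OF H(1)] real_polynomial_function.intros(2)]
    by (simp add: lin_op_minus H)
  have "w x0 * gauss \<alpha> x0 \<xi>0 \<le> exp (H1 \<xi>0)"
  proof (rule Ule[OF r(1,2)])
    show "real_polynomial_function H1" unfolding H1_def by (rule real_polynomial_add_const[OF poly1])
    show "\<forall>\<xi>\<in>ball \<xi>0 r. lin_op A H1 \<xi> \<le> - \<mu> - N - 2 * \<kappa>"
      using \<gamma> by (simp add: LH1 e_def \<kappa>_def \<gamma>_def field_simps)
    show "\<forall>\<xi>\<in>sphere \<xi>0 r. \<forall>x\<in>K. w x * gauss \<alpha> x \<xi> \<le> exp (H1 \<xi>)"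
    proof (intro ballI)
      fix \<xi> x assume \<xi>: "\<xi> \<in> sphere \<xi>0 r" and x: "x \<in> K"
      obtain y where y: "y \<in> K" "S \<xi> = inverse (v y) * gauss \<alpha> y \<xi>" using S(2)[OF \<xi>] by blast
      have "w x * gauss \<alpha> x \<xi> * S \<xi> \<le> M"
        unfolding y(2) M_def using max[OF x _ y(1)] \<xi> r(4) by blast
      then have "w x * gauss \<alpha> x \<xi> \<le> M / S \<xi>" using Spos[OF \<xi>] by (simp add: pos_le_divide_eq)
      also have "\<dots> = exp (ln (M / S \<xi>))" using M Spos[OF \<xi>] by simp
      also have "\<dots> \<le> exp (H1 \<xi>)"
        using P(2)[OF \<xi>] H(2)[OF \<xi>] \<xi> by (simp add: H1_def dist_norm norm_minus_commute)
      finally show "w x * gauss \<alpha> x \<xi> \<le> exp (H1 \<xi>)" .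
    qed
    show "x0 \<in> K" using in\<Omega> by blast
  qed
  moreover have "inverse (v y0) * gauss \<alpha> y0 \<xi>0 \<le> exp (H2 \<xi>0)"
  proof (rule Vle[OF r(1,3)])
    show "real_polynomial_function H2" unfolding H2_def
      by (rule real_polynomial_add_const[OF real_polynomial_function_minus[OF H(1)]])
    show "\<forall>\<xi>\<in>ball \<xi>0 r. lin_op A H2 \<xi> \<le> \<Lambda> + N - 2 * \<kappa>"
      using \<gamma> by (simp add: LH2 e_def \<kappa>_def \<gamma>_def field_simps)
    show "\<forall>\<xi>\<in>sphere \<xi>0 r. \<forall>x\<in>K. inverse (v x) * gauss \<alpha> x \<xi> \<le> exp (H2 \<xi>)"
    proof (intro ballI)
      fix \<xi> y assume \<xi>: "\<xi> \<in> sphere \<xi>0 r" and y: "y \<in> K"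
      have "inverse (v y) * gauss \<alpha> y \<xi> \<le> S \<xi>" by (rule S(3)[OF \<xi> y])
      also have "S \<xi> = exp (ln M - ln (M / S \<xi>))" using M Spos[OF \<xi>] by (simp add: ln_div)
      also have "\<dots> \<le> exp (H2 \<xi>)"
        using P(2)[OF \<xi>] H(2)[OF \<xi>] by (simp add: H2_def)
      finally show "inverse (v y) * gauss \<alpha> y \<xi> \<le> exp (H2 \<xi>)" .
    qed
    show "y0 \<in> K" using in\<Omega> by blast
  qed
  ultimately have "M \<le> exp (H1 \<xi>0) * exp (H2 \<xi>0)"
    unfolding M_def using vy0 by (intro mult_mono) (auto intro!: mult_nonneg_nonneg less_imp_le)
  also have "\<dots> = exp (ln M + (2 * \<epsilon> - b * r\<^sup>2))"
    unfolding exp_add[symmetric] by (simp add: H1_def H2_def)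
  also have "\<dots> < exp (ln M)"
    using b r(1) by (simp add: \<epsilon>_def)
  also have "\<dots> = M" using M by simp
  finally show False by simp
qed

section \<open>Parabolic comparison\<close>

lemma continuous_on_polynomial_fst:
  fixes H :: "'a::euclidean_space \<Rightarrow> real"
  assumes "real_polynomial_function H"
  shows "continuous_on S (\<lambda>z. H (fst z))"
  by (rule continuous_on_compose2[OF real_polynomial_continuous_on[OF assms, of UNIV]
      continuous_on_fst[OF continuous_on_id]]) auto

lemma C21_on_exp:
  fixes H :: "'a::euclidean_space \<Rightarrow> real"
  assumes H: "real_polynomial_function H"
    and b: "\<And>t. (b has_real_derivative b' t) (at t)" "continuous_on UNIV b'"
  shows "C21_on S (\<lambda>z. exp (H (fst z) + b (snd z)))"
    and "deriv (\<lambda>\<tau>. exp (H x + b \<tau>)) t = b' t * exp (H x + b t)"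
proof -
  have polyH: "real_polynomial_function (\<lambda>x. H x + b t)" for t
    by (rule real_polynomial_add_const[OF H])
  have D: "((\<lambda>\<tau>. exp (H x + b \<tau>)) has_real_derivative b' t * exp (H x + b t)) (at t)" for x t
    by (auto intro!: derivative_eq_intros b)
  have deriv: "deriv (\<lambda>\<tau>. exp (H x + b \<tau>)) t = b' t * exp (H x + b t)" for x t
    by (rule DERIV_imp_deriv[OF D])
  then show "deriv (\<lambda>\<tau>. exp (H x + b \<tau>)) t = b' t * exp (H x + b t)" .
  have contb: "continuous_on UNIV b"
    using b(1) by (meson DERIV_isCont continuous_at_imp_continuous_on)
  have cb: "continuous_on S (\<lambda>z. b (snd z))" "continuous_on S (\<lambda>z. b' (snd z))"
    by (rule continuous_on_compose2[OF contb continuous_on_snd[OF continuous_on_id]]; auto)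
       (rule continuous_on_compose2[OF b(2) continuous_on_snd[OF continuous_on_id]]; auto)
  have p1: "partial i (\<lambda>x. exp (H x + b t)) = (\<lambda>x. partial i H x * exp (H x + b t))" for i t
    using partial_exp_polynomial[OF polyH] by (simp add: partial_add_const[OF H])
  have p2: "partial i (partial j (\<lambda>x. exp (H x + b t)))
      = (\<lambda>x. (partial i (partial j H) x + partial i H x * partial j H x) * exp (H x + b t))" for i j t
    using partial_partial_exp_polynomial[OF polyH] by (simp add: partial_add_const[OF H])
  have d1: "(\<lambda>x. partial i H x * exp (H x + b t)) differentiable at x" for i t x
    by (intro differentiable_mult real_polynomial_exp_differentiable[OF polyH]
        real_polynomial_differentiable real_polynomial_partial H)
  show "C21_on S (\<lambda>z. exp (H (fst z) + b (snd z)))"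
    unfolding C21_on_def case_prod_unfold fst_conv snd_conv p2 deriv unfolding p1
    using D d1
    by (auto simp: field_differentiable_def real_polynomial_exp_differentiable[OF polyH]
        intro!: continuous_intros continuous_on_polynomial_fst cb H real_polynomial_partial)
qed

lemma log_plap_add_const:
  fixes H :: "'a::euclidean_space \<Rightarrow> real"
  assumes "real_polynomial_function H"
  shows "log_plap p (\<lambda>x. H x + c) = log_plap p H"
  by (simp add: log_plap_def gradient_def lin_op_def partial_add_const[OF assms] fun_eq_iff)

text \<open>Along a sequence violating the claim the optimal times subconverge to some t in I;
  semicontinuity of F at (x, t) keeps the limit value below F (x, t), hence below the maximum at
  x.\<close>

lemma upper_semicontinuous_on_marginal_max:
  fixes F :: "'a::metric_space \<times> 'b::metric_space \<Rightarrow> real"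
  assumes F: "upper_semicontinuous_on (K \<times> I) F" and I: "compact I"
    and \<tau>: "\<And>x. x \<in> K \<Longrightarrow> \<tau> x \<in> I" "\<And>x t. x \<in> K \<Longrightarrow> t \<in> I \<Longrightarrow> F (x, t) \<le> F (x, \<tau> x)"
  shows "upper_semicontinuous_on K (\<lambda>x. F (x, \<tau> x))"
  unfolding upper_semicontinuous_on_def
proof (intro ballI allI impI, rule ccontr)
  fix x c assume x: "x \<in> K" and c: "F (x, \<tau> x) < c"
    and "\<not> (\<forall>\<^sub>F z in at x within K. F (z, \<tau> z) < c)"
  then have "\<forall>n::nat. \<exists>z\<in>K. dist z x \<le> inverse (real (Suc n)) \<and> c \<le> F (z, \<tau> z)"
    unfolding eventually_at by (metis inverse_positive_iff_positive less_imp_le not_le of_nat_0_less_iff zero_less_Suc)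
  then obtain Z where Z: "\<And>n::nat. Z n \<in> K" "\<And>n. dist (Z n) x \<le> inverse (real (Suc n))" "\<And>n. c \<le> F (Z n, \<tau> (Z n))"
    by metis
  have "Z \<longlonglongrightarrow> x"
    unfolding tendsto_dist_iff[of Z]
    by (rule Lim_null_comparison[OF _ LIMSEQ_inverse_real_of_nat]) (use Z(2) in auto)
  moreover obtain t s where s: "t \<in> I" "strict_mono s" "((\<lambda>n. \<tau> (Z n)) \<circ> s) \<longlonglongrightarrow> t"
    using I \<tau>(1) Z(1) unfolding compact_def by metis
  ultimately have lim: "(\<lambda>n. (Z (s n), \<tau> (Z (s n)))) \<longlonglongrightarrow> (x, t)"
    using LIMSEQ_subseq_LIMSEQ[of Z x s] by (intro tendsto_Pair) (auto simp: o_def)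
  have "c \<le> F (x, t)"
    by (rule upper_semicontinuous_on_seq_bound[OF F _ lim _ _ tendsto_const])
       (use Z \<tau>(1) x s(1) in auto)
  also have "\<dots> \<le> F (x, \<tau> x)" using \<tau>(2) x s(1) by blast
  finally show False using c by simp
qed

text \<open>The maximum over \<open>t\<close> of \<open>u (x, t) exp (- b t)\<close>, with \<open>b' \<ge> - m\<close>, is a subsolution of an
  elliptic equation. The summand \<open>\<sigma> exp (k / \<sigma> (t - t1))\<close> of \<open>b\<close> is small at \<open>t1\<close> but keeps the
  maximum away from \<open>t1 + 1\<close>.\<close>

lemma parabolic_comparison:
  fixes u :: "'a::euclidean_space \<times> real \<Rightarrow> real"
  assumes \<Omega>: "open \<Omega>" "bounded \<Omega>" and p: "p \<ge> 2" and gap: "(p - 1) * m < \<Lambda>"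
    and u: "upper_semicontinuous_on (closure \<Omega> \<times> {0..}) u"
      "\<forall>z\<in>closure \<Omega> \<times> {0..}. 0 \<le> u z"
      "viscosity_subsolution p \<Omega> u"
    and v: "continuous_on (closure \<Omega>) v" "\<forall>x\<in>closure \<Omega>. 0 < v x"
    and super: "log_supersolution p \<Lambda> \<Omega> v"
    and t: "0 \<le> t0" "t0 \<le> t1" and C: "C > 0"
    and init: "\<And>x. x \<in> closure \<Omega> \<Longrightarrow> u (x, t0) \<le> C * v x * exp (- m * t0)"
    and lateral: "\<And>x t. x \<in> frontier \<Omega> \<Longrightarrow> t0 \<le> t \<Longrightarrow> t \<le> t1 + 1 \<Longrightarrow> u (x, t) \<le> C * v x * exp (- m * t)"
    and xs: "xs \<in> closure \<Omega>"
  shows "u (xs, t1) \<le> C * v xs * exp (- m * t1)"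
proof -
  define I where "I = {t0..t1 + 1}"
  define K where "K = closure \<Omega>"
  have K: "compact K" "K \<noteq> {}" using \<Omega>(2) xs by (auto simp: K_def compact_closure)
  have I: "compact I" "I \<noteq> {}" using t by (auto simp: I_def)
  have uK: "upper_semicontinuous_on (K \<times> I) u"
    using t by (intro upper_semicontinuous_on_subset[OF u(1)]) (auto simp: K_def I_def)
  have u0: "0 \<le> u (x, t)" if "x \<in> K" "t \<in> I" for x t
    using that t u(2) by (simp add: K_def I_def)
  obtain z where z: "z \<in> K \<times> I" "\<forall>y\<in>K \<times> I. u y \<le> u z"
    using upper_semicontinuous_on_attains_sup[OF compact_Times[OF K(1) I(1)] _ uK] K(2) I(2) by blast
  define U where "U = u z"
  have U: "0 \<le> U" "\<And>x t. x \<in> K \<Longrightarrow> t \<in> I \<Longrightarrow> u (x, t) \<le> U"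
    using z u0 by (auto simp: U_def)
  obtain xm where xm: "xm \<in> K" "\<forall>x\<in>K. v xm \<le> v x"
    using continuous_attains_inf[OF K v(1)[folded K_def]] by auto
  have vm: "0 < v xm" using v(2) xm(1) by (simp add: K_def)
  \<comment> \<open>k is the ratio of the bound U to the smallest value of C v exp (- m t) at t = t1
    + 1. There the penalty factor exp (\<sigma> exp (k / \<sigma>)) is at least k, by exp s \<ge> 1
    + s used twice.\<close>
  define k where "k = U / (C * v xm * exp (- m * (t1 + 1)))"
  have k: "0 \<le> k" using U(1) C vm by (simp add: k_def)
  have "u (xs, t1) \<le> C * v xs * exp (- m * t1) * exp \<sigma>" if \<sigma>: "\<sigma> > 0" for \<sigma>
  proof -
    define b where "b = (\<lambda>t. ln C - m * t + \<sigma> * exp (k / \<sigma> * (t - t1)))"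
    define b' where "b' = (\<lambda>t. - m + k * exp (k / \<sigma> * (t - t1)))"
    have b: "(b has_real_derivative b' t) (at t)" for t
      unfolding b_def b'_def using \<sigma> by (auto intro!: derivative_eq_intros)
    have contb': "continuous_on UNIV b'" unfolding b'_def by (intro continuous_intros)
    have contb: "continuous_on S b" for S unfolding b_def by (intro continuous_intros)
    have b'_ge: "- m \<le> b' t" for t using k by (simp add: b'_def)
    have expb: "C * exp (- m * t) \<le> exp (b t)" for t
    proof -
      have "C * exp (- m * t) = exp (ln C - m * t)" using C by (simp add: exp_add exp_diff exp_minus field_simps)
      also have "\<dots> \<le> exp (b t)" using \<sigma> by (simp add: b_def)
      finally show ?thesis .
    qed
    have below: "u (x, t) * exp (- b t) \<le> v x" if "u (x, t) \<le> C * v x * exp (- m * t)" "x \<in> K" for x t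
    proof -
      have "u (x, t) \<le> v x * (C * exp (- m * t))" using that(1) by (simp add: mult_ac)
      also have "\<dots> \<le> v x * exp (b t)"
        using expb v(2) that(2) by (intro mult_left_mono) (auto simp: K_def less_imp_le)
      finally show ?thesis by (simp add: exp_minus field_simps)
    qed
    have top: "u (x, t1 + 1) * exp (- b (t1 + 1)) \<le> v x" if x: "x \<in> K" for x
    proof -
      have "k \<le> \<sigma> * exp (k / \<sigma>)"
      proof -
        have "k / \<sigma> \<le> exp (k / \<sigma>)" using exp_ge_add_one_self[of "k / \<sigma>"] by linarith
        then show ?thesis using \<sigma> by (simp add: field_simps)
      qed
      then have "k \<le> exp (\<sigma> * exp (k / \<sigma>))"
        using exp_ge_add_one_self[of "\<sigma> * exp (k / \<sigma>)"] by linarith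
      then have "C * v xm * exp (- m * (t1 + 1)) * k \<le> C * v xm * exp (- m * (t1 + 1)) * exp (\<sigma> * exp (k / \<sigma>))"
        using C vm by (intro mult_left_mono) auto
      then have "U \<le> C * v xm * exp (- m * (t1 + 1)) * exp (\<sigma> * exp (k / \<sigma>))"
        using C vm by (simp add: k_def)
      also have "\<dots> = v xm * exp (b (t1 + 1))"
        using C by (simp add: b_def exp_add exp_diff exp_minus field_simps)
      also have "\<dots> \<le> v x * exp (b (t1 + 1))" using xm(2) x by simp
      finally have "u (x, t1 + 1) \<le> v x * exp (b (t1 + 1))"
        using U(2)[OF x, of "t1 + 1"] t by (simp add: I_def)
      then show ?thesis by (simp add: exp_minus field_simps)
    qed
    define F where "F z = u z * exp (- b (snd z))" for z
    have F: "upper_semicontinuous_on (K \<times> I) F"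
      unfolding F_def
    proof (rule upper_semicontinuous_on_mult[OF uK])
      show "continuous_on (K \<times> I) (\<lambda>z. exp (- b (snd z)))"
        by (intro continuous_intros continuous_on_compose2[OF contb[of UNIV] continuous_on_snd[OF continuous_on_id]]) auto
    qed (use u0 in auto)
    have "\<exists>s\<in>I. \<forall>t\<in>I. F (x, t) \<le> F (x, s)" if "x \<in> K" for x
      using that
      by (intro upper_semicontinuous_on_attains_sup[OF I] upper_semicontinuous_on_compose[OF F])
         (auto intro!: continuous_intros)
    then obtain \<tau> where \<tau>: "\<And>x. x \<in> K \<Longrightarrow> \<tau> x \<in> I" "\<And>x t. x \<in> K \<Longrightarrow> t \<in> I \<Longrightarrow> F (x, t) \<le> F (x, \<tau> x)"
      by metis
    define w where "w x = F (x, \<tau> x)" for x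
    have usc: "upper_semicontinuous_on K w"
      unfolding w_def by (rule upper_semicontinuous_on_marginal_max[OF F I(1) \<tau>])
    have "w xs \<le> v xs"
    proof (rule elliptic_comparison[OF \<Omega> p gap usc[unfolded K_def] _ v(1) v(2)[rule_format] _ super _ xs])
      show "0 \<le> w x" if "x \<in> closure \<Omega>" for x
        using that u0[of x "\<tau> x"] \<tau>(1)[of x] by (simp add: w_def F_def K_def)
      show "w x \<le> v x" if "x \<in> frontier \<Omega>" for x
      proof -
        have "x \<in> K" using that by (simp add: K_def frontier_def)
        then show ?thesis
          using \<tau>(1)[of x] lateral[OF that, of "\<tau> x"] below[of x "\<tau> x"] by (simp add: w_def F_def I_def)
      qed
      fix y H
      assume y: "y \<in> \<Omega>" and vw: "v y < w y" and H: "real_polynomial_function H" "exp (H y) = w y"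
        and ev: "\<forall>\<^sub>F x in nhds y. w x \<le> exp (H x)"
      define s where "s = \<tau> y"
      have yK: "y \<in> K" using y closure_subset by (auto simp: K_def)
      have sI: "s \<in> I" using \<tau>(1)[OF yK] by (simp add: s_def)
      have ws: "w y = u (y, s) * exp (- b s)" by (simp add: w_def F_def s_def)
      \<comment> \<open>Where w exceeds v, the optimal time is neither endpoint: the initial bound
        excludes t0 and the penalty excludes t1 + 1. Hence s is interior and the viscosity
        inequality is available at (y, s).\<close>
      have "s \<noteq> t0" using below[OF init yK] yK vw ws by (auto simp: K_def)
      moreover have "s \<noteq> t1 + 1" using top[OF yK] vw ws by auto
      ultimately have s: "t0 < s" "s < t1 + 1" "0 < s" using sI t by (auto simp: I_def)
      define \<psi> where "\<psi> = (\<lambda>z. exp (H (fst z) + b (snd z)))"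
      have eq: "u (y, s) = exp (H y + b s)"
        using H(2) ws by (simp add: exp_add exp_minus field_simps)
      have "\<forall>\<^sub>F z in nhds y \<times>\<^sub>F nhds s. (fst z \<in> \<Omega> \<and> w (fst z) \<le> exp (H (fst z))) \<and> snd z \<in> {t0<..<t1 + 1}"
        using eventually_conj[OF eventually_nhds_in_open[OF \<Omega>(1) y] ev]
          eventually_nhds_in_open[of "{t0<..<t1 + 1}" s] s
        by (intro eventually_prodI) auto
      then have "\<forall>\<^sub>F z in nhds (y, s). u z - \<psi> z \<le> u (y, s) - \<psi> (y, s)"
        unfolding nhds_prod
      proof eventually_elim
        case (elim z)
        obtain x t where xt: "z = (x, t)" by fastforce
        have x: "x \<in> K" "w x \<le> exp (H x)" and t: "t \<in> I"
          using elim closure_subset by (auto simp: xt K_def I_def)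
        have "u (x, t) * exp (- b t) \<le> exp (H x)"
          using \<tau>(2)[OF x(1) t] x(2) by (simp add: w_def F_def)
        then show ?case
          by (simp add: xt \<psi>_def eq) (simp add: exp_add exp_minus field_simps)
      qed
      then have "local_max_at (\<lambda>z. u z - \<psi> z) (y, s)" by (simp add: local_max_at_def)
      moreover have "(y, s) \<in> space_time \<Omega>" using y s(3) by (simp add: space_time_def)
      moreover have "C21_on (space_time \<Omega>) \<psi>"
        unfolding \<psi>_def by (rule C21_on_exp[OF H(1) b contb'])
      ultimately have visc: "p_laplacian p (\<lambda>x. \<psi> (x, s)) y
          - (p - 1) * (if p = 2 then 1 else u (y, s) powr (p - 2)) * deriv (\<lambda>\<tau>. \<psi> (y, \<tau>)) s \<ge> 0"
        using u(3) unfolding viscosity_subsolution_def by blast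
      define L where "L = H y + b s"
      have "p_laplacian p (\<lambda>x. \<psi> (x, s)) y = exp ((p - 1) * L) * log_plap p H y"
        using p_laplacian_exp[OF real_polynomial_add_const[OF H(1), of "b s"] p, of y]
        by (simp add: \<psi>_def log_plap_add_const[OF H(1)] L_def)
      moreover have "(if p = 2 then 1 else u (y, s) powr (p - 2)) = exp ((p - 2) * L)"
        by (simp add: eq L_def powr_def)
      moreover have "deriv (\<lambda>\<tau>. \<psi> (y, \<tau>)) s = b' s * exp L"
        using C21_on_exp(2)[OF H(1) b contb'] by (simp add: \<psi>_def L_def)
      ultimately have "0 \<le> exp ((p - 1) * L) * log_plap p H y - (p - 1) * exp ((p - 2) * L) * (b' s * exp L)"
        using visc by simp
      \<comment> \<open>Since u equals the test function exp L at the contact point, both terms are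
        homogeneous of degree p - 1 in exp L, and this positive factor cancels.\<close>
      moreover have "(p - 1) * exp ((p - 2) * L) * (b' s * exp L) = exp ((p - 1) * L) * ((p - 1) * b' s)"
      proof -
        have "exp ((p - 2) * L) * exp L = exp ((p - 1) * L)"
          unfolding exp_add[symmetric] by (simp add: algebra_simps)
        then show ?thesis by (metis (no_types, lifting) mult.assoc mult.commute)
      qed
      ultimately have "0 \<le> exp ((p - 1) * L) * (log_plap p H y - (p - 1) * b' s)"
        by (simp only: right_diff_distrib)
      then have "(p - 1) * b' s \<le> log_plap p H y" by (simp add: zero_le_mult_iff)
      moreover have "(p - 1) * (- m) \<le> (p - 1) * b' s" using b'_ge p by (intro mult_left_mono) auto
      ultimately show "- ((p - 1) * m) \<le> log_plap p H y" by simp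
    qed
    moreover have "F (xs, t1) \<le> w xs"
      unfolding w_def using xs t by (intro \<tau>(2)) (auto simp: K_def I_def)
    ultimately have "F (xs, t1) \<le> v xs" by simp
    then have "u (xs, t1) \<le> v xs * exp (b t1)"
      by (simp add: F_def exp_minus field_simps)
    also have "\<dots> = C * v xs * exp (- m * t1) * exp \<sigma>"
      using C by (simp add: b_def exp_add exp_diff exp_minus field_simps)
    finally show ?thesis .
  qed
  then have ev: "\<forall>\<^sub>F \<sigma> in at_right 0. u (xs, t1) \<le> C * v xs * exp (- m * t1) * exp \<sigma>"
    by (simp add: eventually_at_filter)
  have "((\<lambda>\<sigma>. C * v xs * exp (- m * t1) * exp \<sigma>) \<longlongrightarrow> C * v xs * exp (- m * t1) * exp 0) (at_right 0)"
    by (intro tendsto_intros)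
  then show ?thesis
    using tendsto_lowerbound[OF _ ev] by simp
qed

section \<open>Barriers and growth rates\<close>

text \<open>With \<open>a\<close> outside \<open>\<Omega>\<close> the gradient of \<open>- c |x - a|\<^sup>2\<close> does not vanish on \<open>\<Omega>\<close>, and for small
  \<open>c\<close> the term \<open>(p - 1) |DH|\<^sup>p\<close> is dominated by the negative Hessian.\<close>

lemma barrier_exists:
  fixes \<Omega> :: "'a::euclidean_space set"
  assumes \<Omega>: "bounded \<Omega>" and p: "p \<ge> 2"
  shows "\<exists>H. \<exists>\<Lambda>>0. real_polynomial_function H \<and> log_supersolution p \<Lambda> \<Omega> (\<lambda>x. exp (H x))"
proof -
  obtain \<rho> where \<rho>: "\<rho> > 0" "\<And>x. x \<in> \<Omega> \<Longrightarrow> norm x \<le> \<rho>"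
    using \<Omega> bounded_pos by blast
  obtain e :: 'a where e: "e \<in> Basis" by (rule nonempty_Basis[THEN ex_in_conv[THEN iffD2], THEN exE])
  \<comment> \<open>This point has distance between 1 and R from every point of \<Omega>.\<close>
  define a where "a = (\<rho> + 1) *\<^sub>R e"
  define R where "R = 2 * \<rho> + 1"
  have na: "norm a = \<rho> + 1" using e \<rho>(1) by (simp add: a_def)
  have dR: "1 \<le> norm (x - a)" "norm (x - a) \<le> R" if "x \<in> \<Omega>" for x
    using \<rho>(2)[OF that] na norm_triangle_ineq4[of x a] norm_triangle_ineq2[of a x]
    by (auto simp: R_def norm_minus_commute)
  have R1: "R \<ge> 1" using \<rho>(1) by (simp add: R_def)
  \<comment> \<open>The solution of (p - 1) (2 c R)^2 = c: as |DH| is at most 2 c R on \<Omega>, the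
    gradient term uses up at most half of the Hessian contribution, which is at least 2 c |DH|^(p-2)
    in absolute value.\<close>
  define c where "c = 1 / (4 * (p - 1) * R\<^sup>2)"
  have c: "c > 0" using p R1 by (simp add: c_def)
  define H where "H = (\<lambda>x. - c * (norm (x - a))\<^sup>2)"
  \<comment> \<open>A lower bound for the remaining half c |DH|^(p-2), as |DH| is at least 2 c on
    \<Omega>.\<close>
  define \<Lambda> where "\<Lambda> = c * (2 * c) powr (p - 2)"
  have polyH: "real_polynomial_function H"
    unfolding H_def by (intro real_polynomial_function.intros(2,4) real_polynomial_norm_sq)
  have grad: "gradient H x = (- 2 * c) *\<^sub>R (x - a)" for x
  proof (rule euclidean_eqI)
    fix i :: 'a assume i: "i \<in> Basis"
    have "partial i H x = - c * (2 * ((x - a) \<bullet> i))"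
      unfolding H_def
      using partial_cmult[OF real_polynomial_differentiable[OF real_polynomial_norm_sq[of a]], of i "- c"]
      by (simp add: partial_norm_sq)
    then show "gradient H x \<bullet> i = ((- 2 * c) *\<^sub>R (x - a)) \<bullet> i"
      by (simp add: gradient_inner[OF i])
  qed
  have logH: "log_plap p H y \<le> - \<Lambda>" if y: "y \<in> \<Omega>" for y
  proof -
    define q where "q = gradient H y"
    have nq: "norm q = 2 * c * norm (y - a)" using c by (simp add: q_def grad)
    have "norm (y - a) > 0" using dR(1)[OF y] by linarith
    then have q0: "norm q > 0" unfolding nq using c by (intro mult_pos_pos) auto
    have "norm q powr (p - 2) \<le> (\<Sum>i\<in>Basis. plap_coeff p q i i)"
    proof -
      have ge: "norm q powr (p - 2) \<le> plap_coeff p q i i" for i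
        using p q0 by (cases "p = 2") (auto simp: plap_coeff_def)
      have "norm q powr (p - 2) \<le> plap_coeff p q e e" by (rule ge)
      also have "\<dots> \<le> (\<Sum>i\<in>Basis. plap_coeff p q i i)"
        using e ge order_trans[OF powr_ge_zero ge] by (intro member_le_sum) auto
      finally show ?thesis .
    qed
    then have "2 * c * norm q powr (p - 2) \<le> 2 * c * (\<Sum>i\<in>Basis. plap_coeff p q i i)"
      using c by (intro mult_left_mono) auto
    moreover have "lin_op (plap_coeff p q) H y = - (2 * c * (\<Sum>i\<in>Basis. plap_coeff p q i i))"
      unfolding H_def lin_op_cmult[OF real_polynomial_norm_sq] lin_op_norm_sq by simp
    moreover have "(p - 1) * norm q powr p \<le> c * norm q powr (p - 2)"
    proof -
      have "norm q powr p = norm q powr (p - 2) * (norm q)\<^sup>2"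
      proof -
        have "norm q powr (p - 2) * norm q powr 2 = norm q powr p"
          unfolding powr_add[symmetric] by simp
        then show ?thesis using q0 by (simp add: powr_numeral)
      qed
      moreover have "(p - 1) * (norm q)\<^sup>2 \<le> c"
      proof -
        have "(norm (y - a))\<^sup>2 \<le> R\<^sup>2" using dR[OF y] by (intro power_mono) auto
        then have "(p - 1) * (4 * c\<^sup>2 * (norm (y - a))\<^sup>2) \<le> (p - 1) * (4 * c\<^sup>2 * R\<^sup>2)"
          using p by (intro mult_left_mono) auto
        also have "\<dots> = c * (4 * (p - 1) * R\<^sup>2 * c)" by (simp add: power2_eq_square algebra_simps)
        also have "\<dots> = c" using p R1 by (simp add: c_def)
        finally show ?thesis by (simp add: nq power_mult_distrib)
      qed
      then have "norm q powr (p - 2) * ((p - 1) * (norm q)\<^sup>2) \<le> norm q powr (p - 2) * c"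
        by (intro mult_left_mono) auto
      ultimately show ?thesis by (simp add: mult_ac)
    qed
    moreover have "\<Lambda> \<le> c * norm q powr (p - 2)"
      unfolding \<Lambda>_def using c p dR(1)[OF y] by (intro mult_left_mono powr_mono2) (auto simp: nq)
    ultimately show ?thesis by (simp add: log_plap_def flip: q_def)
  qed
  show ?thesis
    unfolding log_supersolution_def
  proof (intro exI[of _ H] exI[of _ \<Lambda>] conjI ballI allI impI polyH)
    show "\<Lambda> > 0" using c by (simp add: \<Lambda>_def)
    \<comment> \<open>A classical supersolution is one in the viscosity sense: H - G has a minimum
      at y, so the gradients agree and ellipticity compares the second-order parts.\<close>
    fix y G assume y: "y \<in> \<Omega>" and G: "real_polynomial_function G" "exp (G y) = exp (H y)"
      and ev: "\<forall>\<^sub>F x in nhds y. exp (G x) \<le> exp (H x)"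
    have poly: "real_polynomial_function (\<lambda>x. H x - G x)"
      by (rule real_polynomial_function_diff[OF polyH G(1)])
    have min: "local_min_at (\<lambda>x. H x - G x) y"
      unfolding local_min_at_def using ev by (rule eventually_mono) (use G(2) in auto)
    have "partial i G y = partial i H y" if "i \<in> Basis" for i
      using real_polynomial_local_min(1)[OF poly min that] polyH G(1)
      by (simp add: partial_diff real_polynomial_differentiable)
    then have g: "gradient G y = gradient H y" by (simp add: gradient_def)
    have "0 \<le> lin_op (plap_coeff p (gradient H y)) (\<lambda>x. H x - G x) y"
      by (rule lin_op_local_min[OF elliptic_plap_coeff[OF p] poly min])
    then have "log_plap p G y \<le> log_plap p H y"
      by (simp add: log_plap_def g lin_op_diff[OF polyH G(1)])
    then show "log_plap p G y \<le> - \<Lambda>" using logH[OF y] by simp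
  qed
qed

lemma C2_on_exp:
  fixes H :: "'a::euclidean_space \<Rightarrow> real"
  assumes H: "real_polynomial_function H"
  shows "C2_on S (\<lambda>x. exp (H x))"
proof -
  have "(\<lambda>x. partial i H x * exp (H x)) differentiable at x" for i x
    by (intro differentiable_mult real_polynomial_exp_differentiable
        real_polynomial_differentiable real_polynomial_partial H)
  moreover have "continuous_on S H" "continuous_on S (partial i H)"
      "continuous_on S (partial i (partial j H))" for i j
    by (intro real_polynomial_continuous_on real_polynomial_partial H)+
  ultimately show ?thesis
    unfolding C2_on_def partial_partial_exp_polynomial[OF H] unfolding partial_exp_polynomial[OF H]
    by (auto simp: real_polynomial_exp_differentiable[OF H] intro!: continuous_intros)
qed

text \<open>At contact v^(p-1) = exp ((p-1) H y), a positive factor common to both terms of the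
  inequality.\<close>

lemma eigen_viscosity_solution_log_supersolution:
  assumes v: "eigen_viscosity_solution p \<mu> \<Omega> v" and p: "p \<ge> 2"
  shows "log_supersolution p \<mu> \<Omega> v"
  unfolding log_supersolution_def
proof (intro ballI allI impI)
  fix y H
  assume y: "y \<in> \<Omega>" and H: "real_polynomial_function H" "exp (H y) = v y"
    "\<forall>\<^sub>F x in nhds y. exp (H x) \<le> v x"
  have "local_min_at (\<lambda>x. v x - exp (H x)) y"
    unfolding local_min_at_def using H(3) by (rule eventually_mono) (simp add: H(2))
  then have "p_laplacian p (\<lambda>x. exp (H x)) y + \<mu> * v y powr (p - 1) \<le> 0"
    using v y C2_on_exp[OF H(1)] unfolding eigen_viscosity_solution_def by blast
  then have "exp ((p - 1) * H y) * (log_plap p H y + \<mu>) \<le> 0"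
    by (simp add: p_laplacian_exp[OF H(1) p] H(2)[symmetric] powr_def algebra_simps)
  then show "log_plap p H y \<le> - \<mu>" by (simp add: mult_le_0_iff)
qed

section \<open>Logarithmic rates in the extended reals\<close>

lemma elog_le_ln:
  assumes "S \<le> ereal D" "D > 0"
  shows "elog S \<le> ereal (ln D)"
  using assms by (cases S) (auto simp: elog_def)

text \<open>The constant D costs ln D / t, which is eventually below the margin m - m'.\<close>

lemma Limsup_elog_le:
  fixes S :: "real \<Rightarrow> ereal"
  assumes S: "\<And>t. T \<le> t \<Longrightarrow> S t \<le> ereal (D * exp (- m * t))" and D: "D > 0" and m: "m' < m"
  shows "Limsup at_top (\<lambda>t. elog (S t) / ereal t) \<le> ereal (- m')"
proof (rule Limsup_bounded)
  have "((\<lambda>t. ln D / t) \<longlongrightarrow> 0) at_top"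
    by (intro tendsto_divide_0[OF tendsto_const] filterlim_at_top_imp_at_infinity filterlim_ident)
  then have "\<forall>\<^sub>F t in at_top. ln D / t < m - m'"
    using m by (intro order_tendstoD(2)) auto
  then show "\<forall>\<^sub>F t in at_top. elog (S t) / ereal t \<le> ereal (- m')"
    using eventually_gt_at_top[of 0] eventually_ge_at_top[of T]
  proof eventually_elim
    case (elim t)
    have "elog (S t) \<le> ereal (ln (D * exp (- m * t)))"
      using S[OF elim(3)] D by (intro elog_le_ln) auto
    also have "ln (D * exp (- m * t)) = ln D - m * t" using D by (simp add: ln_mult)
    finally have "elog (S t) / ereal t \<le> ereal (ln D - m * t) / ereal t"
      using elim(2) by (intro ereal_divide_right_mono) auto
    also have "\<dots> = ereal (ln D / t - m)" using elim(2) by (simp add: diff_divide_distrib)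
    also have "\<dots> \<le> ereal (- m')" using elim(1) by simp
    finally show ?case .
  qed
qed

text \<open>Multiplied by c, the bound reads \<mu> \<le> - L c for each \<mu> in E and so passes to
  the supremum. The cases cover infinite values: an unbounded E forces L to be minus
  infinity.\<close>

lemma ereal_le_neg_SUP_divide:
  fixes L :: ereal
  assumes c: "c > 0" and le: "\<And>\<mu>. \<mu> \<in> E \<Longrightarrow> L \<le> ereal (- \<mu> / c)"
  shows "L \<le> - (SUP \<mu>\<in>E. ereal \<mu>) / ereal c"
proof -
  have "(SUP \<mu>\<in>E. ereal \<mu>) \<le> - L * ereal c"
  proof (rule SUP_least)
    fix \<mu> assume "\<mu> \<in> E"
    from le[OF this] show "ereal \<mu> \<le> - L * ereal c"
      using c by (cases L) (auto simp: field_simps)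
  qed
  then show ?thesis
    using c by (cases L; cases "SUP \<mu>\<in>E. ereal \<mu>") (auto simp: field_simps)
qed

theorem theorem1p1:
  fixes p \<delta> :: real
    and \<Omega> :: "(real ^ 'n) set"
    and f :: "real ^ 'n \<Rightarrow> real"
    and g h u :: "(real ^ 'n) \<times> real \<Rightarrow> real"
  assumes "2 \<le> p"
    and "CARD('n) \<ge> 2"
    and "\<Omega> \<noteq> {}" "open \<Omega>" "connected \<Omega>" "bounded \<Omega>"
    and "continuous_boundary_data \<Omega> f g h"
    and "\<forall>z\<in>parabolic_boundary \<Omega>. 0 \<le> h z"
    and "bdd_above (h ` parabolic_boundary \<Omega>)"
    and "\<forall>z\<in>space_time \<Omega> \<union> parabolic_boundary \<Omega>. 0 \<le> u z"
    and "upper_semicontinuous_on (space_time \<Omega> \<union> parabolic_boundary \<Omega>) u"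
    and "viscosity_subsolution p \<Omega> u"
    and "\<forall>z\<in>parabolic_boundary \<Omega>. u z \<le> h z"
    and "\<delta> > 0"
  shows "(((\<lambda>t. SUP x\<in>frontier \<Omega>. ereal (g (x, t))) \<longlongrightarrow> 0) at_top \<longrightarrow>
            ((\<lambda>t. SUP z\<in>\<Omega> \<times> {t..}. ereal (u z)) \<longlongrightarrow> 0) at_top)
       \<and> ((\<exists>T\<^sub>0\<ge>0. \<forall>x\<in>frontier \<Omega>. \<forall>t\<ge>T\<^sub>0. g (x, t) = 0) \<longrightarrow>
            Limsup at_top (\<lambda>t::real. elog (SUP x\<in>\<Omega>. ereal (u (x, t))) / ereal t)
              \<le> - first_eigenvalue p \<delta> \<Omega> / ereal (p - 1))"
proof -
  note p = assms(1) and open\<Omega> = assms(4) and bd\<Omega> = assms(6)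
  define K where "K = closure \<Omega>"
  have K: "compact K" "K \<noteq> {}" using bd\<Omega> assms(3) by (auto simp: K_def compact_closure)
  have \<Omega>K: "\<Omega> \<subseteq> K" by (simp add: K_def closure_subset)
  have K_eq: "K = \<Omega> \<union> frontier \<Omega>"
    using open\<Omega> closure_Un_frontier by (auto simp: K_def)
  have "space_time \<Omega> \<union> parabolic_boundary \<Omega> = K \<times> {0..}"
    using K_eq by (auto simp: space_time_def parabolic_boundary_def K_def[symmetric])
  then have u_usc: "upper_semicontinuous_on (closure \<Omega> \<times> {0..}) u"
    and u0: "\<forall>z\<in>closure \<Omega> \<times> {0..}. 0 \<le> u z"
    using assms(10,11) by (auto simp: K_def)
  have front: "(x, t) \<in> parabolic_boundary \<Omega>" if "x \<in> frontier \<Omega>" "0 \<le> t" for x t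
    using that by (auto simp: parabolic_boundary_def frontier_def)
  have ug: "u (x, t) \<le> g (x, t)" if "x \<in> frontier \<Omega>" "0 \<le> t" for x t
    using assms(7,13) front[OF that] that unfolding continuous_boundary_data_def by metis
  obtain B where B: "B \<ge> 1" "\<And>z. z \<in> parabolic_boundary \<Omega> \<Longrightarrow> u z \<le> B"
  proof -
    obtain B0 where "\<And>z. z \<in> parabolic_boundary \<Omega> \<Longrightarrow> h z \<le> B0"
      using assms(9) by (auto simp: bdd_above_def)
    then show ?thesis using that[of "max 1 B0"] assms(13) by fastforce
  qed
  note compare = parabolic_comparison[OF open\<Omega> bd\<Omega> p _ u_usc u0 assms(12)]
  obtain H \<Lambda> where H: "real_polynomial_function H" "\<Lambda> > 0"
    and barrier: "log_supersolution p \<Lambda> \<Omega> (\<lambda>x. exp (H x))"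
    using barrier_exists[OF bd\<Omega> p] by blast
  define v where "v x = exp (H x)" for x
  have contv: "continuous_on K v"
    unfolding v_def by (intro continuous_intros real_polynomial_continuous_on H)
  have vpos: "0 < v x" for x by (simp add: v_def)
  obtain x1 where x1: "x1 \<in> K" "\<And>x. x \<in> K \<Longrightarrow> v x1 \<le> v x"
    using continuous_attains_inf[OF K contv] by blast
  obtain x2 where x2: "x2 \<in> K" "\<And>x. x \<in> K \<Longrightarrow> v x \<le> v x2"
    using continuous_attains_sup[OF K contv] by blast
  note compare_v = compare[OF _ contv[unfolded K_def] ballI[OF vpos] barrier[folded v_def]]
  \<comment> \<open>The multiple B / v x1 of v is at least B on K, and M is its largest value
    there.\<close>
  define M where "M = B / v x1 * v x2"
  have M1: "M \<ge> 1"
  proof -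
    have "v x1 \<le> v x2" using x1 x2 by blast
    then have "1 * 1 \<le> B * (v x2 / v x1)" using B(1) vpos[of x1] by (intro mult_mono) auto
    then show ?thesis by (simp add: M_def)
  qed
  \<comment> \<open>Comparison with rate 0, admissible because \<Lambda> > 0. The resulting bound
    for all times serves as initial bound whenever a comparison is started later.\<close>
  have bounded: "u (x, t) \<le> M" if x: "x \<in> K" and t: "0 \<le> t" for x t
  proof -
    have ge: "B \<le> B / v x1 * v y" if "y \<in> K" for y
      using x1(2)[OF that] vpos[of x1] B(1) by (simp add: field_simps)
    have "u (x, t) \<le> B / v x1 * v x * exp (- 0 * t)"
    proof (rule compare_v[where m = 0 and ?t0.0 = 0])
      show "u (y, 0) \<le> B / v x1 * v y * exp (- 0 * 0)" if "y \<in> closure \<Omega>" for y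
      proof -
        have "u (y, 0) \<le> B" using that by (intro B(2)) (auto simp: parabolic_boundary_def)
        then show ?thesis using ge[of y] that by (simp add: K_def)
      qed
      show "u (y, s) \<le> B / v x1 * v y * exp (- 0 * s)" if "y \<in> frontier \<Omega>" "0 \<le> s" for y s
        using B(2)[OF front[OF that]] ge[of y] that(1) K_eq by simp
    qed (use H(2) t x B(1) vpos in \<open>auto simp: K_def\<close>)
    also have "\<dots> = B / v x1 * v x" by simp
    also have "\<dots> \<le> M"
      unfolding M_def using x2(2)[OF x] B(1) vpos[of x1] by (intro mult_left_mono) auto
    finally show ?thesis .
  qed
  have part1: "((\<lambda>t. SUP z\<in>\<Omega> \<times> {t..}. ereal (u z)) \<longlongrightarrow> 0) at_top"
    if lim: "((\<lambda>t. SUP x\<in>frontier \<Omega>. ereal (g (x, t))) \<longlongrightarrow> 0) at_top"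
  proof -
    define m where "m = \<Lambda> / (2 * (p - 1))"
    have "(p - 1) * m = \<Lambda> / 2" using p by (simp add: m_def field_simps)
    then have m: "m > 0" "(p - 1) * m < \<Lambda>" using H(2) p by (simp add: m_def, linarith)
    define Q where "Q = exp m * v x2 / v x1"
    have Q: "Q > 0" using vpos by (simp add: Q_def)
    have decay: "\<exists>T. \<forall>t\<ge>T. \<forall>x\<in>K. u (x, t) \<le> Q * \<epsilon>" if \<epsilon>: "0 < \<epsilon>" "\<epsilon> \<le> M" for \<epsilon>
    proof -
      have "\<forall>\<^sub>F t in at_top. (SUP x\<in>frontier \<Omega>. ereal (g (x, t))) < ereal \<epsilon>"
        using lim \<epsilon>(1) by (intro order_tendstoD(2)[OF lim]) simp
      then obtain T1 where T1: "\<And>t. t \<ge> T1 \<Longrightarrow> (SUP x\<in>frontier \<Omega>. ereal (g (x, t))) < ereal \<epsilon>"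
        unfolding eventually_at_top_linorder by blast
      have g\<epsilon>: "g (x, t) \<le> \<epsilon>" if "t \<ge> T1" "x \<in> frontier \<Omega>" for x t
      proof -
        have "ereal (g (x, t)) \<le> (SUP x\<in>frontier \<Omega>. ereal (g (x, t)))"
          using that(2) by (rule SUP_upper)
        then have "ereal (g (x, t)) < ereal \<epsilon>" using T1[OF that(1)] by (rule le_less_trans)
        then show ?thesis by simp
      qed
      \<comment> \<open>The waiting time after which decay at rate m brings M down to \<epsilon>; it
        is nonnegative because \<epsilon> \<le> M.\<close>
      define \<tau> where "\<tau> = ln (M / \<epsilon>) / m"
      have \<tau>: "\<tau> \<ge> 0" using \<epsilon> m(1) by (simp add: \<tau>_def)
      have exp\<tau>: "M * exp (- m * \<tau>) = \<epsilon>"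
      proof -
        have "exp (- m * \<tau>) = exp (- ln (M / \<epsilon>))" using m(1) by (simp add: \<tau>_def)
        also have "\<dots> = \<epsilon> / M" using \<epsilon> by (simp add: exp_minus)
        finally show ?thesis using \<epsilon> by simp
      qed
      have "u (x, t) \<le> Q * \<epsilon>" if t: "t \<ge> max 0 T1 + \<tau>" and x: "x \<in> K" for x t
      proof -
        define s where "s = t - \<tau>"
        have s: "0 \<le> s" "T1 \<le> s" "s \<le> t" using t \<tau> by (auto simp: s_def)
        \<comment> \<open>The comparison starts at s with values up to M. Its lateral condition
          extends to t + 1, one unit past the waiting time; the factor exp m keeps the barrier at
          least \<epsilon> up to there.\<close>
        define C where "C = M * exp m * exp (m * s) / v x1"
        have C: "C > 0" using M1 vpos by (simp add: C_def)
        have lower: "M * exp m * exp (- m * (r - s)) \<le> C * v y * exp (- m * r)" if "y \<in> K" for y r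
        proof -
          have "M * exp m * exp (- m * (r - s)) * 1 \<le> M * exp m * exp (- m * (r - s)) * (v y / v x1)"
            using x1(2)[OF that] vpos[of x1] M1 by (intro mult_left_mono) auto
          also have "\<dots> = C * v y * exp (- m * r)"
            by (simp add: C_def exp_diff exp_minus field_simps)
          finally show ?thesis by simp
        qed
        have "u (x, t) \<le> C * v x * exp (- m * t)"
        proof (rule compare_v[OF m(2) s(1,3) C])
          show "u (y, s) \<le> C * v y * exp (- m * s)" if "y \<in> closure \<Omega>" for y
          proof -
            have "u (y, s) \<le> M" using that s by (intro bounded) (auto simp: K_def)
            also have "M * 1 \<le> M * exp m" using M1 m(1) by (intro mult_left_mono) auto
            then have "M \<le> M * exp m * exp (- m * (s - s))" by simp
            also have "\<dots> \<le> C * v y * exp (- m * s)" using that by (intro lower) (simp add: K_def)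
            finally show ?thesis .
          qed
          show "u (y, r) \<le> C * v y * exp (- m * r)" if y: "y \<in> frontier \<Omega>" and r: "s \<le> r" "r \<le> t + 1" for y r
          proof -
            have "u (y, r) \<le> \<epsilon>"
              using ug[OF y, of r] g\<epsilon>[OF _ y, of r] r s by simp
            also have "\<epsilon> = M * exp (- m * \<tau>)" by (rule exp\<tau>[symmetric])
            also have "\<dots> \<le> M * (exp m * exp (- m * (r - s)))"
            proof -
              have "m * (r - s) \<le> m * (\<tau> + 1)" using r(2) m(1) by (intro mult_left_mono) (auto simp: s_def)
              then have "- m * \<tau> \<le> m + - m * (r - s)" by (simp add: algebra_simps)
              then show ?thesis using M1 unfolding exp_add[symmetric] by (intro mult_left_mono) auto
            qed
            also have "\<dots> \<le> C * v y * exp (- m * r)"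
              using lower[of y r] y K_eq by (simp add: mult.assoc)
            finally show ?thesis .
          qed
          show "x \<in> closure \<Omega>" using x by (simp add: K_def)
        qed
        also have "\<dots> \<le> C * v x2 * exp (- m * t)"
          using x2(2)[OF x] C by (intro mult_right_mono mult_left_mono) auto
        also have "\<dots> = Q * (M * exp (- m * \<tau>))"
        proof -
          have "exp (m * s) * exp (- m * t) = exp (- m * \<tau>)"
            unfolding exp_add[symmetric] by (simp add: s_def algebra_simps)
          then have "C * v x2 * exp (- m * t) = M * exp m / v x1 * v x2 * exp (- m * \<tau>)"
            by (simp add: C_def field_simps)
          then show ?thesis by (simp add: Q_def)
        qed
        finally show ?thesis by (simp only: exp\<tau>)
      qed
      then show ?thesis by blast
    qed
    show ?thesis
    proof (rule order_tendstoI)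
      fix a :: ereal assume a: "a < 0"
      obtain y where y: "y \<in> \<Omega>" using assms(3) by blast
      show "\<forall>\<^sub>F t in at_top. a < (SUP z\<in>\<Omega> \<times> {t..}. ereal (u z))"
        using eventually_ge_at_top[of 0]
      proof eventually_elim
        case (elim t)
        have "0 \<le> ereal (u (y, t))" using u0 y elim closure_subset by force
        also have "\<dots> \<le> (SUP z\<in>\<Omega> \<times> {t..}. ereal (u z))" using y by (intro SUP_upper) auto
        finally show ?case using a by simp
      qed
    next
      fix a :: ereal assume a: "0 < a"
      obtain r where r: "0 < r" "ereal r < a"
        using ereal_dense2[OF a] by (auto simp: zero_ereal_def)
      define \<epsilon> where "\<epsilon> = min M (r / Q)"
      have \<epsilon>: "0 < \<epsilon>" "\<epsilon> \<le> M" "Q * \<epsilon> \<le> r"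
        using M1 r(1) Q by (auto simp: \<epsilon>_def min_def field_simps)
      obtain T where T: "\<And>t x. t \<ge> T \<Longrightarrow> x \<in> K \<Longrightarrow> u (x, t) \<le> Q * \<epsilon>"
        using decay[OF \<epsilon>(1,2)] by blast
      show "\<forall>\<^sub>F t in at_top. (SUP z\<in>\<Omega> \<times> {t..}. ereal (u z)) < a"
        using eventually_ge_at_top[of T]
      proof eventually_elim
        case (elim t)
        have "(SUP z\<in>\<Omega> \<times> {t..}. ereal (u z)) \<le> ereal r"
        proof (rule SUP_least)
          fix z assume "z \<in> \<Omega> \<times> {t..}"
          then show "ereal (u z) \<le> ereal r"
            using T[of "snd z" "fst z"] elim \<epsilon>(3) \<Omega>K by (cases z) force
        qed
        then show ?case using r(2) by simp
      qed
    qed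
  qed
  have part2: "Limsup at_top (\<lambda>t::real. elog (SUP x\<in>\<Omega>. ereal (u (x, t))) / ereal t) \<le> ereal (- \<mu> / (p - 1))"
    (is "?L \<le> _")
    if T: "T \<ge> 0" "\<forall>x\<in>frontier \<Omega>. \<forall>t\<ge>T. g (x, t) = 0" and \<mu>: "\<mu> \<in> eigen_set p \<delta> \<Omega>" for T \<mu>
  proof -
    obtain e where e: "continuous_on (closure \<Omega>) e" "\<forall>x\<in>closure \<Omega>. 0 < e x"
      "eigen_viscosity_solution p \<mu> \<Omega> e"
      using \<mu> by (auto simp: eigen_set_def)
    obtain y1 where y1: "y1 \<in> K" "\<And>x. x \<in> K \<Longrightarrow> e y1 \<le> e x"
      using continuous_attains_inf[OF K e(1)[folded K_def]] by blast
    obtain y2 where y2: "y2 \<in> K" "\<And>x. x \<in> K \<Longrightarrow> e x \<le> e y2"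
      using continuous_attains_sup[OF K e(1)[folded K_def]] by blast
    have epos: "0 < e x" if "x \<in> K" for x using e(2) that by (simp add: K_def)
    have rate: "?L \<le> ereal (- m')" if m': "m' < \<mu> / (p - 1)" for m'
    proof -
      \<comment> \<open>Two margins are spent: m < \<mu> / (p - 1) on the strict gap in the
        comparison, m' < m on the constant in the limit superior. For \<mu> = 0 the rate m is
        negative, which the comparison allows.\<close>
      obtain m where m: "m' < m" "m < \<mu> / (p - 1)" using dense[OF m'] by blast
      have gap: "(p - 1) * m < \<mu>" using m(2) p by (simp add: field_simps)
      \<comment> \<open>The factor exp (m T) makes the barrier equal to M e / e y1, hence at least
        M, at the starting time T.\<close>
      define C where "C = M / e y1 * exp (m * T)"
      have C: "C > 0" using M1 epos[OF y1(1)] by (simp add: C_def)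
      have decay: "u (x, t) \<le> C * e x * exp (- m * t)" if x: "x \<in> K" and t: "T \<le> t" for x t
      proof (rule compare[OF gap e(1,2) eigen_viscosity_solution_log_supersolution[OF e(3) p] T(1) t C])
        show "u (y, T) \<le> C * e y * exp (- m * T)" if "y \<in> closure \<Omega>" for y
        proof -
          have yK: "y \<in> K" using that by (simp add: K_def)
          have "u (y, T) \<le> M" using bounded[OF yK T(1)] .
          also have "M \<le> M / e y1 * e y"
            using y1(2)[OF yK] epos[OF y1(1)] M1 by (simp add: field_simps)
          also have "\<dots> = C * e y * exp (- m * T)"
            by (simp add: C_def exp_minus field_simps)
          finally show ?thesis .
        qed
        show "u (y, s) \<le> C * e y * exp (- m * s)" if "y \<in> frontier \<Omega>" "T \<le> s" for y s
        proof -
          have "u (y, s) \<le> 0" using ug[of y s] that T by auto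
          also have "0 \<le> C * e y * exp (- m * s)"
            using C epos[of y] that(1) K_eq by (auto intro: less_imp_le)
          finally show ?thesis .
        qed
        show "x \<in> closure \<Omega>" using x by (simp add: K_def)
      qed
      show ?thesis
      proof (rule Limsup_elog_le[where D = "C * e y2" and T = T, OF _ _ m(1)])
        show "0 < C * e y2" using C epos[OF y2(1)] by simp
        fix t assume t: "T \<le> t"
        show "(SUP x\<in>\<Omega>. ereal (u (x, t))) \<le> ereal (C * e y2 * exp (- m * t))"
        proof (rule SUP_least)
          fix x assume "x \<in> \<Omega>"
          then have x: "x \<in> K" using \<Omega>K by blast
          have "u (x, t) \<le> C * e x * exp (- m * t)" by (rule decay[OF x t])
          also have "\<dots> \<le> C * e y2 * exp (- m * t)"
            using y2(2)[OF x] C by (intro mult_right_mono mult_left_mono) auto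
          finally show "ereal (u (x, t)) \<le> ereal (C * e y2 * exp (- m * t))" by simp
        qed
      qed
    qed
    \<comment> \<open>As m' was arbitrary below \<mu> / (p - 1), a real number strictly between the
      two sides would contradict \<open>rate\<close>.\<close>
    show ?thesis
    proof (rule ccontr)
      assume "\<not> ?thesis"
      then have "ereal (- \<mu> / (p - 1)) < ?L" by (simp only: not_le)
      from ereal_dense2[OF this] obtain r where r: "- \<mu> / (p - 1) < r" "ereal r < ?L"
        by auto
      then show False using rate[of "- r"] by simp
    qed
  qed
  show ?thesis
    unfolding first_eigenvalue_def
  proof (intro conjI impI part1; (elim exE conjE)?)
    fix T assume "0 \<le> T" "\<forall>x\<in>frontier \<Omega>. \<forall>t\<ge>T. g (x, t) = 0"
    then show "Limsup at_top (\<lambda>t::real. elog (SUP x\<in>\<Omega>. ereal (u (x, t))) / ereal t)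
        \<le> - (SUP \<mu>\<in>eigen_set p \<delta> \<Omega>. ereal \<mu>) / ereal (p - 1)"
      using p by (intro ereal_le_neg_SUP_divide part2) auto
  qed
qed

end
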